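(* Let $S$ be a complete separable metric space, let $X=(X(t):t\ge 0)$ be an $S$-valued Markov process that is $v$-geometrically ergodic with limiting probability $\pi$, and let $f:S\to\mathbb{R}_+$ be bounded and continuous. Let $X(\infty)$ denote an $S$-valued random variable with distribution $\pi$, and suppose $\lambda^*:=\mathbb{E} f(X(\infty))>0$. For $\epsilon>0$ let $N_\epsilon$ be a doubly stochastic Poisson process with stochastic intensity $\lambda_\epsilon(t)=f(X(t/\epsilon))$, and let $N_0$ be a Poisson process with constant rate $\lambda^*$. Let $V=(V_n:n\ge 1)$ be an iid sequence of service times, independent of the arrival processes, such that $V_1$ has a density $\kappa=(\kappa(u):u\ge 0)$, and set $\bar K(u)=P(V_1>u)$. Let $Q_\epsilon=(Q_\epsilon(t):t\ge 0)$ (respectively $Q_0=(Q_0(t):t\ge 0)$) be the number-in-system process of the infinite-server queue that starts empty at time $0$, with arrival process $N_\epsilon$ (respectively $N_0$) and service time sequence $V$. Put $f_c(y)=f(y)-\mathbb{E} f(X(\infty))$, $$g(y)=\int_0^\infty\mathbb{E}_y f_c(X(s))\,ds,\qquad \sigma^2=2\,\mathbb{E}\big[f_c(X(\infty))g(X(\infty))\big],$$ and, for $t>0$, $$\eta^2=2\sigma^2\int_0^t\bar K(s)\kappa(s)\,s\,ds+\sigma^2t\,\bar K(t)^2.$$ Then for every $x\in S$, $t>0$ and integer $k\ge 0$, $$P_x(Q_\epsilon(t)=k)=P(Q_0(t)=k)\left(1+\epsilon\left[\left(\frac{k}{\mathbb{E} Q_0(t)}-1\right)g(x)\bar K(t)+\frac12\left(1-\frac{2k}{\mathbb{E}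 Q_0(t)}+\frac{k(k-1)}{(\mathbb{E} Q_0(t))^2}\right)\eta^2\right]+o(\epsilon)\right)$$ as $\epsilon\downarrow 0$.
   Context: An $S$-valued (time-homogeneous) Markov process $X$ is $v$-geometrically ergodic if there exist a measurable function $v:S\to[1,\infty)$, a probability $\pi$ on $S$, $d<\infty$ and $\alpha>0$ such that $$\sup_{|h|\le v}\Big|\mathbb{E}_x h(X(t))-\int_S h(y)\,\pi(dy)\Big|\le d\,v(x)e^{-\alpha t}$$ for all $t\ge 0$ and $x\in S$, where the supremum is over measurable $h$ with $|h|\le v$ pointwise. Here $P_x(\cdot)=P(\,\cdot\mid X(0)=x)$ and $\mathbb{E}_x(\cdot)=\mathbb{E}(\,\cdot\mid X(0)=x)$. Under $v$-geometric ergodicity the integral defining $g$ converges absolutely and $|g|$ is bounded by a multiple of $v$. A doubly stochastic Poisson process with stochastic intensity $\lambda_\epsilon$ is a point process that, conditional on $X$, is a Poisson process with intensity function $s\mapsto\lambda_\epsilon(s)$. In the infinite-server queue, the $n$-th arriving customer, arriving at time $T_n$, immediately begins service and leaves at time $T_n+V_n$; the number in system at time $t$ is $\#\{n: T_n\le t<T_n+V_n\}$. $o(\epsilon)$ denotes a function of $\epsilon$ with $o(\epsilon)/\epsilon\to 0$ as $\epsilon\downarrow 0$. *)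

theory Defs
  imports "HOL-Probability.Probability"
begin

definition generated :: "'w measure \<Rightarrow> 'b measure \<Rightarrow> ('i \<Rightarrow> 'w \<Rightarrow> 'b) \<Rightarrow> 'i set \<Rightarrow> 'w measure"
  where "generated M K Y I =
    sigma (space M) (\<Union>i\<in>I. {Y i -` A \<inter> space M | A. A \<in> sets K})"

text \<open>\<open>M\<close> is the underlying probability space and \<open>P\<close> is the regular version of the conditional law
  given \<open>X(0)\<close>: a probability kernel, \<open>P x\<close> being concentrated on \<open>X(0) = x\<close>, with
  \<open>M = \<integral> P x \<mu>(dx)\<close> where \<open>\<mu>\<close> is the law of \<open>X(0)\<close> under \<open>M\<close>.  The transition probabilities are
  \<open>A \<mapsto> P y (X t \<in> A)\<close>, so the Markov property below includes time homogeneity.  Joint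
  measurability of the paths is what makes \<open>s \<mapsto> f (X (s / \<epsilon>))\<close> an admissible intensity.\<close>

definition markov_process ::
    "'w measure \<Rightarrow> ('s::polish_space \<Rightarrow> 'w measure) \<Rightarrow> (real \<Rightarrow> 'w \<Rightarrow> 's) \<Rightarrow> bool"
  where "markov_process M P X \<longleftrightarrow>
    prob_space M \<and>
    (\<lambda>(t, \<omega>). X t \<omega>) \<in> borel_measurable (restrict_space borel {0..} \<Otimes>\<^sub>M M) \<and>
    P \<in> borel \<rightarrow>\<^sub>M prob_algebra M \<and>
    M = distr M borel (X 0) \<bind> P \<and>
    (\<forall>x. AE \<omega> in P x. X 0 \<omega> = x) \<and>
    (\<forall>x. \<forall>s\<ge>0. \<forall>t\<ge>0. \<forall>A\<in>sets borel. AE \<omega> in P x.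
       real_cond_exp (P x) (generated (P x) borel X {0..s})
         (indicator {\<omega> \<in> space M. X (s + t) \<omega> \<in> A}) \<omega>
       = measure (P (X s \<omega>)) {\<omega>' \<in> space M. X t \<omega>' \<in> A})"

text \<open>Although Bochner integrals of non-integrable functions are 0, no integrability clause is needed:
  applying the bound at \<open>t = 0\<close> to \<open>h = min v n\<close> gives \<open>\<integral> min v n d\<pi> \<le> (1 + d) v(x)\<close> for all \<open>n\<close>, so
  \<open>v\<close> is \<open>\<pi>\<close>-integrable, and likewise \<open>v (X t)\<close> is integrable under each \<open>P x\<close>.\<close>

definition geometrically_ergodic ::
    "('s::polish_space \<Rightarrow> 'w measure) \<Rightarrow> (real \<Rightarrow> 'w \<Rightarrow> 's) \<Rightarrow> ('s \<Rightarrow> real) \<Rightarrow> 's measure \<Rightarrow> bool"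
  where "geometrically_ergodic P X v \<pi> \<longleftrightarrow>
    v \<in> borel_measurable borel \<and> (\<forall>y. 1 \<le> v y) \<and>
    prob_space \<pi> \<and> sets \<pi> = sets borel \<and>
    (\<exists>d \<alpha>. 0 < \<alpha> \<and>
      (\<forall>t\<ge>0. \<forall>x.
        (SUP h \<in> {h \<in> borel_measurable borel. \<forall>y. \<bar>h y\<bar> \<le> v y}.
           ereal \<bar>(\<integral>\<omega>. h (X t \<omega>) \<partial>P x) - (\<integral>y. h y \<partial>\<pi>)\<bar>)
        \<le> ereal (d * v x * exp (- \<alpha> * t))))"

text \<open>\<open>N t\<close> is the number of arrivals in \<open>{0<..t}\<close>; jumps larger than 1 are not excluded a priori.\<close>

definition counting_process :: "'w measure \<Rightarrow> (real \<Rightarrow> 'w \<Rightarrow> nat) \<Rightarrow> bool"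
  where "counting_process M N \<longleftrightarrow>
    (\<forall>t\<ge>0. N t \<in> M \<rightarrow>\<^sub>M count_space UNIV) \<and>
    (\<forall>\<omega>\<in>space M. N 0 \<omega> = 0 \<and> mono_on {0..} (\<lambda>t. N t \<omega>) \<and>
       (\<forall>t\<ge>0. continuous (at_right t) (\<lambda>s. N s \<omega>)))"

text \<open>The library's \<^const>\<open>poisson_pmf\<close> is specified only for positive rates, whereas a stochastic
  intensity may vanish on an interval.\<close>

definition poisson_mass :: "real \<Rightarrow> nat \<Rightarrow> real"
  where "poisson_mass r k = r ^ k / fact k * exp (- r)"

definition poisson_process :: "'w measure \<Rightarrow> real \<Rightarrow> (real \<Rightarrow> 'w \<Rightarrow> nat) \<Rightarrow> bool"
  where "poisson_process M r N \<longleftrightarrow>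
    counting_process M N \<and>
    (\<forall>\<tau>::nat \<Rightarrow> real. \<forall>n. 0 \<le> \<tau> 0 \<and> mono \<tau> \<longrightarrow>
       prob_space.indep_vars M (\<lambda>_. count_space UNIV)
         (\<lambda>i \<omega>. N (\<tau> (Suc i)) \<omega> - N (\<tau> i) \<omega>) {..<n}) \<and>
    (\<forall>s t k. 0 \<le> s \<and> s \<le> t \<longrightarrow>
       measure M {\<omega> \<in> space M. N t \<omega> - N s \<omega> = k} = poisson_mass (r * (t - s)) k)"

text \<open>The Cox process condition: given \<open>G\<close>, \<open>N\<close> is Poisson with intensity \<open>\<Lambda>\<close>, expressed
  through the joint conditional law of the increments over adjacent intervals.\<close>

definition doubly_stochastic_poisson ::
    "'w measure \<Rightarrow> 'w measure \<Rightarrow> (real \<Rightarrow> 'w \<Rightarrow> real) \<Rightarrow> (real \<Rightarrow> 'w \<Rightarrow> nat) \<Rightarrow> bool"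
  where "doubly_stochastic_poisson M G \<Lambda> N \<longleftrightarrow>
    counting_process M N \<and>
    (\<forall>\<tau>::nat \<Rightarrow> real. \<forall>n. \<forall>k::nat \<Rightarrow> nat. 0 \<le> \<tau> 0 \<and> mono \<tau> \<longrightarrow>
       (AE \<omega> in M.
          real_cond_exp M G
            (indicator {\<omega> \<in> space M. \<forall>i<n. N (\<tau> (Suc i)) \<omega> - N (\<tau> i) \<omega> = k i}) \<omega>
          = (\<Prod>i<n. poisson_mass (LINT s:{\<tau> i..\<tau> (Suc i)}|lborel. \<Lambda> s \<omega>) (k i))))"

text \<open>Customers are numbered from 1.\<close>

definition service_times :: "'w measure \<Rightarrow> (nat \<Rightarrow> 'w \<Rightarrow> real) \<Rightarrow> (real \<Rightarrow> real) \<Rightarrow> bool"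
  where "service_times M V \<kappa> \<longleftrightarrow>
    prob_space.indep_vars M (\<lambda>_. borel) V {1..} \<and>
    (\<forall>n\<ge>1. distributed M lborel (V n) (\<lambda>u. ennreal (\<kappa> u) * indicator {0..} u))"

definition independent_of_arrivals ::
    "'w measure \<Rightarrow> (real \<Rightarrow> 'w \<Rightarrow> nat) \<Rightarrow> (nat \<Rightarrow> 'w \<Rightarrow> real) \<Rightarrow> bool"
  where "independent_of_arrivals M N V \<longleftrightarrow>
    prob_space.indep_set M
      (sets (generated M (count_space UNIV) N {0..})) (sets (generated M borel V {1..}))"

text \<open>The arrival time is \<open>\<infinity>\<close> if fewer than \<open>n\<close> customers ever arrive.\<close>

definition arrival_time :: "(real \<Rightarrow> 'w \<Rightarrow> nat) \<Rightarrow> nat \<Rightarrow> 'w \<Rightarrow> ereal"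
  where "arrival_time N n \<omega> = (INF t \<in> {t. 0 \<le> t \<and> n \<le> N t \<omega>}. ereal t)"

definition number_in_system ::
    "(real \<Rightarrow> 'w \<Rightarrow> nat) \<Rightarrow> (nat \<Rightarrow> 'w \<Rightarrow> real) \<Rightarrow> real \<Rightarrow> 'w \<Rightarrow> nat"
  where "number_in_system N V t \<omega> =
    card {n. 1 \<le> n \<and> arrival_time N n \<omega> \<le> ereal t \<and>
             ereal t < arrival_time N n \<omega> + ereal (V n \<omega>)}"

definition service_tail :: "'w measure \<Rightarrow> (nat \<Rightarrow> 'w \<Rightarrow> real) \<Rightarrow> real \<Rightarrow> real"
  where "service_tail M V u = measure M {\<omega> \<in> space M. u < V 1 \<omega>}"

definition centred :: "'s measure \<Rightarrow> ('s \<Rightarrow> real) \<Rightarrow> 's \<Rightarrow> real"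
  where "centred \<pi> f y = f y - (\<integral>z. f z \<partial>\<pi>)"

definition potential ::
    "('s \<Rightarrow> 'w measure) \<Rightarrow> (real \<Rightarrow> 'w \<Rightarrow> 's) \<Rightarrow> 's measure \<Rightarrow> ('s \<Rightarrow> real) \<Rightarrow> 's \<Rightarrow> real"
  where "potential P X \<pi> f y = (LINT s:{0..}|lborel. (\<integral>\<omega>. centred \<pi> f (X s \<omega>) \<partial>P y))"

definition sigma_sq ::
    "('s \<Rightarrow> 'w measure) \<Rightarrow> (real \<Rightarrow> 'w \<Rightarrow> 's) \<Rightarrow> 's measure \<Rightarrow> ('s \<Rightarrow> real) \<Rightarrow> real"
  where "sigma_sq P X \<pi> f = 2 * (\<integral>y. centred \<pi> f y * potential P X \<pi> f y \<partial>\<pi>)"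

definition eta_sq :: "real \<Rightarrow> (real \<Rightarrow> real) \<Rightarrow> (real \<Rightarrow> real) \<Rightarrow> real \<Rightarrow> real"
  where "eta_sq \<sigma>2 Kbar \<kappa> t =
    2 * \<sigma>2 * (LINT s:{0..t}|lborel. Kbar s * \<kappa> s * s) + \<sigma>2 * t * (Kbar t)\<^sup>2"

end

theory Submission
  imports Defs
begin

text \<open>
  Given its arrival intensity \<open>\<Lambda>\<close>, an infinite-server queue with doubly stochastic Poisson arrivals
  has a Poisson number of customers in the system, with mean the offered load
  \<open>\<integral>\<^sub>0\<^sup>t \<Lambda>(s) K(t - s) ds\<close>, where \<open>K\<close> is the tail of the service time.  Hence \<open>P\<^sub>x(Q\<^sub>\<epsilon>(t) = k)\<close> is the mean
  of a Poisson mass at the random load, and \<open>P(Q\<^sub>0(t) = k)\<close> is the same mass at the averaged load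
  \<open>m\<close> (\<open>number_in_system_mass\<close>).  It remains to expand \<open>E\<^sub>x \<phi>(m + \<Delta>\<^sub>\<epsilon>)\<close>, where \<open>\<phi>\<close> is the Poisson mass as a
  function of its mean and \<open>\<Delta>\<^sub>\<epsilon> = \<integral>\<^sub>0\<^sup>t f\<^sub>c(X(s / \<epsilon>)) K(t - s) ds\<close> is the fluctuation of the load.

  The Poisson law itself is found by discretising time.  On a grid of \<open>n\<close> cells the number in system
  lies between two counts in which every customer of a cell is kept according to one threshold for
  the service time (\<open>number_in_system_sandwich\<close>).  The increments of the arrival process then
  determine the generating functions of both counts (\<open>thinned_count_pgf\<close>), and because \<open>K\<close> is monotone
  the mean counts, given the intensity, differ by a telescoping sum of order \<open>1 / n\<close> (\<open>load_sandwich\<close>).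

  For the expansion, Taylor's formula reduces the claim to the moments of \<open>\<Delta>\<^sub>\<epsilon>\<close>: divided by \<open>\<epsilon>\<close>, the
  mean tends to \<open>g(x) K(t)\<close>, the second moment tends to \<open>\<sigma>\<^sup>2 \<integral>\<^sub>0\<^sup>t K(t - s)\<^sup>2 ds\<close>, and the fourth moment,
  which together with the second controls the remainder, tends to \<open>0\<close>.  All moments come from one identity.  Writing
  \<open>A(r)\<close> for the fluctuation accumulated up to time \<open>r\<close>, with integrand \<open>a\<close>,
  \<open>A(t)\<^sup>j\<^sup>+\<^sup>2 = (j + 2) (j + 1) \<integral>\<^sub>0\<^sup>t A(r)\<^sup>j a(r) \<integral>\<^sub>r\<^sup>t a(s) ds dr\<close> (\<open>primitive_power_nested\<close>).  The substitution
  \<open>s = r + \<epsilon> w\<close> extracts one factor \<open>\<epsilon>\<close>, and the Markov property at time \<open>r / \<epsilon>\<close> replaces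
  \<open>f\<^sub>c(X(r / \<epsilon> + w))\<close> by its conditional mean, which decays like \<open>v(X(r / \<epsilon>)) exp(- \<alpha> w)\<close>
  (\<open>fluctuation_moment\<close>).  This provides an integrable majorant, so limits may be taken under the
  integral: for \<open>j = 0\<close> the inner expectation converges to its stationary value, and for \<open>j = 2\<close> the
  factor \<open>A(r)\<^sup>2\<close>, itself of order \<open>\<epsilon>\<close> by the case \<open>j = 0\<close>, forces the limit \<open>0\<close>.

  Finally \<open>\<integral>\<^sub>0\<^sup>t K(s)\<^sup>2 ds = 2 \<integral>\<^sub>0\<^sup>t K(s) \<kappa>(s) s ds + t K(t)\<^sup>2\<close> by partial integration (\<open>integral_square_tail\<close>),
  which turns the limit of the second moment into \<open>\<eta>\<^sup>2\<close>, and \<open>\<phi>'\<close> and \<open>\<phi>''\<close> are \<open>\<phi>\<close> times the two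
  polynomials in \<open>k / m\<close> of the statement.
\<close>

section \<open>Primitives of Lebesgue integrable functions\<close>

lemma primitive_bound:
  fixes q :: "real \<Rightarrow> real"
  assumes [measurable]: "integrable lborel q"
  shows "\<bar>LINT r:A|lborel. q r\<bar> \<le> (\<integral>r. \<bar>q r\<bar> \<partial>lborel)"
proof (cases "set_integrable lborel A q")
  case True
  have "\<bar>LINT r:A|lborel. q r\<bar> \<le> (\<integral>r. \<bar>indicator A r *\<^sub>R q r\<bar> \<partial>lborel)"
    unfolding set_lebesgue_integral_def by (rule integral_abs_bound)
  also have "\<dots> \<le> (\<integral>r. \<bar>q r\<bar> \<partial>lborel)"
    using True assms by (intro integral_mono) (auto simp: set_integrable_def indicator_def)
  finally show ?thesis .
next
  case False
  then show ?thesis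
    by (auto simp: set_lebesgue_integral_def set_integrable_def not_integrable_integral_eq)
qed

lemma borel_measurable_primitive [measurable]:
  fixes q :: "real \<Rightarrow> real"
  assumes [measurable]: "q \<in> borel_measurable borel"
  shows "(\<lambda>s. LINT r:{0..s}|lborel. q r) \<in> borel_measurable borel"
proof -
  have "(\<lambda>s. LINT r|lborel. (if 0 \<le> r \<and> r \<le> s then q r else 0)) \<in> borel_measurable borel"
    by measurable
  then show ?thesis
    by (rule measurable_cong[THEN iffD1, rotated])
       (auto simp: set_lebesgue_integral_def intro!: Bochner_Integration.integral_cong)
qed

text \<open>Partial integration for primitives that are only absolutely continuous: the product is an
  integral over the square \<open>{0..T} \<times> {0..T}\<close>, which Fubini's theorem splits along the diagonal.\<close>

lemma primitive_times_primitive: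
  fixes p q :: "real \<Rightarrow> real"
  assumes p: "integrable lborel p" and q: "integrable lborel q"
  shows "(LINT s:{0..T}|lborel. p s) * (LINT s:{0..T}|lborel. q s) =
    (LINT s:{0..T}|lborel. p s * (LINT r:{0..s}|lborel. q r) + q s * (LINT r:{0..s}|lborel. p r))"
proof -
  note [measurable] = borel_measurable_integrable[OF p, simplified] borel_measurable_integrable[OF q, simplified]
  define p' where "p' = (\<lambda>s. indicator {0..T} s * p s)"
  define q' where "q' = (\<lambda>s. indicator {0..T} s * q s)"
  have p': "integrable lborel p'" and q': "integrable lborel q'"
    unfolding p'_def q'_def using p q by (auto intro!: integrable_real_mult_indicator simp: mult.commute)
  note [measurable] = borel_measurable_integrable[OF p', simplified] borel_measurable_integrable[OF q', simplified]
  have int: "integrable (lborel \<Otimes>\<^sub>M lborel) (\<lambda>(x, y). p' x * q' y)"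
    by (intro lborel_pair.Fubini_integrable) (auto simp: abs_mult intro!: integrable_mult_left integrable_mult_right p' q' integrable_abs)
  have int1: "integrable (lborel \<Otimes>\<^sub>M lborel) (\<lambda>(x, y). p' x * q' y * indicator {..x} y)"
    by (rule Bochner_Integration.integrable_bound[OF int]) (auto simp: split_beta' abs_mult indicator_def)
  have int2: "integrable (lborel \<Otimes>\<^sub>M lborel) (\<lambda>(x, y). p' x * q' y * indicator {..<y} x)"
    by (rule Bochner_Integration.integrable_bound[OF int]) (auto simp: split_beta' abs_mult indicator_def)
  have ip: "(LINT x|lborel. p' x * indicator {..<y} x) = indicator {0..T} y * (LINT r:{0..y}|lborel. p r)" if "y \<in> {0..T}" for y
  proof -
    have "AE x in lborel. p' x * indicator {..<y} x = indicator {0..y} x *\<^sub>R p x"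
      using AE_lborel_singleton[of y] by eventually_elim (use that in \<open>auto simp: p'_def indicator_def\<close>)
    then have "(LINT x|lborel. p' x * indicator {..<y} x) = (LINT r:{0..y}|lborel. p r)"
      unfolding set_lebesgue_integral_def by (intro integral_cong_AE) auto
    then show ?thesis using that by simp
  qed
  have iq: "(LINT x|lborel. q' x * indicator {..y} x) = (LINT r:{0..y}|lborel. q r)" if "y \<in> {0..T}" for y
    using that unfolding set_lebesgue_integral_def q'_def
    by (auto intro!: Bochner_Integration.integral_cong simp: indicator_def)
  have "(LINT s:{0..T}|lborel. p s) * (LINT s:{0..T}|lborel. q s) = (LINT x|lborel. p' x) * (LINT y|lborel. q' y)"
    by (simp add: set_lebesgue_integral_def p'_def q'_def)
  also have "\<dots> = (LINT x|lborel. LINT y|lborel. p' x * q' y)"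
    by (simp)
  also have "\<dots> = (LINT z|(lborel \<Otimes>\<^sub>M lborel). (\<lambda>(x, y). p' x * q' y) z)"
    by (subst lborel_pair.integral_fst'[OF int, symmetric]) simp
  also have "\<dots> = (LINT z|(lborel \<Otimes>\<^sub>M lborel). (\<lambda>(x, y). p' x * q' y * indicator {..x} y) z + (\<lambda>(x, y). p' x * q' y * indicator {..<y} x) z)"
    by (intro Bochner_Integration.integral_cong) (auto simp: indicator_def)
  also have "\<dots> = (LINT z|(lborel \<Otimes>\<^sub>M lborel). (\<lambda>(x, y). p' x * q' y * indicator {..x} y) z) + (LINT z|(lborel \<Otimes>\<^sub>M lborel). (\<lambda>(x, y). p' x * q' y * indicator {..<y} x) z)"
    by (rule Bochner_Integration.integral_add[OF int1 int2])
  also have "(LINT z|(lborel \<Otimes>\<^sub>M lborel). (\<lambda>(x, y). p' x * q' y * indicator {..x} y) z) = (LINT x|lborel. LINT y|lborel. p' x * q' y * indicator {..x} y)"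
    by (subst lborel_pair.integral_fst'[OF int1, symmetric]) simp
  also have "\<dots> = (LINT s:{0..T}|lborel. p s * (LINT r:{0..s}|lborel. q r))"
    unfolding set_lebesgue_integral_def[where A="{0..T}"]
  proof (intro Bochner_Integration.integral_cong refl)
    fix x :: real
    have "(LINT y|lborel. p' x * q' y * indicator {..x} y) = p' x * (LINT y|lborel. q' y * indicator {..x} y)"
      by (simp add: mult.assoc)
    then show "(LINT y|lborel. p' x * q' y * indicator {..x} y) = indicator {0..T} x *\<^sub>R (p x * (LINT r:{0..x}|lborel. q r))"
      using iq[of x] by (cases "x \<in> {0..T}") (auto simp: p'_def)
  qed
  also have "(LINT z|(lborel \<Otimes>\<^sub>M lborel). (\<lambda>(x, y). p' x * q' y * indicator {..<y} x) z) = (LINT y|lborel. LINT x|lborel. p' x * q' y * indicator {..<y} x)"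
    by (subst lborel_pair.integral_snd[where f="\<lambda>x y. p' x * q' y * indicator {..<y} x", symmetric]) (use int2 in auto)
  also have "\<dots> = (LINT s:{0..T}|lborel. q s * (LINT r:{0..s}|lborel. p r))"
    unfolding set_lebesgue_integral_def[where A="{0..T}"]
  proof (intro Bochner_Integration.integral_cong refl)
    fix y :: real
    have "(LINT x|lborel. p' x * q' y * indicator {..<y} x) = q' y * (LINT x|lborel. p' x * indicator {..<y} x)"
      by (simp add: mult.assoc mult.left_commute flip: integral_mult_right_zero)
    then show "(LINT x|lborel. p' x * q' y * indicator {..<y} x) = indicator {0..T} y *\<^sub>R (q y * (LINT r:{0..y}|lborel. p r))"
      using ip[of y] by (cases "y \<in> {0..T}") (auto simp: q'_def)
  qed
  also have "(LINT s:{0..T}|lborel. p s * (LINT r:{0..s}|lborel. q r)) + (LINT s:{0..T}|lborel. q s * (LINT r:{0..s}|lborel. p r))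
    = (LINT s:{0..T}|lborel. p s * (LINT r:{0..s}|lborel. q r) + q s * (LINT r:{0..s}|lborel. p r))"
  proof (rule set_integral_add(2)[symmetric])
    have "integrable lborel (\<lambda>s. (LINT r:{0..s}|lborel. q r) * p s)"
      by (rule Bochner_Integration.integrable_bound[where f="\<lambda>s. (\<integral>r. \<bar>q r\<bar> \<partial>lborel) * \<bar>p s\<bar>"])
         (use primitive_bound[OF q] in \<open>auto simp: abs_mult mult.commute intro!: mult_mono p\<close>)
    then show "set_integrable lborel {0..T} (\<lambda>s. p s * (LINT r:{0..s}|lborel. q r))"
      unfolding set_integrable_def by (intro integrable_mult_indicator) (auto simp: mult.commute)
    have "integrable lborel (\<lambda>s. (LINT r:{0..s}|lborel. p r) * q s)"
      by (rule Bochner_Integration.integrable_bound[where f="\<lambda>s. (\<integral>r. \<bar>p r\<bar> \<partial>lborel) * \<bar>q s\<bar>"])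
         (use primitive_bound[OF p] in \<open>auto simp: abs_mult mult.commute intro!: mult_mono q\<close>)
    then show "set_integrable lborel {0..T} (\<lambda>s. q s * (LINT r:{0..s}|lborel. p r))"
      unfolding set_integrable_def by (intro integrable_mult_indicator) (auto simp: mult.commute)
  qed
  finally show ?thesis .
qed

lemma set_integrable_bounded:
  fixes a :: "real \<Rightarrow> real"
  assumes [measurable]: "a \<in> borel_measurable borel" and "\<And>s. \<bar>a s\<bar> \<le> C" and "A \<in> sets borel" "emeasure lborel A < \<infinity>"
  shows "set_integrable lborel A a"
  unfolding set_integrable_def
  by (rule integrableI_bounded_set_indicator[where B=C]) (use assms in auto)

text \<open>The chain rule for powers of a primitive, by repeated partial integration; since the integrand
  is merely integrable, the primitive need not be differentiable everywhere.\<close>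

lemma primitive_power:
  fixes a :: "real \<Rightarrow> real"
  assumes a [measurable]: "integrable lborel a" 
  defines "A \<equiv> \<lambda>r. LINT s:{0..r}|lborel. a s"
  shows "A T ^ Suc n = real (Suc n) * (LINT s:{0..T}|lborel. A s ^ n * a s)"
proof (induction n arbitrary: T)
  case 0
  then show ?case by (simp add: A_def)
next
  case (Suc n)
  note [measurable] = borel_measurable_integrable[OF a, simplified]
  define q where "q = (\<lambda>s. real (Suc n) * (A s ^ n * a s))"
  have [measurable]: "A \<in> borel_measurable borel" unfolding A_def by measurable
  have bA: "\<bar>A s\<bar> \<le> (\<integral>r. \<bar>a r\<bar> \<partial>lborel)" for s
    unfolding A_def by (rule primitive_bound[OF a])
  have i: "integrable lborel (\<lambda>s. A s ^ m * a s)" for m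
    by (rule Bochner_Integration.integrable_bound[where f="\<lambda>s. (\<integral>r. \<bar>a r\<bar> \<partial>lborel) ^ m * \<bar>a s\<bar>"])
       (auto simp: abs_mult power_abs intro!: mult_mono power_mono bA integrable_mult_right integrable_abs a)
  have q: "integrable lborel q" unfolding q_def by (intro integrable_mult_right i)
  have Q: "(LINT r:{0..s}|lborel. q r) = A s ^ Suc n" for s
    using Suc.IH[of s] by (simp add: q_def)
  have "A T ^ Suc (Suc n) = A T * (LINT s:{0..T}|lborel. q s)" by (simp add: Q)
  also have "\<dots> = (LINT s:{0..T}|lborel. a s * A s ^ Suc n + q s * A s)"
    using primitive_times_primitive[OF a q, of T] by (simp only: Q) (simp only: A_def)
  also have "\<dots> = (LINT s:{0..T}|lborel. real (Suc (Suc n)) * (A s ^ Suc n * a s))"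
    by (intro arg_cong2[where f="set_lebesgue_integral lborel"] ext refl) (simp add: q_def algebra_simps)
  finally show ?case by simp
qed

text \<open>Two applications of the chain rule, arranged so that the last factor runs over the future of
  \<open>r\<close>: this is the form in which the Markov property at time \<open>r\<close> can be applied.\<close>

lemma primitive_power_nested:
  fixes a :: "real \<Rightarrow> real"
  assumes a [measurable]: "integrable lborel a" and T: "0 \<le> T"
  defines "A \<equiv> \<lambda>r. LINT s:{0..r}|lborel. a s"
  shows "A T ^ (j + 2) = real ((j + 2) * (j + 1)) *
    (LINT r:{0..T}|lborel. A r ^ j * a r * (LINT s:{r..T}|lborel. a s))"
proof -
  note [measurable] = borel_measurable_integrable[OF a, simplified]
  have [measurable]: "A \<in> borel_measurable borel" unfolding A_def by measurable
  have bA: "\<bar>A s\<bar> \<le> (\<integral>r. \<bar>a r\<bar> \<partial>lborel)" for s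
    unfolding A_def by (rule primitive_bound[OF a])
  have i: "integrable lborel (\<lambda>s. A s ^ m * a s)" for m
    by (rule Bochner_Integration.integrable_bound[where f="\<lambda>s. (\<integral>r. \<bar>a r\<bar> \<partial>lborel) ^ m * \<bar>a s\<bar>"])
       (auto simp: abs_mult power_abs intro!: mult_mono power_mono bA integrable_mult_right integrable_abs a)
  have si: "set_integrable lborel {0..T} (\<lambda>s. A s ^ m * a s)" for m
    unfolding set_integrable_def by (intro integrable_mult_indicator i) auto
  have tail: "(LINT s:{r..T}|lborel. a s) = A T - A r" if r: "r \<in> {0..T}" for r
  proof -
    have sub: "set_integrable lborel B a" if "B \<in> sets lborel" for B
      unfolding set_integrable_def by (intro integrable_mult_indicator a that)
    have "A T = (LINT s:{0..<r} \<union> {r..T}|lborel. a s)"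
      unfolding A_def using r by (intro arg_cong2[where f="\<lambda>S. set_lebesgue_integral lborel S"]) auto
    also have "\<dots> = (LINT s:{0..<r}|lborel. a s) + (LINT s:{r..T}|lborel. a s)"
      by (intro set_integral_Un sub) auto
    also have "(LINT s:{0..<r}|lborel. a s) = A r"
      unfolding A_def set_lebesgue_integral_def
      by (intro integral_cong_AE; (measurable; fail)?)
         (use AE_lborel_singleton[of r] in \<open>eventually_elim, auto simp: indicator_def\<close>)
    finally show ?thesis by simp
  qed
  have "(LINT r:{0..T}|lborel. A r ^ j * a r * (LINT s:{r..T}|lborel. a s))
    = (LINT r:{0..T}|lborel. A T * (A r ^ j * a r) - A r ^ Suc j * a r)"
    by (intro set_lebesgue_integral_cong) (auto simp: tail algebra_simps)
  also have "\<dots> = A T * (LINT r:{0..T}|lborel. A r ^ j * a r) - (LINT r:{0..T}|lborel. A r ^ Suc j * a r)"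
    using si[of j] si[of "Suc j"] by (subst set_integral_diff) auto
  also have "(LINT r:{0..T}|lborel. A r ^ j * a r) = A T ^ Suc j / real (Suc j)"
    using primitive_power[OF a, of T j] by (simp add: A_def field_simps del: power_Suc)
  also have "(LINT r:{0..T}|lborel. A r ^ Suc j * a r) = A T ^ Suc (Suc j) / real (Suc (Suc j))"
    using primitive_power[OF a, of T "Suc j"] by (simp add: A_def field_simps del: power_Suc)
  also have "A T * (A T ^ Suc j / real (Suc j)) - A T ^ Suc (Suc j) / real (Suc (Suc j))
    = A T ^ (j + 2) / real ((j + 2) * (j + 1))"
  proof -
    have "x / real (Suc j) - x / real (Suc (Suc j)) = x / real ((j + 2) * (j + 1))" for x :: real
    proof -
      have "real ((j + 2) * (j + 1)) = real (Suc j) * real (Suc (Suc j))" by (simp add: algebra_simps)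
      then show ?thesis
        by (simp only:) (simp add: divide_simps del: of_nat_Suc, simp add: algebra_simps)
    qed
    from this[of "A T ^ Suc (Suc j)"] show ?thesis by simp
  qed
  finally show ?thesis
    by (simp del: of_nat_mult of_nat_add)
qed

text \<open>Partial integration of \<open>s \<mapsto> s\<close> against \<open>1 - K\<^sup>2\<close>, whose density is \<open>2 K q\<close>.\<close>

lemma integral_square_tail:
  fixes q K :: "real \<Rightarrow> real"
  assumes q: "integrable lborel q" and t: "0 \<le> t"
    and K: "\<And>s. s \<in> {0..t} \<Longrightarrow> K s = 1 - (LINT r:{0..s}|lborel. q r)"
  shows "(LINT s:{0..t}|lborel. (K s)\<^sup>2) = 2 * (LINT s:{0..t}|lborel. K s * q s * s) + t * (K t)\<^sup>2"
proof -
  note [measurable] = borel_measurable_integrable[OF q, simplified]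
  define B where "B = (\<lambda>s. LINT r:{0..s}|lborel. q r)"
  have [measurable]: "B \<in> borel_measurable borel" unfolding B_def by measurable
  define Cq where "Cq = (\<integral>r. \<bar>q r\<bar> \<partial>lborel)"
  have bB: "\<bar>B s\<bar> \<le> Cq" for s
    unfolding B_def Cq_def by (rule primitive_bound[OF q])
  \<comment> \<open>The density of \<open>1 - (1 - B)\<^sup>2\<close>.\<close>
  define w where "w = (\<lambda>s. 2 * (1 - B s) * q s)"
  have iBq: "integrable lborel (\<lambda>s. B s * q s)"
    by (rule Bochner_Integration.integrable_bound[where f="\<lambda>s. Cq * \<bar>q s\<bar>"])
       (use bB order_trans[OF abs_ge_zero bB] in \<open>auto simp: abs_mult intro!: mult_mono q\<close>)
  have w: "integrable lborel w"
  proof -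
    have "integrable lborel (\<lambda>s. 2 * q s - 2 * (B s * q s))"
      by (intro Bochner_Integration.integrable_diff integrable_mult_right q iBq)
    then show ?thesis by (simp add: w_def algebra_simps)
  qed
  have pw: "(LINT r:{0..s}|lborel. w r) = 2 * B s - (B s)\<^sup>2" for s
  proof -
    have i1: "set_integrable lborel {0..s} q" "set_integrable lborel {0..s} (\<lambda>s. B s * q s)"
      unfolding set_integrable_def by (intro integrable_mult_indicator q iBq, simp)+
    have "(LINT r:{0..s}|lborel. w r) = (LINT r:{0..s}|lborel. 2 * q r - 2 * (B r * q r))"
      by (intro arg_cong2[where f="set_lebesgue_integral lborel"] ext refl) (simp add: w_def algebra_simps)
    also have "\<dots> = 2 * B s - 2 * (LINT r:{0..s}|lborel. B r * q r)"
      using i1 by (subst set_integral_diff) (auto simp: B_def)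
    also have "2 * (LINT r:{0..s}|lborel. B r * q r) = (B s)\<^sup>2"
      using primitive_power[OF q, of s 1] by (simp add: B_def power2_eq_square)
    finally show ?thesis .
  qed
  define p where "p = (indicator {0..t} :: real \<Rightarrow> real)"
  have p: "integrable lborel p" unfolding p_def by (intro integrable_real_indicator) (auto simp: emeasure_lborel_Icc_eq)
  have pp: "(LINT r:{0..s}|lborel. p r) = s" if "s \<in> {0..t}" for s
  proof -
    have "(LINT r:{0..s}|lborel. p r) = (LINT r|lborel. indicator {0..s} r)"
      unfolding set_lebesgue_integral_def using that
      by (intro Bochner_Integration.integral_cong) (auto simp: p_def indicator_def)
    then show ?thesis using that by simp
  qed
  have [measurable]: "w \<in> borel_measurable borel" unfolding w_def by measurable
  have sw: "set_integrable lborel {0..t} (\<lambda>s. w s * s)"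
    unfolding set_integrable_def
  proof (rule Bochner_Integration.integrable_bound[where f="\<lambda>s. t * \<bar>w s\<bar>"])
    show "AE s in lborel. norm (indicator {0..t} s *\<^sub>R (w s * s)) \<le> norm (t * \<bar>w s\<bar>)"
      using t by (intro AE_I2) (auto simp: abs_mult indicator_def mult.commute intro!: mult_right_mono)
  qed (use w in auto)
  have sK: "set_integrable lborel {0..t} (\<lambda>s. (1 - B s)\<^sup>2)"
  proof (rule set_integrable_bounded[where C="(1 + Cq)\<^sup>2"])
    show "\<bar>(1 - B s)\<^sup>2\<bar> \<le> (1 + Cq)\<^sup>2" for s
      using bB[of s] by (simp add: abs_le_square_iff[symmetric])
  qed (use t in auto)
  have "t * (1 - (1 - B t)\<^sup>2) = (LINT s:{0..t}|lborel. p s) * (LINT s:{0..t}|lborel. w s)"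
  proof -
    have "1 - (1 - B t)\<^sup>2 = (LINT s:{0..t}|lborel. w s)"
      by (simp add: pw power2_eq_square algebra_simps)
    then show ?thesis using pp[of t] t by simp
  qed
  also have "\<dots> = (LINT s:{0..t}|lborel. p s * (LINT r:{0..s}|lborel. w r) + w s * (LINT r:{0..s}|lborel. p r))"
    by (rule primitive_times_primitive[OF p w])
  also have "\<dots> = (LINT s:{0..t}|lborel. (1 - (1 - B s)\<^sup>2) + w s * s)"
    by (intro set_lebesgue_integral_cong) (auto simp: pw pp, simp add: p_def power2_eq_square algebra_simps)
  also have "\<dots> = (LINT s:{0..t}|lborel. 1 - (1 - B s)\<^sup>2) + (LINT s:{0..t}|lborel. w s * s)"
    using sK sw t by (intro set_integral_add set_integral_diff) (auto simp: set_integrable_def)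
  also have "(LINT s:{0..t}|lborel. 1 - (1 - B s)\<^sup>2) = t - (LINT s:{0..t}|lborel. (1 - B s)\<^sup>2)"
    using sK t by (subst set_integral_diff) (auto simp: set_integrable_def set_lebesgue_integral_def)
  also have "(LINT s:{0..t}|lborel. (1 - B s)\<^sup>2) = (LINT s:{0..t}|lborel. (K s)\<^sup>2)"
    by (intro set_lebesgue_integral_cong) (auto simp: K B_def)
  also have "(LINT s:{0..t}|lborel. w s * s) = (LINT s:{0..t}|lborel. 2 * (K s * q s * s))"
    by (intro set_lebesgue_integral_cong) (auto simp: K B_def w_def)
  also have "\<dots> = 2 * (LINT s:{0..t}|lborel. K s * q s * s)"
    by (rule set_integral_mult_right)
  finally have "t * (1 - (1 - B t)\<^sup>2) = t - (LINT s:{0..t}|lborel. (K s)\<^sup>2) + 2 * (LINT s:{0..t}|lborel. K s * q s * s)" .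
  moreover have "1 - B t = K t" using K[of t] t by (simp add: B_def)
  ultimately show ?thesis by (simp add: right_diff_distrib)
qed

section \<open>Measurability and integrability in general measure spaces\<close>

text \<open>A variable \<open>U\<close> orthogonal to all bounded \<open>F\<close>-measurable variables stays orthogonal to them after
  multiplication by powers of a time integral \<open>\<integral>\<^sub>S b u du\<close> of \<open>F\<close>-measurable \<open>b u\<close>.  The process \<open>b\<close> is
  jointly measurable only with respect to \<open>M\<close>, so the time integral need not be \<open>F\<close>-measurable; the
  lemma avoids this question by exchanging integrals, one factor at a time, which moves \<open>b u\<close> into
  the \<open>F\<close>-measurable factor \<open>Z\<close>.\<close>

lemma (in prob_space) expectation_power_integral_zero:
  fixes b :: "real \<Rightarrow> 'a \<Rightarrow> real" and U :: "'a \<Rightarrow> real"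
  assumes F: "subalgebra M F"
    and b [measurable]: "(\<lambda>(u, \<omega>). b u \<omega>) \<in> borel_measurable (borel \<Otimes>\<^sub>M M)"
    and bC: "\<And>u \<omega>. \<bar>b u \<omega>\<bar> \<le> C"
    and bF: "\<And>u. u \<in> S \<Longrightarrow> b u \<in> borel_measurable F"
    and S [measurable]: "S \<in> sets borel" and Sfin: "emeasure lborel S < \<infinity>"
    and U [measurable]: "U \<in> borel_measurable M" and UD: "\<And>\<omega>. \<bar>U \<omega>\<bar> \<le> D"
    and orth: "\<And>Z B. Z \<in> borel_measurable F \<Longrightarrow> (\<And>\<omega>. \<bar>Z \<omega>\<bar> \<le> B) \<Longrightarrow> (\<integral>\<omega>. Z \<omega> * U \<omega> \<partial>M) = 0"
    and Z: "Z \<in> borel_measurable F" "\<And>\<omega>. \<bar>Z \<omega>\<bar> \<le> B"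
  shows "(\<integral>\<omega>. (LINT u:S|lborel. b u \<omega>) ^ j * Z \<omega> * U \<omega> \<partial>M) = 0"
  using Z
proof (induction j arbitrary: Z B)
  case 0
  then show ?case using orth[of Z B] by simp
next
  case (Suc j)
  define A where "A = (\<lambda>\<omega>. LINT u:S|lborel. b u \<omega>)"
  have A [measurable]: "A \<in> borel_measurable M"
    unfolding A_def set_lebesgue_integral_def by measurable
  have C0: "0 \<le> C" using order_trans[OF abs_ge_zero bC] .
  have D0: "0 \<le> D" using order_trans[OF abs_ge_zero UD] .
  have B0: "0 \<le> B" using order_trans[OF abs_ge_zero Suc.prems(2)] .
  have [measurable]: "Z \<in> borel_measurable M"
    by (rule measurable_from_subalg[OF F Suc.prems(1)])
  define m where "m = measure lborel S"
  have m0: "0 \<le> m" by (simp add: m_def)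
  have iS: "integrable lborel (\<lambda>u. indicator S u *\<^sub>R C)"
    using Sfin by (intro integrable_scaleR_left integrable_real_indicator) auto
  have AC: "\<bar>A \<omega>\<bar> \<le> C * m" if w: "\<omega> \<in> space M" for \<omega>
  proof -
    have "\<bar>A \<omega>\<bar> \<le> (\<integral>u. \<bar>indicator S u *\<^sub>R b u \<omega>\<bar> \<partial>lborel)"
      unfolding A_def set_lebesgue_integral_def by (rule integral_abs_bound)
    also have "\<dots> \<le> (\<integral>u. indicator S u *\<^sub>R C \<partial>lborel)"
    proof (rule integral_mono'[OF iS])
      fix u show "\<bar>indicator S u *\<^sub>R b u \<omega>\<bar> \<le> indicator S u *\<^sub>R C"
        using bC[of u \<omega>] by (auto simp: indicator_def)
    qed (use C0 in auto)
    also have "\<dots> = C * m" using Sfin by (simp add: m_def)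
    finally show ?thesis .
  qed
  interpret PS: pair_sigma_finite lborel M ..
  have int: "integrable (lborel \<Otimes>\<^sub>M M) (\<lambda>(u, \<omega>). indicator S u * (A \<omega> ^ j * (b u \<omega> * Z \<omega>) * U \<omega>))"
  proof (rule Bochner_Integration.integrable_bound[where f="\<lambda>(u, \<omega>). indicator S u *\<^sub>R (((C * m) ^ j * (C * B)) * D)"])
    show "integrable (lborel \<Otimes>\<^sub>M M) (\<lambda>(u, \<omega>). indicator S u *\<^sub>R (((C * m) ^ j * (C * B)) * D))"
    proof -
      have "integrable (lborel \<Otimes>\<^sub>M M) (\<lambda>z. indicator (S \<times> space M) z *\<^sub>R (((C * m) ^ j * (C * B)) * D))"
      proof (intro integrable_scaleR_left integrable_real_indicator)
        have "emeasure (lborel \<Otimes>\<^sub>M M) (S \<times> space M) = emeasure lborel S * emeasure M (space M)"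
          by (intro emeasure_pair_measure_Times) auto
        then show "emeasure (lborel \<Otimes>\<^sub>M M) (S \<times> space M) < \<infinity>"
          using Sfin by (simp add: emeasure_space_1)
      qed auto
      then show ?thesis
        by (rule Bochner_Integration.integrable_cong[THEN iffD1, rotated -1])
           (auto simp: space_pair_measure indicator_def)
    qed
    show "AE z in lborel \<Otimes>\<^sub>M M. norm (case z of (u, \<omega>) \<Rightarrow> indicator S u * (A \<omega> ^ j * (b u \<omega> * Z \<omega>) * U \<omega>))
        \<le> norm (case z of (u, \<omega>) \<Rightarrow> indicator S u *\<^sub>R (((C * m) ^ j * (C * B)) * D))"
    proof (rule AE_I2, clarsimp simp: space_pair_measure)
      fix u \<omega> assume w: "\<omega> \<in> space M"
      have "\<bar>A \<omega> ^ j * (b u \<omega> * Z \<omega>) * U \<omega>\<bar> \<le> ((C * m) ^ j * (C * B)) * D"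
        unfolding abs_mult power_abs
        by (intro mult_mono power_mono AC w bC UD Suc.prems) (use C0 B0 D0 m0 in auto)
      then show "\<bar>indicator S u * (A \<omega> ^ j * (b u \<omega> * Z \<omega>) * U \<omega>)\<bar> \<le> \<bar>indicator S u * (((C * m) ^ j * (C * B)) * D)\<bar>"
        using C0 B0 D0 m0 by (auto simp: indicator_def)
    qed
  qed measurable
  have "(\<integral>\<omega>. A \<omega> ^ Suc j * Z \<omega> * U \<omega> \<partial>M) = (\<integral>\<omega>. (\<integral>u. indicator S u * (A \<omega> ^ j * (b u \<omega> * Z \<omega>) * U \<omega>) \<partial>lborel) \<partial>M)"
  proof (intro Bochner_Integration.integral_cong refl)
    fix \<omega>
    have "(\<integral>u. indicator S u * (A \<omega> ^ j * (b u \<omega> * Z \<omega>) * U \<omega>) \<partial>lborel)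
      = (\<integral>u. (A \<omega> ^ j * Z \<omega> * U \<omega>) * (indicator S u *\<^sub>R b u \<omega>) \<partial>lborel)"
      by (intro Bochner_Integration.integral_cong) auto
    also have "\<dots> = (A \<omega> ^ j * Z \<omega> * U \<omega>) * A \<omega>"
      unfolding A_def set_lebesgue_integral_def by (rule integral_mult_right_zero)
    finally show "A \<omega> ^ Suc j * Z \<omega> * U \<omega> = (\<integral>u. indicator S u * (A \<omega> ^ j * (b u \<omega> * Z \<omega>) * U \<omega>) \<partial>lborel)"
      by simp
  qed
  also have "\<dots> = (\<integral>u. (\<integral>\<omega>. indicator S u * (A \<omega> ^ j * (b u \<omega> * Z \<omega>) * U \<omega>) \<partial>M) \<partial>lborel)"
    by (rule PS.Fubini_integral[OF int])
  also have "\<dots> = 0"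
  proof -
    have "(\<integral>\<omega>. indicator S u * (A \<omega> ^ j * (b u \<omega> * Z \<omega>) * U \<omega>) \<partial>M) = 0" for u
    proof (cases "u \<in> S")
      case True
      have "(\<integral>\<omega>. A \<omega> ^ j * (b u \<omega> * Z \<omega>) * U \<omega> \<partial>M) = 0"
        unfolding A_def
        by (rule Suc.IH[of _ "C * B"])
           (use bF[OF True] Suc.prems bC C0 in \<open>auto simp: abs_mult intro!: mult_mono\<close>)
      then show ?thesis using True by simp
    qed simp
    then show ?thesis by (simp only: Bochner_Integration.integral_zero)
  qed
  finally show ?case by (simp add: A_def)
qed

lemma subalgebra_generated:
  assumes "\<And>i. i \<in> I \<Longrightarrow> Y i \<in> measurable M K"
  shows "subalgebra M (generated M K Y I)"
proof -
  have "(\<Union>i\<in>I. {Y i -` A \<inter> space M | A. A \<in> sets K}) \<subseteq> sets M"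
    using assms by (auto intro: measurable_sets)
  then show ?thesis
    unfolding subalgebra_def generated_def
    by (auto simp: sets.sigma_sets_subset space_measure_of_conv sets_measure_of_conv dest: sets.sets_into_space)
qed

lemma measurable_generated:
  assumes "i \<in> I" "Y i \<in> space M \<rightarrow> space K"
  shows "Y i \<in> measurable (generated M K Y I) K"
proof (rule measurableI)
  have sub: "(\<Union>i\<in>I. {Y i -` A \<inter> space M | A. A \<in> sets K}) \<subseteq> Pow (space M)" by auto
  fix A assume "A \<in> sets K"
  then show "Y i -` A \<inter> space (generated M K Y I) \<in> sets (generated M K Y I)"
    using assms(1) sub unfolding generated_def by (auto simp: space_measure_of_conv)
qed (use assms in \<open>auto simp: generated_def space_measure_of_conv\<close>)

text \<open>Bochner integrals against a kernel depend measurably on the parameter: the positive and negative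
  parts do, and so does the set of parameters on which the convention for non-integrable functions
  applies.\<close>

lemma integral_measurable_prob_kernel:
  fixes h :: "'a \<Rightarrow> 'w \<Rightarrow> real"
  assumes h [measurable]: "(\<lambda>(y, \<omega>). h y \<omega>) \<in> borel_measurable (N \<Otimes>\<^sub>M M)"
    and P: "P \<in> N \<rightarrow>\<^sub>M prob_algebra M"
  shows "(\<lambda>y. \<integral>\<omega>. h y \<omega> \<partial>P y) \<in> borel_measurable N"
proof -
  have P' [measurable]: "P \<in> N \<rightarrow>\<^sub>M subprob_algebra M" by (rule measurable_prob_algebraD[OF P])
  have s: "sets (P y) = sets M" "prob_space (P y)" if "y \<in> space N" for y
    using measurable_space[OF P that] by (auto simp: space_prob_algebra)
  define g where "g = (\<lambda>y. (if (\<integral>\<^sup>+\<omega>. ennreal \<bar>h y \<omega>\<bar> \<partial>P y) = \<infinity> then 0 else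
     enn2real (\<integral>\<^sup>+\<omega>. ennreal (h y \<omega>) \<partial>P y) - enn2real (\<integral>\<^sup>+\<omega>. ennreal (- h y \<omega>) \<partial>P y)))"
  have m1: "(\<lambda>y. \<integral>\<^sup>+\<omega>. ennreal (h y \<omega>) \<partial>P y) \<in> borel_measurable N"
    by (rule nn_integral_measurable_subprob_algebra2[OF _ P']) measurable
  have m2: "(\<lambda>y. \<integral>\<^sup>+\<omega>. ennreal (- h y \<omega>) \<partial>P y) \<in> borel_measurable N"
    by (rule nn_integral_measurable_subprob_algebra2[OF _ P']) measurable
  have m3: "(\<lambda>y. \<integral>\<^sup>+\<omega>. ennreal \<bar>h y \<omega>\<bar> \<partial>P y) \<in> borel_measurable N"
    by (rule nn_integral_measurable_subprob_algebra2[OF _ P']) measurable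
  have "g \<in> borel_measurable N"
    unfolding g_def using m1 m2 m3 by measurable
  moreover have "(\<integral>\<omega>. h y \<omega> \<partial>P y) = g y" if y: "y \<in> space N" for y
  proof -
    have [measurable]: "(\<lambda>\<omega>. h y \<omega>) \<in> borel_measurable (P y)"
      using measurable_compose[OF measurable_Pair1'[OF y] h] s[OF y] by (simp cong: measurable_cong_sets)
    show ?thesis
    proof (cases "integrable (P y) (h y)")
      case True
      then show ?thesis
        by (subst real_lebesgue_integral_def) (auto simp: g_def integrable_iff_bounded)
    next
      case False
      then show ?thesis
        by (auto simp: g_def integrable_iff_bounded not_integrable_integral_eq less_top[symmetric])
    qed
  qed
  ultimately show ?thesis by (simp cong: measurable_cong)
qed

text \<open>The supremum in the definition of ergodicity, unfolded once and for all.  The test function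
  \<open>h = 0\<close> shows that the constant \<open>d\<close> is non-negative.\<close>

lemma ergodicity_constants:
  assumes "geometrically_ergodic P X v \<pi>"
  obtains d \<alpha> where "0 \<le> d" "0 < \<alpha>"
    "\<And>u x h. \<lbrakk>0 \<le> u; h \<in> borel_measurable borel; \<And>y. \<bar>h y\<bar> \<le> v y\<rbrakk> \<Longrightarrow>
       \<bar>(\<integral>\<omega>. h (X u \<omega>) \<partial>P x) - (\<integral>y. h y \<partial>\<pi>)\<bar> \<le> d * v x * exp (- \<alpha> * u)"
proof -
  have v1: "1 \<le> v y" for y using assms by (auto simp: geometrically_ergodic_def)
  from assms obtain d \<alpha> where \<alpha>: "0 < \<alpha>" and *: "\<forall>u\<ge>0. \<forall>x.
     (SUP h \<in> {h \<in> borel_measurable borel. \<forall>y. \<bar>h y\<bar> \<le> v y}.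
           ereal \<bar>(\<integral>\<omega>. h (X u \<omega>) \<partial>P x) - (\<integral>y. h y \<partial>\<pi>)\<bar>) \<le> ereal (d * v x * exp (- \<alpha> * u))"
    unfolding geometrically_ergodic_def by blast
  have **: "\<bar>(\<integral>\<omega>. h (X u \<omega>) \<partial>P x) - (\<integral>y. h y \<partial>\<pi>)\<bar> \<le> d * v x * exp (- \<alpha> * u)"
    if "0 \<le> u" "h \<in> borel_measurable borel" "\<And>y. \<bar>h y\<bar> \<le> v y" for u x h
  proof -
    have "ereal \<bar>(\<integral>\<omega>. h (X u \<omega>) \<partial>P x) - (\<integral>y. h y \<partial>\<pi>)\<bar> \<le>
      (SUP h \<in> {h \<in> borel_measurable borel. \<forall>y. \<bar>h y\<bar> \<le> v y}.
           ereal \<bar>(\<integral>\<omega>. h (X u \<omega>) \<partial>P x) - (\<integral>y. h y \<partial>\<pi>)\<bar>)"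
      by (rule SUP_upper) (use that in simp)
    also have "\<dots> \<le> ereal (d * v x * exp (- \<alpha> * u))"
      using * that(1) by blast
    finally show ?thesis by simp
  qed
  have v0: "0 \<le> v y" for y by (rule order_trans[OF zero_le_one v1])
  have "0 \<le> d * v undefined * exp (- \<alpha> * 0)"
    by (rule order_trans[OF abs_ge_zero **[of 0 "\<lambda>_. 0"]]) (use v0 in auto)
  then have "0 \<le> d" using v1[of undefined] by (simp add: zero_le_mult_iff)
  with \<alpha> ** show ?thesis using that by blast
qed

text \<open>Ergodicity bounds means of functions dominated by \<open>v\<close> under the Bochner convention; integrability
  of \<open>v\<close> itself follows by applying the bound to its truncations and letting the level grow.\<close>

lemma integrable_of_bounded_truncations:
  assumes "prob_space Q" and [measurable]: "q \<in> borel_measurable Q" and q1: "\<And>\<omega>. 1 \<le> q \<omega>"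
    and le: "\<And>n::nat. (\<integral>\<omega>. min (q \<omega>) (real n) \<partial>Q) \<le> B"
  shows "integrable Q q" "(\<integral>\<omega>. q \<omega> \<partial>Q) \<le> B"
proof -
  interpret Q: prob_space Q by fact
  have q0: "0 \<le> q \<omega>" for \<omega> using q1[of \<omega>] by simp
  have i: "integrable Q (\<lambda>\<omega>. min (q \<omega>) (real n))" for n
    by (rule Q.integrable_const_bound[where B="real n"]) (use q0 in auto)
  have mono: "AE \<omega> in Q. mono (\<lambda>n. min (q \<omega>) (real n))"
    by (intro AE_I2 monoI) (auto simp: min_def)
  have lim: "(\<lambda>n. min (q \<omega>) (real n)) \<longlonglongrightarrow> q \<omega>" for \<omega>
  proof (rule tendsto_eventually)
    obtain m where "q \<omega> \<le> real m" using real_arch_simple by blast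
    then show "\<forall>\<^sub>F n in sequentially. min (q \<omega>) (real n) = q \<omega>"
      by (intro eventually_sequentiallyI[of m]) (auto simp: min_def)
  qed
  define s where "s n = (\<integral>\<omega>. min (q \<omega>) (real n) \<partial>Q)" for n :: nat
  have "incseq s" unfolding s_def
    by (intro monoI integral_mono i) (auto simp: min_def)
  moreover have "s n \<le> B" for n unfolding s_def by (rule le)
  ultimately obtain L where L: "s \<longlonglongrightarrow> L" "\<forall>n. s n \<le> L" using incseq_convergent[of s B] by auto
  note mc = i mono AE_I2[OF lim] L(1)[unfolded s_def] assms(2)
  show "integrable Q q" by (rule integrable_monotone_convergence[OF mc])
  have "integral\<^sup>L Q q = L" by (rule integral_monotone_convergence[OF mc])
  moreover have "L \<le> B" using L(1) by (rule LIMSEQ_le_const2) (use le in \<open>auto simp: s_def\<close>)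
  ultimately show "(\<integral>\<omega>. q \<omega> \<partial>Q) \<le> B" by simp
qed

lemma integrable_lborel_product:
  fixes p q :: "real \<Rightarrow> real"
  assumes p: "integrable lborel p" and q: "integrable lborel q"
  shows "integrable lborel (\<lambda>z. p (fst z) * q (snd z))"
proof -
  note [measurable] = borel_measurable_integrable[OF p, simplified] borel_measurable_integrable[OF q, simplified]
  have "integrable (lborel \<Otimes>\<^sub>M lborel) (\<lambda>(x, y). p x * q y)"
    by (intro lborel_pair.Fubini_integrable) (auto simp: abs_mult intro!: integrable_mult_left integrable_mult_right p q integrable_abs)
  then show ?thesis by (simp add: lborel_prod split_beta')
qed

lemma integral_lborel_product:
  fixes p q :: "real \<Rightarrow> real"
  assumes p: "integrable lborel p" and q: "integrable lborel q"
  shows "(\<integral>z. p (fst z) * q (snd z) \<partial>lborel) = (\<integral>u. p u \<partial>lborel) * (\<integral>u. q u \<partial>lborel)"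
proof -
  have "integrable (lborel \<Otimes>\<^sub>M lborel) (\<lambda>z. p (fst z) * q (snd z))"
    using integrable_lborel_product[OF p q] by (simp add: lborel_prod)
  from lborel_pair.integral_fst'[OF this] show ?thesis by (simp add: lborel_prod)
qed

lemma integrable_exp_decay:
  assumes "0 < \<alpha>"
  shows "integrable lborel (\<lambda>w::real. indicator {0..} w * exp (- \<alpha> * w))"
proof -
  interpret prob_space "density lborel (exponential_density \<alpha>)"
    by (rule prob_space_exponential_density[OF assms])
  have "(\<integral>\<^sup>+w. ennreal (exponential_density \<alpha> w) \<partial>lborel) = 1"
    using emeasure_space_1 by (simp add: emeasure_density)
  then have "integrable lborel (exponential_density \<alpha>)"
    using assms by (intro integrableI_nonneg) (auto simp: exponential_density_def)
  then have "integrable lborel (\<lambda>w. exponential_density \<alpha> w / \<alpha>)" by simp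
  then show ?thesis
    by (rule Bochner_Integration.integrable_cong[THEN iffD1, rotated -1])
       (use assms in \<open>auto simp: exponential_density_def mult.commute\<close>)
qed

lemma tendsto_at_right_zeroI:
  fixes f :: "real \<Rightarrow> real"
  assumes "\<And>E. (\<And>i. 0 < E i) \<Longrightarrow> E \<longlonglongrightarrow> 0 \<Longrightarrow> (\<lambda>i::nat. f (E i)) \<longlonglongrightarrow> a"
  shows "(f \<longlongrightarrow> a) (at_right 0)"
  unfolding tendsto_at_iff_sequentially comp_def using assms by auto

text \<open>Convergence of the integrands below may fail on the boundary lines \<open>q = 0\<close>, where the process has not mixed,
  and \<open>q = t\<close>; both are null sets of the plane.\<close>

lemma AE_lborel_fst_neq: "AE z in (lborel :: (real \<times> real) measure). fst z \<noteq> c"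
proof -
  have "AE z in (lborel :: real measure) \<Otimes>\<^sub>M (lborel :: real measure). fst z \<noteq> c"
  proof (rule AE_I')
    have "emeasure (lborel \<Otimes>\<^sub>M lborel) ({c} \<times> (UNIV :: real set)) = emeasure lborel {c} * emeasure lborel (UNIV :: real set)"
      by (intro lborel.emeasure_pair_measure_Times) auto
    then show "{c} \<times> UNIV \<in> null_sets (lborel \<Otimes>\<^sub>M (lborel :: real measure))"
      by (intro null_setsI) auto
  qed auto
  then show ?thesis by (simp only: lborel_prod)
qed

section \<open>The modulating Markov process\<close>

text \<open>The constants of ergodicity are parameters here because the dominated convergence arguments need
  the same \<open>d\<close> and \<open>\<alpha>\<close> at all times and starting points.  \<open>C\<close> bounds the centred intensity.\<close>

locale ergodic_modulation =
  fixes M :: "'w measure"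
    and P :: "'s::polish_space \<Rightarrow> 'w measure"
    and X :: "real \<Rightarrow> 'w \<Rightarrow> 's"
    and v f :: "'s \<Rightarrow> real"
    and \<pi> :: "'s measure"
    and d \<alpha> C :: real
  assumes markov: "markov_process M P X"
    and v_meas [measurable]: "v \<in> borel_measurable borel" and v1: "\<And>y. 1 \<le> v y"
    and \<pi>: "prob_space \<pi>" and sets_\<pi> [measurable_cong]: "sets \<pi> = sets borel"
    and d_nonneg: "0 \<le> d" and \<alpha>_pos: "0 < \<alpha>" and C_pos: "0 < C"
    and ergodic: "\<And>u x h. \<lbrakk>0 \<le> u; h \<in> borel_measurable borel; \<And>y. \<bar>h y\<bar> \<le> v y\<rbrakk> \<Longrightarrow>
      \<bar>(\<integral>\<omega>. h (X u \<omega>) \<partial>P x) - (\<integral>y. h y \<partial>\<pi>)\<bar> \<le> d * v x * exp (- \<alpha> * u)"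
    and f_meas [measurable]: "f \<in> borel_measurable borel"
    and fc_le: "\<And>y. \<bar>centred \<pi> f y\<bar> \<le> C"
begin

text \<open>The process extended to negative times, so that it is jointly measurable on the whole line and
  can be integrated against Lebesgue measure.\<close>

definition Y :: "real \<Rightarrow> 'w \<Rightarrow> 's" where "Y u = X (max 0 u)"

abbreviation fc :: "'s \<Rightarrow> real" where "fc \<equiv> centred \<pi> f"

text \<open>The transition semigroup of the process, applied to the centred intensity.\<close>

definition semigroup :: "real \<Rightarrow> 's \<Rightarrow> real"
  where "semigroup u y = (\<integral>\<omega>. fc (Y u \<omega>) \<partial>P y)"

lemma kernel: "P \<in> borel \<rightarrow>\<^sub>M prob_algebra M"
  using markov by (simp add: markov_process_def)

lemma prob_space_P: "prob_space (P y)" and sets_P [measurable_cong]: "sets (P y) = sets M"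
  using measurable_space[OF kernel, of y] by (auto simp: space_prob_algebra)

lemma space_P: "space (P y) = space M"
  by (rule sets_eq_imp_space_eq[OF sets_P])

lemma Y_measurable [measurable]: "(\<lambda>(u, \<omega>). Y u \<omega>) \<in> borel_measurable (borel \<Otimes>\<^sub>M M)"
proof -
  have X: "(\<lambda>(t, \<omega>). X t \<omega>) \<in> borel_measurable (restrict_space borel {0..} \<Otimes>\<^sub>M M)"
    using markov by (simp add: markov_process_def)
  have "(\<lambda>(u::real, \<omega>). (max 0 u, \<omega>)) \<in> borel \<Otimes>\<^sub>M M \<rightarrow>\<^sub>M restrict_space borel {0..} \<Otimes>\<^sub>M M"
    by (auto intro!: measurable_Pair measurable_restrict_space2 simp: split_beta')
  from measurable_compose[OF this X] show ?thesis
    by (simp add: Y_def split_beta')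
qed

lemma Y_measurable_section [measurable]: "Y u \<in> borel_measurable M"
  using measurable_compose[OF measurable_Pair1'[of u borel M] Y_measurable] by simp

lemma X_measurable: "0 \<le> u \<Longrightarrow> X u \<in> borel_measurable M"
  using Y_measurable_section[of u] by (simp add: Y_def)

lemma fc_meas [measurable]: "fc \<in> borel_measurable borel"
  unfolding centred_def by measurable

lemma semigroup_meas [measurable]: "(\<lambda>(u, y). semigroup u y) \<in> borel_measurable (borel \<Otimes>\<^sub>M borel)"
proof -
  have "(\<lambda>z. \<integral>\<omega>. (\<lambda>z \<omega>. fc (Y (fst z) \<omega>)) z \<omega> \<partial>P (snd z)) \<in> borel_measurable (borel \<Otimes>\<^sub>M borel)"
    by (rule integral_measurable_prob_kernel[where M=M, OF _ measurable_compose[OF measurable_snd kernel]])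
       measurable
  then show ?thesis by (simp add: semigroup_def split_beta')
qed

lemma f_integrable: "integrable \<pi> f"
proof -
  interpret \<pi>: prob_space \<pi> by (rule \<pi>)
  have "\<bar>f y\<bar> \<le> C + \<bar>\<integral>z. f z \<partial>\<pi>\<bar>" for y
    using fc_le[of y] unfolding centred_def by linarith
  then show ?thesis by (intro \<pi>.integrable_const_bound[where B="C + \<bar>\<integral>z. f z \<partial>\<pi>\<bar>"]) auto
qed

lemma integral_fc: "(\<integral>y. fc y \<partial>\<pi>) = 0"
proof -
  interpret \<pi>: prob_space \<pi> by (rule \<pi>)
  show ?thesis unfolding centred_def using f_integrable by (simp add: \<pi>.prob_space)
qed

lemma v0: "0 \<le> v y"
  by (rule order_trans[OF zero_le_one v1])

lemma convergence:
  assumes "0 \<le> u" "h \<in> borel_measurable borel" "\<And>y. \<bar>h y\<bar> \<le> v y"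
  shows "\<bar>(\<integral>\<omega>. h (Y u \<omega>) \<partial>P x) - (\<integral>y. h y \<partial>\<pi>)\<bar> \<le> d * v x * exp (- \<alpha> * u)"
  using ergodic[OF assms] by (simp add: Y_def assms(1))

text \<open>Scaling a bounded function into the unit ball, which lies below \<open>v \<ge> 1\<close>.\<close>

lemma convergence_bounded:
  assumes "0 \<le> u" and h: "h \<in> borel_measurable borel" "\<And>y. \<bar>h y\<bar> \<le> B" and B: "0 < B"
  shows "\<bar>(\<integral>\<omega>. h (Y u \<omega>) \<partial>P x) - (\<integral>y. h y \<partial>\<pi>)\<bar> \<le> B * d * v x * exp (- \<alpha> * u)"
proof -
  have "\<bar>(\<integral>\<omega>. h (Y u \<omega>) / B \<partial>P x) - (\<integral>y. h y / B \<partial>\<pi>)\<bar> \<le> d * v x * exp (- \<alpha> * u)"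
  proof (rule convergence)
    show "\<bar>h y / B\<bar> \<le> v y" for y
    proof -
      have "\<bar>h y / B\<bar> \<le> 1" using h(2)[of y] B by simp
      then show ?thesis using v1[of y] by linarith
    qed
  qed (use assms in measurable)
  then have "\<bar>((\<integral>\<omega>. h (Y u \<omega>) \<partial>P x) - (\<integral>y. h y \<partial>\<pi>)) / B\<bar> \<le> d * v x * exp (- \<alpha> * u)"
    by (simp add: diff_divide_distrib)
  then show ?thesis using B by (simp add: abs_divide field_simps)
qed

lemma semigroup_bound: "0 \<le> u \<Longrightarrow> \<bar>semigroup u y\<bar> \<le> C * d * v y * exp (- \<alpha> * u)"
  using convergence_bounded[of u fc C y] fc_le C_pos by (simp add: semigroup_def integral_fc)

lemma expectation_initial:
  assumes [measurable]: "h \<in> borel_measurable borel"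
  shows "(\<integral>\<omega>. h (Y 0 \<omega>) \<partial>P x) = (h x :: real)"
proof -
  interpret Px: prob_space "P x" by (rule prob_space_P)
  have "AE \<omega> in P x. X 0 \<omega> = x" using markov by (simp add: markov_process_def)
  then have "AE \<omega> in P x. h (Y 0 \<omega>) = h x" by eventually_elim (simp add: Y_def)
  then have "(\<integral>\<omega>. h (Y 0 \<omega>) \<partial>P x) = (\<integral>\<omega>. h x \<partial>P x)"
    by (intro integral_cong_AE) measurable
  then show ?thesis by (simp add: Px.prob_space)
qed

lemma v_integrable_\<pi>: "integrable \<pi> v"
proof (rule integrable_of_bounded_truncations(1)[OF \<pi>, where B="v undefined + d * v undefined"])
  fix n :: nat
  have "\<bar>(\<integral>\<omega>. min (v (Y 0 \<omega>)) (real n) \<partial>P undefined) - (\<integral>y. min (v y) (real n) \<partial>\<pi>)\<bar> \<le> d * v undefined * exp (- \<alpha> * 0)"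
    using v1 by (intro convergence) (auto simp: min_def abs_real_def not_less v0)
  moreover have "(\<integral>\<omega>. min (v (Y 0 \<omega>)) (real n) \<partial>P undefined) = min (v undefined) (real n)"
    by (rule expectation_initial) measurable
  ultimately show "(\<integral>y. min (v y) (real n) \<partial>\<pi>) \<le> v undefined + d * v undefined" by auto
qed (use v1 in auto)

text \<open>A bound for the mean of \<open>v\<close> along the process that is uniform in time.\<close>

definition v_moment_bound where "v_moment_bound x = (\<integral>y. v y \<partial>\<pi>) + d * v x"

lemma v_integrable: "integrable (P x) (\<lambda>\<omega>. v (Y u \<omega>))"
  and expectation_v_le: "(\<integral>\<omega>. v (Y u \<omega>) \<partial>P x) \<le> v_moment_bound x"
proof -
  have "(\<integral>\<omega>. min (v (Y u \<omega>)) (real n) \<partial>P x) \<le> v_moment_bound x" for n :: nat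
  proof -
    have "\<bar>(\<integral>\<omega>. min (v (Y (max 0 u) \<omega>)) (real n) \<partial>P x) - (\<integral>y. min (v y) (real n) \<partial>\<pi>)\<bar> \<le> d * v x * exp (- \<alpha> * max 0 u)"
      using v1 by (intro convergence) (auto simp: min_def abs_real_def not_less v0)
    also have "\<dots> \<le> d * v x"
      using \<alpha>_pos d_nonneg v1[of x] by (intro mult_right_le_one_le) auto
    moreover have "(\<integral>y. min (v y) (real n) \<partial>\<pi>) \<le> (\<integral>y. v y \<partial>\<pi>)"
      using v1 by (intro integral_mono v_integrable_\<pi> Bochner_Integration.integrable_bound[OF v_integrable_\<pi>])
        (auto simp: min_def abs_real_def not_less v0)
    ultimately show ?thesis by (simp add: Y_def v_moment_bound_def)
  qed
  from integrable_of_bounded_truncations[OF prob_space_P _ _ this] v1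
  show "integrable (P x) (\<lambda>\<omega>. v (Y u \<omega>))" "(\<integral>\<omega>. v (Y u \<omega>) \<partial>P x) \<le> v_moment_bound x"
    by auto
qed

definition past :: "real \<Rightarrow> 's \<Rightarrow> 'w measure" where "past s x = generated (P x) borel X {0..s}"

lemma subalgebra_past: "subalgebra (P x) (past s x)"
  unfolding past_def by (intro subalgebra_generated) (use X_measurable in auto)

lemma Y_past: "0 \<le> s \<Longrightarrow> u \<le> s \<Longrightarrow> Y u \<in> borel_measurable (past s x)"
  unfolding past_def Y_def by (rule measurable_generated) auto

text \<open>The Markov property is assumed for indicators of states; monotone approximation extends it to all
  non-negative functions of the future state.\<close>

lemma markov_nn_integral:
  assumes s: "0 \<le> s" and w: "0 \<le> w" and B: "B \<in> sets (past s x)"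
    and h: "h \<in> borel_measurable (borel :: 's measure)"
  shows "(\<integral>\<^sup>+\<omega>. indicator B \<omega> * h (Y (s + w) \<omega>) \<partial>P x) =
    (\<integral>\<^sup>+\<omega>. indicator B \<omega> * (\<integral>\<^sup>+\<omega>'. h (Y w \<omega>') \<partial>P (Y s \<omega>)) \<partial>P x)"
proof -
  interpret Px: prob_space "P x" by (rule prob_space_P)
  interpret sub: finite_measure_subalgebra "P x" "past s x"
    by unfold_locales (rule subalgebra_past)
  have BM [measurable]: "B \<in> sets M"
    using B subalgebra_past[of x s] sets_P[of x] by (auto simp: subalgebra_def)
  have kernel' [measurable]: "P \<in> borel \<rightarrow>\<^sub>M subprob_algebra M"
    by (rule measurable_prob_algebraD[OF kernel])
  have inner [measurable]: "(\<lambda>\<omega>. \<integral>\<^sup>+\<omega>'. q (Y w \<omega>') \<partial>P (Y s \<omega>)) \<in> borel_measurable M"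
    if [measurable]: "q \<in> borel_measurable (borel :: 's measure)" for q :: "'s \<Rightarrow> ennreal"
    by (rule nn_integral_measurable_subprob_algebra2[where N=M]) measurable
  show ?thesis
    using h
  proof (induction rule: borel_measurable_induct)
    case (cong f g)
    then show ?case by simp
  next
    case (set A)
    note [measurable] = set
    have int: "integrable (P x) (\<lambda>\<omega>. indicator B \<omega> * indicator {\<omega> \<in> space M. X (s + w) \<omega> \<in> A} \<omega> :: real)"
      using X_measurable[of "s + w"] s w by (intro Px.integrable_const_bound[where B=1]) (auto simp: indicator_def)
    have m: "(\<lambda>\<omega>. measure (P (Y s \<omega>)) {\<omega>' \<in> space M. Y w \<omega>' \<in> A}) \<in> borel_measurable M"
      by (rule measure_measurable_subprob_algebra2[where N=M]) measurable
    have eqm: "(\<integral>\<^sup>+\<omega>'. indicator A (Y w \<omega>') \<partial>P y) = ennreal (measure (P y) {\<omega>' \<in> space M. Y w \<omega>' \<in> A})" for y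
    proof -
      interpret Py: prob_space "P y" by (rule prob_space_P)
      have "(\<integral>\<^sup>+\<omega>'. indicator A (Y w \<omega>') \<partial>P y) = (\<integral>\<^sup>+\<omega>'. indicator {\<omega>' \<in> space M. Y w \<omega>' \<in> A} \<omega>' \<partial>P y)"
        by (intro nn_integral_cong) (auto simp: indicator_def space_P)
      then show ?thesis by (simp add: Py.emeasure_eq_measure)
    qed
    have "(\<integral>\<^sup>+\<omega>. indicator B \<omega> * indicator A (Y (s + w) \<omega>) \<partial>P x)
      = (\<integral>\<^sup>+\<omega>. ennreal (indicator B \<omega> * indicator {\<omega> \<in> space M. X (s + w) \<omega> \<in> A} \<omega>) \<partial>P x)"
      using s w by (intro nn_integral_cong) (auto simp: indicator_def space_P Y_def)
    also have "\<dots> = ennreal (\<integral>\<omega>. indicator B \<omega> * indicator {\<omega> \<in> space M. X (s + w) \<omega> \<in> A} \<omega> \<partial>P x)"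
      by (rule nn_integral_eq_integral[OF int]) auto
    also have "(\<integral>\<omega>. indicator B \<omega> * indicator {\<omega> \<in> space M. X (s + w) \<omega> \<in> A} \<omega> \<partial>P x)
      = (\<integral>\<omega>. indicator B \<omega> * real_cond_exp (P x) (past s x) (indicator {\<omega> \<in> space M. X (s + w) \<omega> \<in> A}) \<omega> \<partial>P x)"
      using X_measurable[of "s + w"] s w B by (intro sub.real_cond_exp_intg(2)[symmetric] int) auto
    also have "\<dots> = (\<integral>\<omega>. indicator B \<omega> * measure (P (Y s \<omega>)) {\<omega>' \<in> space M. Y w \<omega>' \<in> A} \<partial>P x)"
    proof (rule integral_cong_AE)
      have "AE \<omega> in P x. real_cond_exp (P x) (past s x) (indicator {\<omega> \<in> space M. X (s + w) \<omega> \<in> A}) \<omega>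
         = measure (P (X s \<omega>)) {\<omega>' \<in> space M. X w \<omega>' \<in> A}"
        using markov s w set unfolding markov_process_def past_def by blast
      then show "AE \<omega> in P x. indicator B \<omega> * real_cond_exp (P x) (past s x) (indicator {\<omega> \<in> space M. X (s + w) \<omega> \<in> A}) \<omega>
        = indicator B \<omega> * measure (P (Y s \<omega>)) {\<omega>' \<in> space M. Y w \<omega>' \<in> A}"
        by eventually_elim (use s w in \<open>simp add: Y_def\<close>)
    qed (use m in auto)
    also have "ennreal \<dots> = (\<integral>\<^sup>+\<omega>. ennreal (indicator B \<omega> * measure (P (Y s \<omega>)) {\<omega>' \<in> space M. Y w \<omega>' \<in> A}) \<partial>P x)"
    proof (rule nn_integral_eq_integral[symmetric])
      show "integrable (P x) (\<lambda>\<omega>. indicator B \<omega> * measure (P (Y s \<omega>)) {\<omega>' \<in> space M. Y w \<omega>' \<in> A})"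
      proof (rule Px.integrable_const_bound[where B=1])
        show "AE \<omega> in P x. norm (indicator B \<omega> * measure (P (Y s \<omega>)) {\<omega>' \<in> space M. Y w \<omega>' \<in> A}) \<le> 1"
          using prob_space.prob_le_1[OF prob_space_P] by (auto simp: indicator_def)
      qed (use m in auto)
    qed auto
    also have "\<dots> = (\<integral>\<^sup>+\<omega>. indicator B \<omega> * (\<integral>\<^sup>+\<omega>'. indicator A (Y w \<omega>') \<partial>P (Y s \<omega>)) \<partial>P x)"
      unfolding eqm by (intro nn_integral_cong) (auto simp: indicator_def)
    finally show ?case .
  next
    case (mult u c)
    note [measurable] = mult(2)
    have "(\<integral>\<^sup>+\<omega>. indicator B \<omega> * (c * u (Y (s + w) \<omega>)) \<partial>P x) = c * (\<integral>\<^sup>+\<omega>. indicator B \<omega> * u (Y (s + w) \<omega>) \<partial>P x)"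
      by (subst nn_integral_cmult[symmetric]) (auto simp: mult.left_commute)
    also have "\<dots> = (\<integral>\<^sup>+\<omega>. indicator B \<omega> * (c * (\<integral>\<^sup>+\<omega>'. u (Y w \<omega>') \<partial>P (Y s \<omega>))) \<partial>P x)"
      unfolding mult(4) by (subst nn_integral_cmult[symmetric]) (auto simp: mult.left_commute)
    finally show ?case by (simp add: nn_integral_cmult)
  next
    case (add u q)
    note [measurable] = \<open>u \<in> borel_measurable borel\<close> \<open>q \<in> borel_measurable borel\<close>
    have "(\<integral>\<^sup>+\<omega>. indicator B \<omega> * (q (Y (s + w) \<omega>) + u (Y (s + w) \<omega>)) \<partial>P x)
      = (\<integral>\<^sup>+\<omega>. indicator B \<omega> * q (Y (s + w) \<omega>) \<partial>P x) + (\<integral>\<^sup>+\<omega>. indicator B \<omega> * u (Y (s + w) \<omega>) \<partial>P x)"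
      unfolding distrib_left by (rule nn_integral_add) measurable
    also have "\<dots> = (\<integral>\<^sup>+\<omega>. indicator B \<omega> * (\<integral>\<^sup>+\<omega>'. q (Y w \<omega>') \<partial>P (Y s \<omega>)) + indicator B \<omega> * (\<integral>\<^sup>+\<omega>'. u (Y w \<omega>') \<partial>P (Y s \<omega>)) \<partial>P x)"
      unfolding add by (rule nn_integral_add[symmetric]) measurable
    also have "\<dots> = (\<integral>\<^sup>+\<omega>. indicator B \<omega> * (\<integral>\<^sup>+\<omega>'. q (Y w \<omega>') + u (Y w \<omega>') \<partial>P (Y s \<omega>)) \<partial>P x)"
      unfolding distrib_left[symmetric] by (intro nn_integral_cong arg_cong2[where f="(*)"] nn_integral_add[symmetric] refl) measurable
    finally show ?case .
  next
    case (seq U)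
    note [measurable] = seq(1)
    have [simp]: "incseq (\<lambda>i \<omega>. U i (Y r \<omega>))" for r
      using \<open>incseq U\<close> by (auto simp: incseq_def le_fun_def)
    have inc: "incseq (\<lambda>i \<omega>. indicator B \<omega> * U i (Y (s + w) \<omega>))"
      using \<open>incseq U\<close> by (auto simp: incseq_def le_fun_def intro!: mult_left_mono)
    have inc': "incseq (\<lambda>i \<omega>. indicator B \<omega> * (\<integral>\<^sup>+\<omega>'. U i (Y w \<omega>') \<partial>P (Y s \<omega>)))"
      using \<open>incseq U\<close> by (auto simp: incseq_def le_fun_def intro!: mult_left_mono nn_integral_mono)
    have "(\<integral>\<^sup>+\<omega>. indicator B \<omega> * (SUP i. U i) (Y (s + w) \<omega>) \<partial>P x) = (\<integral>\<^sup>+\<omega>. (SUP i. indicator B \<omega> * U i (Y (s + w) \<omega>)) \<partial>P x)"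
      by (simp add: SUP_apply SUP_mult_left_ennreal image_comp)
    also have "\<dots> = (SUP i. \<integral>\<^sup>+\<omega>. indicator B \<omega> * U i (Y (s + w) \<omega>) \<partial>P x)"
      by (rule nn_integral_monotone_convergence_SUP[OF inc]) auto
    also have "\<dots> = (SUP i. \<integral>\<^sup>+\<omega>. indicator B \<omega> * (\<integral>\<^sup>+\<omega>'. U i (Y w \<omega>') \<partial>P (Y s \<omega>)) \<partial>P x)"
      using seq.IH by simp
    also have "\<dots> = (\<integral>\<^sup>+\<omega>. (SUP i. indicator B \<omega> * (\<integral>\<^sup>+\<omega>'. U i (Y w \<omega>') \<partial>P (Y s \<omega>))) \<partial>P x)"
      by (rule nn_integral_monotone_convergence_SUP[OF inc', symmetric]) auto
    also have "\<dots> = (\<integral>\<^sup>+\<omega>. indicator B \<omega> * (SUP i. (\<integral>\<^sup>+\<omega>'. U i (Y w \<omega>') \<partial>P (Y s \<omega>))) \<partial>P x)"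
      by (simp add: SUP_mult_left_ennreal)
    also have "\<dots> = (\<integral>\<^sup>+\<omega>. indicator B \<omega> * (\<integral>\<^sup>+\<omega>'. (SUP i. U i) (Y w \<omega>') \<partial>P (Y s \<omega>)) \<partial>P x)"
      by (simp add: SUP_apply image_comp nn_integral_monotone_convergence_SUP)
    finally show ?case .
  qed
qed

lemma integrable_bounded_state:
  assumes [measurable]: "(h :: 's \<Rightarrow> real) \<in> borel_measurable borel" and "\<And>y. \<bar>h y\<bar> \<le> D"
  shows "integrable (P y) (\<lambda>\<omega>. h (Y u \<omega>))"
  using prob_space_P[of y] assms(2)
  by (intro finite_measure.integrable_const_bound[where B=D]) (auto simp: prob_space.finite_measure)

lemma abs_mean_state_le:
  assumes h: "(h :: 's \<Rightarrow> real) \<in> borel_measurable borel" and hD: "\<And>y. \<bar>h y\<bar> \<le> D"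
  shows "\<bar>\<integral>\<omega>. h (Y u \<omega>) \<partial>P y\<bar> \<le> D"
proof -
  interpret Py: prob_space "P y" by (rule prob_space_P)
  have "\<bar>\<integral>\<omega>. h (Y u \<omega>) \<partial>P y\<bar> \<le> (\<integral>\<omega>. \<bar>h (Y u \<omega>)\<bar> \<partial>P y)" by (rule integral_abs_bound)
  also have "\<dots> \<le> (\<integral>\<omega>. D \<partial>P y)"
    by (intro integral_mono integrable_abs integrable_bounded_state[OF h hD]) (auto simp: hD)
  finally show ?thesis by (simp add: Py.prob_space)
qed

lemma markov_set_integral:
  assumes s: "0 \<le> s" and w: "0 \<le> w" and B: "B \<in> sets (past s x)"
    and h [measurable]: "(h :: 's \<Rightarrow> real) \<in> borel_measurable borel" and hD: "\<And>y. \<bar>h y\<bar> \<le> D"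
  shows "(\<integral>\<omega>. indicator B \<omega> * h (Y (s + w) \<omega>) \<partial>P x) = 
     (\<integral>\<omega>. indicator B \<omega> * (\<integral>\<omega>'. h (Y w \<omega>') \<partial>P (Y s \<omega>)) \<partial>P x)"
proof -
  interpret Px: prob_space "P x" by (rule prob_space_P)
  have BM [measurable]: "B \<in> sets M"
    using B subalgebra_past[of x s] sets_P[of x] by (auto simp: subalgebra_def)
  have D0: "0 \<le> D" by (rule order_trans[OF abs_ge_zero hD])
  define H where "H y = (\<integral>\<omega>'. h (Y w \<omega>') \<partial>P y)" for y
  have [measurable]: "H \<in> borel_measurable borel" unfolding H_def
    by (rule integral_measurable_prob_kernel[OF _ kernel]) measurable
  note hint = integrable_bounded_state[OF h hD]
  have HD: "\<bar>H y\<bar> \<le> D" for y unfolding H_def by (rule abs_mean_state_le[OF h hD])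
  have h0: "0 \<le> h y + D" and H0: "0 \<le> H y + D" for y using hD[of y] HD[of y] by linarith+
  have nnH: "(\<integral>\<^sup>+\<omega>'. ennreal (h (Y w \<omega>') + D) \<partial>P y) = ennreal (H y + D)" for y
  proof -
    interpret Py: prob_space "P y" by (rule prob_space_P)
    show ?thesis unfolding H_def using hint[of y w] h0
      by (subst nn_integral_eq_integral) (auto simp: Py.prob_space)
  qed
  have ib: "integrable (P x) (\<lambda>\<omega>. indicator B \<omega> * q (Y u \<omega>))"
    if [measurable]: "q \<in> borel_measurable borel" and "\<And>y. \<bar>q y\<bar> \<le> E" for q :: "'s \<Rightarrow> real" and u E
  proof (rule Px.integrable_const_bound[where B="E"])
    show "AE \<omega> in P x. norm (indicator B \<omega> * q (Y u \<omega>)) \<le> E"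
      using that(2) order_trans[OF abs_ge_zero that(2)] by (auto simp: indicator_def)
  qed measurable
  have b: "\<bar>h y + D\<bar> \<le> 2 * D" "\<bar>H y + D\<bar> \<le> 2 * D" for y using hD[of y] HD[of y] by linarith+
  have "ennreal (\<integral>\<omega>. indicator B \<omega> * (h (Y (s + w) \<omega>) + D) \<partial>P x)
    = (\<integral>\<^sup>+\<omega>. indicator B \<omega> * ennreal (h (Y (s + w) \<omega>) + D) \<partial>P x)"
    using ib[of "\<lambda>y. h y + D", OF _ b(1)] h0
    by (subst nn_integral_eq_integral[symmetric]) (auto simp: ennreal_mult' ennreal_indicator)
  also have "\<dots> = (\<integral>\<^sup>+\<omega>. indicator B \<omega> * ennreal (H (Y s \<omega>) + D) \<partial>P x)"
    by (subst markov_nn_integral[OF s w B]) (auto simp: nnH)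
  also have "\<dots> = ennreal (\<integral>\<omega>. indicator B \<omega> * (H (Y s \<omega>) + D) \<partial>P x)"
    using ib[of "\<lambda>y. H y + D", OF _ b(2)] H0
    by (subst nn_integral_eq_integral[symmetric]) (auto simp: ennreal_mult' ennreal_indicator)
  finally have "(\<integral>\<omega>. indicator B \<omega> * (h (Y (s + w) \<omega>) + D) \<partial>P x) = (\<integral>\<omega>. indicator B \<omega> * (H (Y s \<omega>) + D) \<partial>P x)"
    by (subst (asm) ennreal_inj) (auto intro!: integral_nonneg_AE simp: h0 H0)
  moreover have "integrable (P x) (\<lambda>\<omega>. indicator B \<omega> * D)" by (rule ib) auto
  ultimately show ?thesis
    using ib[OF h hD, of "s + w"] ib[of H, OF _ HD, of s]
    by (simp add: distrib_left H_def)
qed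

text \<open>The Markov property as orthogonality: the prediction error of a bounded function of a future
  state is orthogonal to the past.  This is the form that can be combined with time integrals of
  the past.\<close>

lemma markov_orthogonal:
  assumes s: "0 \<le> s" and w: "0 \<le> w" and h [measurable]: "(h :: 's \<Rightarrow> real) \<in> borel_measurable borel" and hD: "\<And>y. \<bar>h y\<bar> \<le> D"
    and Z: "Z \<in> borel_measurable (past s x)" and ZB: "\<And>\<omega>. \<bar>Z \<omega>\<bar> \<le> B"
  shows "(\<integral>\<omega>. Z \<omega> * (h (Y (s + w) \<omega>) - (\<integral>\<omega>'. h (Y w \<omega>') \<partial>P (Y s \<omega>))) \<partial>P x) = 0"
proof -
  interpret Px: prob_space "P x" by (rule prob_space_P)
  interpret sub: finite_measure_subalgebra "P x" "past s x"
    by unfold_locales (rule subalgebra_past)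
  have ZM [measurable]: "Z \<in> borel_measurable M"
    using measurable_from_subalg[OF subalgebra_past Z] by simp
  define H where "H y = (\<integral>\<omega>'. h (Y w \<omega>') \<partial>P y)" for y
  have Hm [measurable]: "H \<in> borel_measurable borel" unfolding H_def
    by (rule integral_measurable_prob_kernel[OF _ kernel]) measurable
  note hint = integrable_bounded_state[OF h hD]
  have HD: "\<bar>H y\<bar> \<le> D" for y unfolding H_def by (rule abs_mean_state_le[OF h hD])
  have B0: "0 \<le> B" by (rule order_trans[OF abs_ge_zero ZB])
  have i: "integrable (P x) (\<lambda>\<omega>. Z \<omega> * q (Y u \<omega>))"
    if [measurable]: "q \<in> borel_measurable borel" and "\<And>y. \<bar>q y\<bar> \<le> D" for q :: "'s \<Rightarrow> real" and u
    by (rule Px.integrable_const_bound[where B="B * D"])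
       (auto simp: abs_mult intro!: mult_mono that ZB B0)
  have iH: "integrable (P x) (\<lambda>\<omega>. H (Y s \<omega>))"
    by (rule Px.integrable_const_bound[where B=D]) (auto simp: HD)
  have ae: "AE \<omega> in P x. real_cond_exp (P x) (past s x) (\<lambda>\<omega>. h (Y (s + w) \<omega>)) \<omega> = H (Y s \<omega>)"
  proof (rule sub.real_cond_exp_charact)
    fix A assume "A \<in> sets (past s x)"
    from markov_set_integral[OF s w this h hD]
    show "(LINT \<omega>:A|P x. h (Y (s + w) \<omega>)) = (LINT \<omega>:A|P x. H (Y s \<omega>))"
      by (simp add: set_lebesgue_integral_def H_def)
  next
    show "(\<lambda>\<omega>. H (Y s \<omega>)) \<in> borel_measurable (past s x)"
      by (rule measurable_compose[OF Y_past[OF s order_refl] Hm])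
  qed (use hint iH in auto)
  have "(\<integral>\<omega>. Z \<omega> * h (Y (s + w) \<omega>) \<partial>P x) = (\<integral>\<omega>. Z \<omega> * real_cond_exp (P x) (past s x) (\<lambda>\<omega>. h (Y (s + w) \<omega>)) \<omega> \<partial>P x)"
    by (rule sub.real_cond_exp_intg(2)[symmetric, OF i[OF h hD] Z]) measurable
  also have "\<dots> = (\<integral>\<omega>. Z \<omega> * H (Y s \<omega>) \<partial>P x)"
    by (rule integral_cong_AE) (use ae in auto)
  finally show ?thesis
    using i[OF h hD, of "s + w"] i[OF Hm HD, of s] by (simp add: right_diff_distrib H_def)
qed

section \<open>Moments of the fluctuation of the offered load\<close>

text \<open>The deviation of the offered load from its average, accumulated over arrival times up to \<open>r\<close>.  The
  weight \<open>k u\<close> stands for the probability that a customer arriving at time \<open>u\<close> is still present at the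
  time of observation.\<close>

definition fluctuation :: "(real \<Rightarrow> real) \<Rightarrow> real \<Rightarrow> real \<Rightarrow> 'w \<Rightarrow> real"
  where "fluctuation k \<epsilon> r \<omega> = (LINT u:{0..r}|lborel. k u * fc (Y (u / \<epsilon>) \<omega>))"

text \<open>The mean of \<open>j\<close> factors of the past, the centred intensity at real time \<open>q\<close>, and its prediction for
  the process time \<open>w\<close> later.\<close>

definition cross_moment :: "(real \<Rightarrow> real) \<Rightarrow> 's \<Rightarrow> real \<Rightarrow> nat \<Rightarrow> real \<Rightarrow> real \<Rightarrow> real"
  where "cross_moment k x \<epsilon> j q w =
    (\<integral>\<omega>. fluctuation k \<epsilon> q \<omega> ^ j * (fc (Y (q / \<epsilon>) \<omega>) * semigroup w (Y (q / \<epsilon>) \<omega>)) \<partial>P x)"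

lemma fluctuation_measurable [measurable]:
  assumes [measurable]: "k \<in> borel_measurable borel"
  shows "(\<lambda>(q, \<omega>). fluctuation k \<epsilon> q \<omega>) \<in> borel_measurable (borel \<Otimes>\<^sub>M M)"
proof -
  have "(\<lambda>(q, \<omega>). LINT u|lborel. (if 0 \<le> u \<and> u \<le> q then k u * fc (Y (u / \<epsilon>) \<omega>) else 0)) \<in> borel_measurable (borel \<Otimes>\<^sub>M M)"
    by measurable
  then show ?thesis
    by (rule measurable_cong[THEN iffD1, rotated])
       (auto simp: fluctuation_def set_lebesgue_integral_def intro!: Bochner_Integration.integral_cong)
qed

lemma fluctuation_bound:
  assumes k1: "\<And>u. \<bar>k u\<bar> \<le> 1" and q: "0 \<le> q"
  shows "\<bar>fluctuation k \<epsilon> q \<omega>\<bar> \<le> C * q"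
proof -
  have "\<bar>fluctuation k \<epsilon> q \<omega>\<bar> \<le> (\<integral>u. \<bar>indicator {0..q} u *\<^sub>R (k u * fc (Y (u / \<epsilon>) \<omega>))\<bar> \<partial>lborel)"
    unfolding fluctuation_def set_lebesgue_integral_def by (rule integral_abs_bound)
  also have "\<dots> \<le> (\<integral>u. indicator {0..q} u *\<^sub>R C \<partial>lborel)"
  proof (rule integral_mono')
    show "integrable lborel (\<lambda>u. indicator {0..q} u *\<^sub>R C)"
      using q by (intro integrable_scaleR_left integrable_real_indicator) auto
    fix u
    have "\<bar>k u * fc (Y (u / \<epsilon>) \<omega>)\<bar> \<le> 1 * C"
      unfolding abs_mult by (intro mult_mono k1 fc_le) auto
    then show "\<bar>indicator {0..q} u *\<^sub>R (k u * fc (Y (u / \<epsilon>) \<omega>))\<bar> \<le> indicator {0..q} u *\<^sub>R C"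
      by (auto simp: indicator_def)
  qed (use C_pos in auto)
  also have "\<dots> = C * q" using q by simp
  finally show ?thesis .
qed

lemma semigroup_le_C: "\<bar>semigroup w y\<bar> \<le> C"
  unfolding semigroup_def by (rule abs_mean_state_le[OF fc_meas fc_le])

lemma cross_moment_markov:
  assumes [measurable]: "k \<in> borel_measurable borel" and k1: "\<And>u. \<bar>k u\<bar> \<le> 1"
    and \<epsilon>: "0 < \<epsilon>" and q: "0 \<le> q" and w: "0 \<le> w"
  shows "(\<integral>\<omega>. fluctuation k \<epsilon> q \<omega> ^ j * (fc (Y (q / \<epsilon>) \<omega>) * fc (Y (q / \<epsilon> + w) \<omega>)) \<partial>P x) = cross_moment k x \<epsilon> j q w"
proof -
  interpret Px: prob_space "P x" by (rule prob_space_P)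
  define s where "s = q / \<epsilon>"
  have s: "0 \<le> s" using q \<epsilon> by (simp add: s_def)
  define U where "U \<omega> = fc (Y (s + w) \<omega>) - semigroup w (Y s \<omega>)" for \<omega>
  have U [measurable]: "U \<in> borel_measurable M" unfolding U_def by measurable
  have z: "(\<integral>\<omega>. fluctuation k \<epsilon> q \<omega> ^ j * fc (Y s \<omega>) * U \<omega> \<partial>P x) = 0"
    unfolding fluctuation_def
  proof (rule Px.expectation_power_integral_zero[OF subalgebra_past[of x s], where C=C and D="2 * C" and B=C])
    show "\<bar>k u * fc (Y (u / \<epsilon>) \<omega>)\<bar> \<le> C" for u \<omega>
      using mult_mono[OF k1[of u] fc_le[of "Y (u / \<epsilon>) \<omega>"]] by (simp add: abs_mult)
    show "(\<lambda>\<omega>. k u * fc (Y (u / \<epsilon>) \<omega>)) \<in> borel_measurable (past s x)" if "u \<in> {0..q}" for u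
    proof -
      have "u / \<epsilon> \<le> s" using that \<epsilon> by (simp add: s_def divide_right_mono)
      then have "(\<lambda>\<omega>. fc (Y (u / \<epsilon>) \<omega>)) \<in> borel_measurable (past s x)"
        by (rule measurable_compose[OF Y_past[OF s] fc_meas])
      then show ?thesis by simp
    qed
    show "\<bar>U \<omega>\<bar> \<le> 2 * C" for \<omega>
      using fc_le[of "Y (s + w) \<omega>"] semigroup_le_C[of w "Y s \<omega>"] unfolding U_def by linarith
    show "(\<integral>\<omega>. Z \<omega> * U \<omega> \<partial>P x) = 0" if "Z \<in> borel_measurable (past s x)" "\<And>\<omega>. \<bar>Z \<omega>\<bar> \<le> B" for Z B
      unfolding U_def semigroup_def by (rule markov_orthogonal[OF s w fc_meas fc_le that])
    show "(\<lambda>\<omega>. fc (Y s \<omega>)) \<in> borel_measurable (past s x)"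
      by (rule measurable_compose[OF Y_past[OF s order_refl] fc_meas])
  qed (use q in \<open>auto simp: fc_le\<close>)
  have i: "integrable (P x) (\<lambda>\<omega>. fluctuation k \<epsilon> q \<omega> ^ j * fc (Y s \<omega>) * W \<omega>)"
    if [measurable]: "W \<in> borel_measurable M" and WC: "\<And>\<omega>. \<bar>W \<omega>\<bar> \<le> C" for W
  proof (rule Px.integrable_const_bound[where B="(C * q) ^ j * C * C"])
    show "AE \<omega> in P x. norm (fluctuation k \<epsilon> q \<omega> ^ j * fc (Y s \<omega>) * W \<omega>) \<le> (C * q) ^ j * C * C"
      unfolding real_norm_def abs_mult power_abs
      by (intro AE_I2 mult_mono power_mono fluctuation_bound k1 q fc_le WC)
         (use C_pos q in auto)
  qed measurable
  have i1: "integrable (P x) (\<lambda>\<omega>. fluctuation k \<epsilon> q \<omega> ^ j * fc (Y s \<omega>) * fc (Y (s + w) \<omega>))"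
    by (rule i) (auto simp: fc_le)
  have i2: "integrable (P x) (\<lambda>\<omega>. fluctuation k \<epsilon> q \<omega> ^ j * fc (Y s \<omega>) * semigroup w (Y s \<omega>))"
    by (rule i) (auto simp: semigroup_le_C)
  show ?thesis
    using z i1 i2 unfolding cross_moment_def U_def s_def[symmetric]
    by (simp add: right_diff_distrib mult.assoc)
qed

lemma cross_moment_measurable [measurable]:
  assumes [measurable]: "k \<in> borel_measurable borel"
  shows "(\<lambda>z. cross_moment k x \<epsilon> j (fst z) (snd z)) \<in> borel_measurable borel"
proof -
  interpret Px: prob_space "P x" by (rule prob_space_P)
  have "(\<lambda>z. cross_moment k x \<epsilon> j (fst z) (snd z)) \<in> borel_measurable (borel \<Otimes>\<^sub>M borel)"
    unfolding cross_moment_def by measurable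
  then show ?thesis by (simp add: borel_prod)
qed

text \<open>Exponential decay in \<open>w\<close>, uniformly in \<open>\<epsilon>\<close>: the prediction decays like \<open>v exp(- \<alpha> w)\<close>, and \<open>v\<close> has
  uniformly bounded means along the process.\<close>

lemma cross_moment_bound:
  assumes [measurable]: "k \<in> borel_measurable borel" and k1: "\<And>u. \<bar>k u\<bar> \<le> 1"
    and q: "0 \<le> q" and w: "0 \<le> w"
  shows "\<bar>cross_moment k x \<epsilon> j q w\<bar> \<le> (C * q) ^ j * (C * (C * d * v_moment_bound x)) * exp (- \<alpha> * w)"
proof -
  interpret Px: prob_space "P x" by (rule prob_space_P)
  define E where "E = (C * q) ^ j * (C * (C * d)) * exp (- \<alpha> * w)"
  have E0: "0 \<le> E" using C_pos q d_nonneg by (simp add: E_def)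
  have "\<bar>cross_moment k x \<epsilon> j q w\<bar> \<le> (\<integral>\<omega>. \<bar>fluctuation k \<epsilon> q \<omega> ^ j * (fc (Y (q / \<epsilon>) \<omega>) * semigroup w (Y (q / \<epsilon>) \<omega>))\<bar> \<partial>P x)"
    unfolding cross_moment_def by (rule integral_abs_bound)
  also have "\<dots> \<le> (\<integral>\<omega>. E * v (Y (q / \<epsilon>) \<omega>) \<partial>P x)"
  proof (rule integral_mono')
    fix \<omega>
    have "\<bar>fluctuation k \<epsilon> q \<omega> ^ j * (fc (Y (q / \<epsilon>) \<omega>) * semigroup w (Y (q / \<epsilon>) \<omega>))\<bar>
       \<le> (C * q) ^ j * (C * (C * d * v (Y (q / \<epsilon>) \<omega>) * exp (- \<alpha> * w)))"
      unfolding abs_mult power_abs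
      by (intro mult_mono power_mono fluctuation_bound k1 q fc_le semigroup_bound w)
         (use C_pos q in auto)
    then show "\<bar>fluctuation k \<epsilon> q \<omega> ^ j * (fc (Y (q / \<epsilon>) \<omega>) * semigroup w (Y (q / \<epsilon>) \<omega>))\<bar> \<le> E * v (Y (q / \<epsilon>) \<omega>)"
      by (simp add: E_def mult_ac)
    show "0 \<le> E * v (Y (q / \<epsilon>) \<omega>)" using E0 v0 by simp
  qed (use v_integrable in auto)
  also have "\<dots> = E * (\<integral>\<omega>. v (Y (q / \<epsilon>) \<omega>) \<partial>P x)" by simp
  also have "\<dots> \<le> E * v_moment_bound x" by (intro mult_left_mono expectation_v_le E0)
  finally show ?thesis by (simp add: E_def mult_ac)
qed

text \<open>The pairs of a time \<open>q\<close> and a delay \<open>w\<close> on the fast scale for which \<open>q + \<epsilon> w\<close> does not exceed \<open>r\<close>.\<close>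

definition triangle :: "real \<Rightarrow> real \<Rightarrow> (real \<times> real) set"
  where "triangle \<epsilon> r = {z. 0 \<le> fst z \<and> 0 \<le> snd z \<and> fst z + \<epsilon> * snd z \<le> r}"

lemma triangle_measurable [measurable]: "triangle \<epsilon> r \<in> sets borel"
  unfolding triangle_def by (intro borel_closed closed_Collect_conj closed_Collect_le continuous_intros)

definition moment_integrand :: "(real \<Rightarrow> real) \<Rightarrow> 's \<Rightarrow> real \<Rightarrow> nat \<Rightarrow> real \<Rightarrow> real \<times> real \<Rightarrow> real"
  where "moment_integrand k x \<epsilon> j r z = indicator (triangle \<epsilon> r) z *
    (k (fst z) * k (fst z + \<epsilon> * snd z) * cross_moment k x \<epsilon> j (fst z) (snd z))"

text \<open>The change to the fast time scale, \<open>u = q + \<epsilon> w\<close>, which produces the factor \<open>\<epsilon>\<close>.\<close>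

lemma fluctuation_tail:
  assumes \<epsilon>: "0 < \<epsilon>"
  shows "(LINT u:{q..r}|lborel. k u * fc (Y (u / \<epsilon>) \<omega>)) =
    \<epsilon> * (\<integral>w. indicator {w. 0 \<le> w \<and> q + \<epsilon> * w \<le> r} w * (k (q + \<epsilon> * w) * fc (Y (q / \<epsilon> + w) \<omega>)) \<partial>lborel)"
proof -
  have "(LINT u:{q..r}|lborel. k u * fc (Y (u / \<epsilon>) \<omega>))
    = \<bar>\<epsilon>\<bar> *\<^sub>R (\<integral>w. indicator {q..r} (q + \<epsilon> * w) *\<^sub>R (k (q + \<epsilon> * w) * fc (Y ((q + \<epsilon> * w) / \<epsilon>) \<omega>)) \<partial>lborel)"
    unfolding set_lebesgue_integral_def using \<epsilon> by (intro lborel_integral_real_affine) auto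
  also have "(\<integral>w. indicator {q..r} (q + \<epsilon> * w) *\<^sub>R (k (q + \<epsilon> * w) * fc (Y ((q + \<epsilon> * w) / \<epsilon>) \<omega>)) \<partial>lborel)
    = (\<integral>w. indicator {w. 0 \<le> w \<and> q + \<epsilon> * w \<le> r} w * (k (q + \<epsilon> * w) * fc (Y (q / \<epsilon> + w) \<omega>)) \<partial>lborel)"
    using \<epsilon> by (intro Bochner_Integration.integral_cong) (auto simp: indicator_def add_divide_distrib zero_le_mult_iff)
  finally show ?thesis using \<epsilon> by simp
qed

text \<open>The exact formula behind all moment estimates.  Along each path it is \<open>primitive_power_nested\<close> on the
  fast time scale; taking means inside the integral lets the Markov property turn the second
  intensity into its prediction.\<close>

lemma fluctuation_moment:
  assumes k [measurable]: "k \<in> borel_measurable borel" and k1: "\<And>u. \<bar>k u\<bar> \<le> 1"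
    and \<epsilon>: "0 < \<epsilon>" and r: "0 \<le> r"
  shows "(\<integral>\<omega>. fluctuation k \<epsilon> r \<omega> ^ (j + 2) \<partial>P x) = real ((j + 2) * (j + 1)) * \<epsilon> *
    (\<integral>z. moment_integrand k x \<epsilon> j r z \<partial>lborel)"
proof -
  interpret Px: prob_space "P x" by (rule prob_space_P)
  define \<Phi> where "\<Phi> z \<omega> = indicator (triangle \<epsilon> r) z * (k (fst z) * k (fst z + \<epsilon> * snd z) *
     (fluctuation k \<epsilon> (fst z) \<omega> ^ j * (fc (Y (fst z / \<epsilon>) \<omega>) * fc (Y (fst z / \<epsilon> + snd z) \<omega>))))" for z \<omega>
  have ind [measurable]: "(\<lambda>z. indicator (triangle \<epsilon> r) z :: real) \<in> borel_measurable (borel \<Otimes>\<^sub>M borel)"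
    unfolding borel_prod by measurable
  have \<Phi>m' [measurable]: "(\<lambda>(z, \<omega>). \<Phi> z \<omega>) \<in> borel_measurable ((borel \<Otimes>\<^sub>M borel) \<Otimes>\<^sub>M M)"
    unfolding \<Phi>_def by measurable
  have \<Phi>m [measurable]: "(\<lambda>(z, \<omega>). \<Phi> z \<omega>) \<in> borel_measurable (lborel \<Otimes>\<^sub>M P x)"
  proof -
    have "sets ((lborel :: (real \<times> real) measure) \<Otimes>\<^sub>M P x) = sets ((borel \<Otimes>\<^sub>M borel) \<Otimes>\<^sub>M M)"
      by (intro sets_pair_measure_cong) (simp_all only: borel_prod sets_lborel sets_P)
    from measurable_cong_sets[OF this refl] \<Phi>m' show ?thesis by blast
  qed
  define R where "R = {0..r} \<times> {0..r / \<epsilon>}"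
  have R: "R \<in> sets lborel" "emeasure lborel R < \<infinity>"
  proof -
    have "R \<in> sets (borel \<Otimes>\<^sub>M borel)" unfolding R_def by measurable
    then show "R \<in> sets lborel" by (simp only: borel_prod sets_lborel)
    have "emeasure (lborel \<Otimes>\<^sub>M lborel) R = emeasure lborel {0..r} * emeasure lborel {0..r / \<epsilon>}"
      unfolding R_def by (intro lborel.emeasure_pair_measure_Times) auto
    then show "emeasure lborel R < \<infinity>" using r \<epsilon> by (simp add: lborel_prod ennreal_mult_less_top)
  qed
  have tR: "triangle \<epsilon> r \<subseteq> R"
  proof
    fix z assume z: "z \<in> triangle \<epsilon> r"
    then have *: "0 \<le> fst z" "0 \<le> snd z" "fst z + \<epsilon> * snd z \<le> r" by (auto simp: triangle_def)
    have "0 \<le> \<epsilon> * snd z" using * \<epsilon> by simp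
    then have "fst z \<le> r" "\<epsilon> * snd z \<le> r" using * by linarith+
    then show "z \<in> R" using * \<epsilon> by (cases z) (auto simp: R_def field_simps)
  qed
  define B where "B = (C * r) ^ j * (C * C)"
  have \<Phi>B: "\<bar>\<Phi> z \<omega>\<bar> \<le> B" for z \<omega>
  proof (cases "z \<in> triangle \<epsilon> r")
    case True
    then have *: "0 \<le> fst z" "fst z \<le> r" using tR by (auto simp: R_def)
    have fl: "\<bar>fluctuation k \<epsilon> (fst z) \<omega>\<bar> \<le> C * r"
      by (rule order_trans[OF fluctuation_bound[OF k1 *(1)]]) (use * C_pos in auto)
    have "\<bar>k (fst z) * k (fst z + \<epsilon> * snd z) * (fluctuation k \<epsilon> (fst z) \<omega> ^ j * (fc (Y (fst z / \<epsilon>) \<omega>) * fc (Y (fst z / \<epsilon> + snd z) \<omega>)))\<bar>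
      \<le> 1 * 1 * ((C * r) ^ j * (C * C))"
      unfolding abs_mult power_abs by (intro mult_mono power_mono k1 fl fc_le) (use C_pos r in auto)
    then show ?thesis using True by (simp add: \<Phi>_def B_def)
  next
    case False
    then show ?thesis using C_pos r by (simp add: \<Phi>_def B_def)
  qed
  have \<Phi>0: "z \<notin> R \<Longrightarrow> \<Phi> z \<omega> = 0" for z \<omega>
  proof -
    assume "z \<notin> R"
    then have "z \<notin> triangle \<epsilon> r" using tR by blast
    then show "\<Phi> z \<omega> = 0" by (simp add: \<Phi>_def)
  qed
  then have \<Phi>0': "\<Phi> z \<omega> \<noteq> 0 \<Longrightarrow> z \<in> R" for z \<omega> by blast
  interpret PS: pair_sigma_finite "lborel :: (real \<times> real) measure" "P x" ..
  have int: "integrable (lborel \<Otimes>\<^sub>M P x) (\<lambda>(z, \<omega>). \<Phi> z \<omega>)"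
  proof (rule integrableI_bounded_set[where A="R \<times> space (P x)" and B=B])
    have "emeasure (lborel \<Otimes>\<^sub>M P x) (R \<times> space (P x)) = emeasure lborel R * emeasure (P x) (space (P x))"
      by (intro Px.emeasure_pair_measure_Times) (use R in auto)
    then show "emeasure (lborel \<Otimes>\<^sub>M P x) (R \<times> space (P x)) < \<infinity>"
      using R by (simp add: Px.emeasure_space_1)
  qed (use R \<Phi>B in \<open>auto simp: space_pair_measure intro!: AE_I2 dest: \<Phi>0'\<close>)
  have path: "fluctuation k \<epsilon> r \<omega> ^ (j + 2) = real ((j + 2) * (j + 1)) * \<epsilon> * (\<integral>z. \<Phi> z \<omega> \<partial>lborel)"
    if w: "\<omega> \<in> space (P x)" for \<omega>
  proof -
    have Yw [measurable]: "(\<lambda>u. Y u \<omega>) \<in> borel_measurable borel"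
      using measurable_compose[OF measurable_Pair2'[of \<omega> M borel] Y_measurable] w by (simp add: space_P)
    define a where "a u = indicator {0..r} u *\<^sub>R (k u * fc (Y (u / \<epsilon>) \<omega>))" for u
    have a: "integrable lborel a"
      unfolding a_def
    proof (rule integrableI_bounded_set_indicator[where B=C])
      show "AE u in lborel. u \<in> {0..r} \<longrightarrow> norm (k u * fc (Y (u / \<epsilon>) \<omega>)) \<le> C"
        using mult_mono[OF k1 fc_le] by (auto simp: abs_mult)
    qed (use r in auto)
    have Aq: "(LINT u:{0..q}|lborel. a u) = fluctuation k \<epsilon> q \<omega>" if "q \<in> {0..r}" for q
      unfolding fluctuation_def set_lebesgue_integral_def a_def using that
      by (intro Bochner_Integration.integral_cong) (auto simp: indicator_def)
    have tail: "(LINT u:{q..r}|lborel. a u) = (LINT u:{q..r}|lborel. k u * fc (Y (u / \<epsilon>) \<omega>))" if "q \<in> {0..r}" for q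
      unfolding set_lebesgue_integral_def a_def using that
      by (intro Bochner_Integration.integral_cong) (auto simp: indicator_def)
    have \<Phi>int: "integrable (lborel \<Otimes>\<^sub>M lborel) (\<lambda>z. \<Phi> z \<omega>)"
    proof -
      have "integrable lborel (\<lambda>z. \<Phi> z \<omega>)"
      proof (rule integrableI_bounded_set[where A=R and B=B])
        show "(\<lambda>z. \<Phi> z \<omega>) \<in> borel_measurable lborel"
          using measurable_compose[OF measurable_Pair2'[OF w] \<Phi>m] by simp
      qed (use R \<Phi>B \<Phi>0 in auto)
      then show ?thesis by (simp add: lborel_prod)
    qed
    have "fluctuation k \<epsilon> r \<omega> ^ (j + 2) = real ((j + 2) * (j + 1)) *
      (LINT q:{0..r}|lborel. (LINT u:{0..q}|lborel. a u) ^ j * a q * (LINT u:{q..r}|lborel. a u))"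
      using primitive_power_nested[OF a r, of j] Aq[of r] r by simp
    also have "(LINT q:{0..r}|lborel. (LINT u:{0..q}|lborel. a u) ^ j * a q * (LINT u:{q..r}|lborel. a u))
      = (\<integral>q. \<epsilon> * (\<integral>w. \<Phi> (q, w) \<omega> \<partial>lborel) \<partial>lborel)"
      unfolding set_lebesgue_integral_def[where A="{0..r}"]
    proof (intro Bochner_Integration.integral_cong refl)
      fix q
      show "indicator {0..r} q *\<^sub>R ((LINT u:{0..q}|lborel. a u) ^ j * a q * (LINT u:{q..r}|lborel. a u)) = \<epsilon> * (\<integral>w. \<Phi> (q, w) \<omega> \<partial>lborel)"
      proof (cases "q \<in> {0..r}")
        case True
        have "(\<integral>w. \<Phi> (q, w) \<omega> \<partial>lborel) = (\<integral>w. (k q * (fluctuation k \<epsilon> q \<omega> ^ j * fc (Y (q / \<epsilon>) \<omega>))) *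
           (indicator {w. 0 \<le> w \<and> q + \<epsilon> * w \<le> r} w * (k (q + \<epsilon> * w) * fc (Y (q / \<epsilon> + w) \<omega>))) \<partial>lborel)"
          using True by (intro Bochner_Integration.integral_cong) (auto simp: \<Phi>_def triangle_def indicator_def)
        also have "\<dots> = (k q * (fluctuation k \<epsilon> q \<omega> ^ j * fc (Y (q / \<epsilon>) \<omega>))) *
           (\<integral>w. (indicator {w. 0 \<le> w \<and> q + \<epsilon> * w \<le> r} w * (k (q + \<epsilon> * w) * fc (Y (q / \<epsilon> + w) \<omega>))) \<partial>lborel)"
          by (rule integral_mult_right_zero)
        finally have "\<epsilon> * (\<integral>w. \<Phi> (q, w) \<omega> \<partial>lborel) = k q * (fluctuation k \<epsilon> q \<omega> ^ j * fc (Y (q / \<epsilon>) \<omega>)) * 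
           (LINT u:{q..r}|lborel. k u * fc (Y (u / \<epsilon>) \<omega>))"
          unfolding fluctuation_tail[OF \<epsilon>] by simp
        then show ?thesis
          using True Aq[OF True] tail[OF True] by (simp add: a_def mult_ac)
      next
        case False
        have "0 \<le> q \<Longrightarrow> 0 \<le> w \<Longrightarrow> q + \<epsilon> * w \<le> r \<Longrightarrow> q \<le> r" for w
          using mult_nonneg_nonneg[of \<epsilon> w] \<epsilon> by linarith
        then have "\<Phi> (q, w) \<omega> = 0" for w using False by (auto simp: \<Phi>_def triangle_def indicator_def)
        then show ?thesis using False by simp
      qed
    qed
    also have "\<dots> = \<epsilon> * (\<integral>q. (\<integral>w. \<Phi> (q, w) \<omega> \<partial>lborel) \<partial>lborel)"
      by (rule integral_mult_right_zero)
    also have "(\<integral>q. (\<integral>w. \<Phi> (q, w) \<omega> \<partial>lborel) \<partial>lborel) = (\<integral>z. \<Phi> z \<omega> \<partial>lborel)"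
      using lborel_pair.integral_fst'[OF \<Phi>int] by (simp add: lborel_prod)
    finally show ?thesis by (simp add: mult.assoc)
  qed
  have "(\<integral>\<omega>. fluctuation k \<epsilon> r \<omega> ^ (j + 2) \<partial>P x) = (\<integral>\<omega>. real ((j + 2) * (j + 1)) * \<epsilon> * (\<integral>z. \<Phi> z \<omega> \<partial>lborel) \<partial>P x)"
    by (intro Bochner_Integration.integral_cong refl path)
  also have "\<dots> = real ((j + 2) * (j + 1)) * \<epsilon> * (\<integral>\<omega>. (\<integral>z. \<Phi> z \<omega> \<partial>lborel) \<partial>P x)"
    by (rule integral_mult_right_zero)
  also have "(\<integral>\<omega>. (\<integral>z. \<Phi> z \<omega> \<partial>lborel) \<partial>P x) = (\<integral>z. (\<integral>\<omega>. \<Phi> z \<omega> \<partial>P x) \<partial>lborel)"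
    by (rule PS.Fubini_integral[OF int])
  also have "\<dots> = (\<integral>z. moment_integrand k x \<epsilon> j r z \<partial>lborel)"
  proof (intro Bochner_Integration.integral_cong refl)
    fix z
    show "(\<integral>\<omega>. \<Phi> z \<omega> \<partial>P x) = moment_integrand k x \<epsilon> j r z"
    proof (cases "z \<in> triangle \<epsilon> r")
      case True
      then have *: "0 \<le> fst z" "0 \<le> snd z" by (auto simp: triangle_def)
      show ?thesis using True unfolding \<Phi>_def moment_integrand_def cross_moment_markov[OF k k1 \<epsilon> *, symmetric] by simp
    qed (simp add: \<Phi>_def moment_integrand_def)
  qed
  finally show ?thesis .
qed

text \<open>The bound of \<open>cross_moment_bound\<close> on the strip \<open>{0..t} \<times> {0..}\<close>, which contains all triangles.\<close>

definition moment_majorant :: "'s \<Rightarrow> real \<Rightarrow> nat \<Rightarrow> real \<times> real \<Rightarrow> real"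
  where "moment_majorant x t j z = (indicator {0..t} (fst z) * ((C * t) ^ j * (C * (C * d * v_moment_bound x)))) *
     (indicator {0..} (snd z) * exp (- \<alpha> * snd z))"

lemma v_moment_bound_nonneg: "0 \<le> v_moment_bound x"
proof -
  have "0 \<le> (\<integral>\<omega>. v (Y 0 \<omega>) \<partial>P x)" by (rule Bochner_Integration.integral_nonneg) (rule v0)
  also have "\<dots> \<le> v_moment_bound x" by (rule expectation_v_le)
  finally show ?thesis .
qed

lemma integrable_moment_majorant: "integrable lborel (moment_majorant x t j)"
  unfolding moment_majorant_def
  by (intro integrable_lborel_product integrable_exp_decay \<alpha>_pos integrable_mult_left integrable_real_indicator)
     (auto simp: emeasure_lborel_Icc_eq)

lemma moment_integrand_bound:
  assumes k: "k \<in> borel_measurable borel" and k1: "\<And>u. \<bar>k u\<bar> \<le> 1"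
    and \<epsilon>: "0 < \<epsilon>" and r: "r \<le> t"
  shows "\<bar>moment_integrand k x \<epsilon> j r z\<bar>
    \<le> moment_majorant x t j z"
proof (cases "z \<in> triangle \<epsilon> r")
  case True
  then have *: "0 \<le> fst z" "0 \<le> snd z" "fst z + \<epsilon> * snd z \<le> r" by (auto simp: triangle_def)
  have "0 \<le> \<epsilon> * snd z" using * \<epsilon> by simp
  then have **: "fst z \<le> t" using * r by linarith
  have "\<bar>k (fst z) * k (fst z + \<epsilon> * snd z) * cross_moment k x \<epsilon> j (fst z) (snd z)\<bar>
    \<le> 1 * 1 * ((C * fst z) ^ j * (C * (C * d * v_moment_bound x)) * exp (- \<alpha> * snd z))"
    unfolding abs_mult using cross_moment_bound[OF k k1 *(1,2)]
    by (intro mult_mono k1) auto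
  also have "\<dots> \<le> 1 * 1 * ((C * t) ^ j * (C * (C * d * v_moment_bound x)) * exp (- \<alpha> * snd z))"
    using C_pos d_nonneg v_moment_bound_nonneg[of x] * ** by (intro mult_mono power_mono) auto
  finally show ?thesis using True * ** by (simp add: moment_integrand_def moment_majorant_def mult_ac)
next
  case False
  have "0 \<le> moment_majorant x t j z"
  proof (cases "fst z \<in> {0..t}")
    case True
    then have "0 \<le> t" by simp
    then show ?thesis using C_pos d_nonneg v_moment_bound_nonneg[of x] by (simp add: moment_majorant_def)
  qed (simp add: moment_majorant_def)
  then show ?thesis using False by (simp add: moment_integrand_def)
qed

lemma moment_integrand_measurable [measurable]:
  assumes [measurable]: "k \<in> borel_measurable borel"
  shows "moment_integrand k x \<epsilon> j r
     \<in> borel_measurable lborel"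
proof -
  have "(\<lambda>z. k (fst z) * k (fst z + \<epsilon> * snd z)) \<in> borel_measurable (borel \<Otimes>\<^sub>M borel)" by measurable
  then have [measurable]: "(\<lambda>z. k (fst z) * k (fst z + \<epsilon> * snd z)) \<in> borel_measurable borel"
    by (simp only: borel_prod)
  show ?thesis unfolding moment_integrand_def by measurable
qed

text \<open>Fluctuations are of order \<open>\<epsilon>\<close> in mean square, uniformly up to time \<open>t\<close>; this is what makes the fourth
  moment negligible.\<close>

lemma second_moment_bound:
  assumes k: "k \<in> borel_measurable borel" and k1: "\<And>u. \<bar>k u\<bar> \<le> 1"
  shows "\<exists>D\<ge>0. \<forall>\<epsilon>>0. \<forall>r\<in>{0..t}. (\<integral>\<omega>. (fluctuation k \<epsilon> r \<omega>)\<^sup>2 \<partial>P x) \<le> D * \<epsilon>"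
proof (intro exI conjI allI impI ballI)
  let ?D = "2 * (\<integral>z. \<bar>moment_majorant x t 0 z\<bar> \<partial>lborel)"
  show "0 \<le> ?D" by simp
  fix \<epsilon> r :: real assume \<epsilon>: "0 < \<epsilon>" and r: "r \<in> {0..t}"
  let ?f = "\<lambda>z. moment_integrand k x \<epsilon> 0 r z"
  have "(\<integral>z. ?f z \<partial>lborel) \<le> (\<integral>z. \<bar>?f z\<bar> \<partial>lborel)"
    using integral_abs_bound[of lborel ?f] by linarith
  also have "\<dots> \<le> (\<integral>z. \<bar>moment_majorant x t 0 z\<bar> \<partial>lborel)"
  proof (rule integral_mono'[OF integrable_abs[OF integrable_moment_majorant]])
    show "\<bar>?f z\<bar> \<le> \<bar>moment_majorant x t 0 z\<bar>" for z
      by (rule order_trans[OF moment_integrand_bound[OF k k1 \<epsilon>] abs_ge_self]) (use r in auto)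
  qed auto
  finally have "2 * \<epsilon> * (\<integral>z. ?f z \<partial>lborel) \<le> 2 * \<epsilon> * (\<integral>z. \<bar>moment_majorant x t 0 z\<bar> \<partial>lborel)"
    using \<epsilon> by (intro mult_left_mono) auto
  then show "(\<integral>\<omega>. (fluctuation k \<epsilon> r \<omega>)\<^sup>2 \<partial>P x) \<le> ?D * \<epsilon>"
    using fluctuation_moment[OF k k1 \<epsilon>, where r=r and j=0 and x=x] r by (simp add: mult_ac numeral_2_eq_2[symmetric])
qed

lemma moment_limit:
  assumes k: "k \<in> borel_measurable borel" and k1: "\<And>u. \<bar>k u\<bar> \<le> 1" and t: "0 \<le> t"
    and E: "\<And>i. 0 < E i" "E \<longlonglongrightarrow> 0"
    and L: "(\<lambda>z. L (fst z) (snd z)) \<in> borel_measurable lborel"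
    and lim: "\<And>q w. 0 < q \<Longrightarrow> q < t \<Longrightarrow> 0 \<le> w \<Longrightarrow> (\<lambda>i. k (q + E i * w) * cross_moment k x (E i) j q w) \<longlonglongrightarrow> L q w"
  shows "(\<lambda>i. (\<integral>\<omega>. fluctuation k (E i) t \<omega> ^ (j + 2) \<partial>P x) / E i) \<longlonglongrightarrow>
    real ((j + 2) * (j + 1)) * (\<integral>z. indicator ({0..t} \<times> {0..}) z * (k (fst z) * L (fst z) (snd z)) \<partial>lborel)"
proof -
  have "(\<lambda>i. \<integral>z. moment_integrand k x (E i) j t z \<partial>lborel)
    \<longlonglongrightarrow> (\<integral>z. indicator ({0..t} \<times> {0..}) z * (k (fst z) * L (fst z) (snd z)) \<partial>lborel)"
  proof (rule integral_dominated_convergence)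
    note [measurable] = k
    have "(\<lambda>z. k (fst z)) \<in> borel_measurable (borel \<Otimes>\<^sub>M (borel :: real measure))" by measurable
    then have [measurable]: "(\<lambda>z::real \<times> real. k (fst z)) \<in> borel_measurable borel"
      by (simp only: borel_prod)
    have [measurable]: "({0..t} \<times> {0..} :: (real \<times> real) set) \<in> sets borel"
      by (intro borel_closed closed_Times) auto
    show "(\<lambda>z. indicator ({0..t} \<times> {0..}) z * (k (fst z) * L (fst z) (snd z))) \<in> borel_measurable lborel"
      using L by measurable
    show "(\<lambda>z. moment_integrand k x (E i) j t z) \<in> borel_measurable lborel" for i
      by (rule moment_integrand_measurable[OF k])
    show "integrable lborel (moment_majorant x t j)" by (rule integrable_moment_majorant)
    show "AE z in lborel. norm (moment_integrand k x (E i) j t z) \<le> moment_majorant x t j z" for i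
      using moment_integrand_bound[OF k k1 E(1) order_refl] by simp
    show "AE z in lborel. (\<lambda>i. moment_integrand k x (E i) j t z)
       \<longlonglongrightarrow> indicator ({0..t} \<times> {0..}) z * (k (fst z) * L (fst z) (snd z))"
      using AE_lborel_fst_neq[of 0] AE_lborel_fst_neq[of t]
    proof eventually_elim
      case (elim z)
      show ?case
      proof (cases "z \<in> {0..t} \<times> {0..}")
        case True
        then have z: "0 < fst z" "fst z < t" "0 \<le> snd z" using elim by (auto simp: mem_Times_iff)
        have "(\<lambda>i. fst z + E i * snd z) \<longlonglongrightarrow> fst z + 0 * snd z"
          by (intro tendsto_intros E)
        then have "\<forall>\<^sub>F i in sequentially. fst z + E i * snd z < t"
          using z by (intro order_tendstoD) auto
        then have ev: "\<forall>\<^sub>F i in sequentially. k (fst z) * (k (fst z + E i * snd z) * cross_moment k x (E i) j (fst z) (snd z)) =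
           moment_integrand k x (E i) j t z"
          by eventually_elim (use z in \<open>auto simp: moment_integrand_def triangle_def indicator_def\<close>)
        have "(\<lambda>i. k (fst z) * (k (fst z + E i * snd z) * cross_moment k x (E i) j (fst z) (snd z))) \<longlonglongrightarrow> k (fst z) * L (fst z) (snd z)"
          by (intro tendsto_intros lim z)
        from Lim_transform_eventually[OF this ev] show ?thesis using True by simp
      next
        case False
        have "z \<notin> triangle (E i) t" for i
        proof
          assume "z \<in> triangle (E i) t"
          then have *: "0 \<le> fst z" "0 \<le> snd z" "fst z + E i * snd z \<le> t" by (auto simp: triangle_def)
          moreover have "0 \<le> E i * snd z" using * E(1)[of i] by simp
          ultimately show False using False by (auto simp: mem_Times_iff)
        qed
        then show ?thesis using False by (simp add: moment_integrand_def)
      qed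
    qed
  qed
  then have "(\<lambda>i. real ((j + 2) * (j + 1)) * (\<integral>z. moment_integrand k x (E i) j t z \<partial>lborel))
    \<longlonglongrightarrow> real ((j + 2) * (j + 1)) * (\<integral>z. indicator ({0..t} \<times> {0..}) z * (k (fst z) * L (fst z) (snd z)) \<partial>lborel)"
    by (rule tendsto_mult_left)
  moreover have "real ((j + 2) * (j + 1)) * (\<integral>z. moment_integrand k x (E i) j t z \<partial>lborel)
     = (\<integral>\<omega>. fluctuation k (E i) t \<omega> ^ (j + 2) \<partial>P x) / E i" for i
    unfolding fluctuation_moment[OF k k1 E(1) t] using E(1)[of i] by simp
  ultimately show ?thesis by simp
qed

text \<open>In the formula with \<open>j = 2\<close> the cross moment carries the squared fluctuation, whose mean is of order
  \<open>\<epsilon>\<close>, while the remaining factors are bounded.\<close>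

lemma fourth_moment_limit:
  assumes k: "k \<in> borel_measurable borel" and k1: "\<And>u. \<bar>k u\<bar> \<le> 1" and t: "0 \<le> t"
  shows "((\<lambda>\<epsilon>. (\<integral>\<omega>. fluctuation k \<epsilon> t \<omega> ^ 4 \<partial>P x) / \<epsilon>) \<longlongrightarrow> 0) (at_right 0)"
proof (rule tendsto_at_right_zeroI)
  fix E :: "nat \<Rightarrow> real" assume E: "\<And>i. 0 < E i" "E \<longlonglongrightarrow> 0"
  interpret Px: prob_space "P x" by (rule prob_space_P)
  note [measurable] = k
  obtain D where D: "0 \<le> D" "\<And>\<epsilon> r. 0 < \<epsilon> \<Longrightarrow> r \<in> {0..t} \<Longrightarrow> (\<integral>\<omega>. (fluctuation k \<epsilon> r \<omega>)\<^sup>2 \<partial>P x) \<le> D * \<epsilon>"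
    using second_moment_bound[OF k k1, of t x] by blast
  have "(\<lambda>i. (\<integral>\<omega>. fluctuation k (E i) t \<omega> ^ (2 + 2) \<partial>P x) / E i) \<longlonglongrightarrow>
     real ((2 + 2) * (2 + 1)) * (\<integral>z. indicator ({0..t} \<times> {0..}) z * (k (fst z) * 0) \<partial>(lborel :: (real \<times> real) measure))"
  proof (rule moment_limit[where L="\<lambda>_ _. 0" and j=2, OF k k1 t E])
    fix q w :: real assume q: "0 < q" "q < t" and w: "0 \<le> w"
    have bound: "\<bar>cross_moment k x (E i) 2 q w\<bar> \<le> (C * C) * (D * E i)" for i
    proof -
      have i2: "integrable (P x) (\<lambda>\<omega>. (fluctuation k (E i) q \<omega>)\<^sup>2)"
        using fluctuation_bound[where k=k and q=q and \<epsilon>="E i", OF k1] q C_pos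
        by (intro Px.integrable_const_bound[where B="(C * q)\<^sup>2"]) (auto simp: power2_le_iff_abs_le)
      have "\<bar>cross_moment k x (E i) 2 q w\<bar> \<le> (\<integral>\<omega>. \<bar>(fluctuation k (E i) q \<omega>)\<^sup>2 * (fc (Y (q / E i) \<omega>) * semigroup w (Y (q / E i) \<omega>))\<bar> \<partial>P x)"
        unfolding cross_moment_def by (rule integral_abs_bound)
      also have "\<dots> \<le> (\<integral>\<omega>. (C * C) * (fluctuation k (E i) q \<omega>)\<^sup>2 \<partial>P x)"
      proof (rule integral_mono'[OF integrable_mult_right[OF i2]])
        fix \<omega>
        have "\<bar>(fluctuation k (E i) q \<omega>)\<^sup>2 * (fc (Y (q / E i) \<omega>) * semigroup w (Y (q / E i) \<omega>))\<bar>
          \<le> (fluctuation k (E i) q \<omega>)\<^sup>2 * (C * C)"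
          unfolding abs_mult by (intro mult_mono fc_le semigroup_le_C) (use C_pos in auto)
        then show "\<bar>(fluctuation k (E i) q \<omega>)\<^sup>2 * (fc (Y (q / E i) \<omega>) * semigroup w (Y (q / E i) \<omega>))\<bar> \<le> (C * C) * (fluctuation k (E i) q \<omega>)\<^sup>2"
          by (simp add: mult_ac)
      qed (use C_pos in auto)
      also have "\<dots> = (C * C) * (\<integral>\<omega>. (fluctuation k (E i) q \<omega>)\<^sup>2 \<partial>P x)" by (rule integral_mult_right_zero)
      also have "\<dots> \<le> (C * C) * (D * E i)"
        using D(2)[OF E(1)[of i], of q] q C_pos by (intro mult_left_mono) auto
      finally show ?thesis .
    qed
    show "(\<lambda>i. k (q + E i * w) * cross_moment k x (E i) 2 q w) \<longlonglongrightarrow> 0"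
    proof (rule Lim_null_comparison)
      have "norm (k (q + E i * w) * cross_moment k x (E i) 2 q w) \<le> (C * C) * (D * E i)" for i
        using mult_mono[OF k1[of "q + E i * w"] bound[of i]] by (simp add: abs_mult)
      then show "\<forall>\<^sub>F i in sequentially. norm (k (q + E i * w) * cross_moment k x (E i) 2 q w) \<le> (C * C) * (D * E i)"
        by simp
      have "(\<lambda>i. (C * C) * (D * E i)) \<longlonglongrightarrow> (C * C) * (D * 0)" by (intro tendsto_intros E)
      then show "(\<lambda>i. (C * C) * (D * E i)) \<longlonglongrightarrow> 0" by simp
    qed
  qed simp
  then show "(\<lambda>i. (\<integral>\<omega>. fluctuation k (E i) t \<omega> ^ 4 \<partial>P x) / E i) \<longlonglongrightarrow> 0" by simp
qed

definition stationary_covariance :: "real \<Rightarrow> real"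
  where "stationary_covariance w = (\<integral>y. fc y * semigroup w y \<partial>\<pi>)"

lemma semigroup_section_measurable [measurable]: "semigroup w \<in> borel_measurable borel"
  using measurable_compose[OF measurable_Pair1'[of w borel borel] semigroup_meas] by simp

lemma stationary_covariance_measurable [measurable]: "stationary_covariance \<in> borel_measurable borel"
proof -
  interpret \<pi>: prob_space \<pi> by (rule \<pi>)
  show ?thesis unfolding stationary_covariance_def by measurable
qed

lemma integrable_covariance:
  "integrable (lborel \<Otimes>\<^sub>M \<pi>) (\<lambda>(w, y). indicator {0..} w * (fc y * semigroup w y))"
proof -
  interpret \<pi>: prob_space \<pi> by (rule \<pi>)
  interpret PS: pair_sigma_finite lborel \<pi> ..
  have i: "integrable (lborel \<Otimes>\<^sub>M \<pi>) (\<lambda>(w, y). (indicator {0..} w * exp (- \<alpha> * w)) * (C * (C * d * v y)))"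
    by (intro PS.Fubini_integrable)
       (auto simp: abs_mult mult.assoc[symmetric] intro!: integrable_mult_left integrable_mult_right v_integrable_\<pi> integrable_abs
          integrable_exp_decay[OF \<alpha>_pos, simplified])
  have "norm (case z of (w, y) \<Rightarrow> indicator {0..} w * (fc y * semigroup w y))
      \<le> norm (case z of (w, y) \<Rightarrow> (indicator {0..} w * exp (- \<alpha> * w)) * (C * (C * d * v y)))" for z
  proof -
    obtain w y where z: "z = (w, y)" by (cases z)
    show ?thesis
    proof (cases "0 \<le> w")
      case True
      have "\<bar>fc y\<bar> * \<bar>semigroup w y\<bar> \<le> C * (C * d * v y * exp (- \<alpha> * w))"
        by (intro mult_mono fc_le semigroup_bound True) (use C_pos in auto)
      then show ?thesis using True C_pos d_nonneg v0[of y] by (simp add: z abs_mult mult_ac)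
    qed (simp add: z)
  qed
  then show ?thesis
    by (intro Bochner_Integration.integrable_bound[OF i] AE_I2) measurable
qed

lemma potential_eq: "potential P X \<pi> f y = (\<integral>w. indicator {0..} w * semigroup w y \<partial>lborel)"
  unfolding potential_def set_lebesgue_integral_def semigroup_def
  by (intro Bochner_Integration.integral_cong) (auto simp: indicator_def Y_def)

lemma integrable_stationary_covariance: "integrable lborel (\<lambda>w. indicator {0..} w * stationary_covariance w)"
proof -
  interpret \<pi>: prob_space \<pi> by (rule \<pi>)
  interpret PS: pair_sigma_finite lborel \<pi> ..
  show ?thesis using PS.integrable_fst'[OF integrable_covariance] by (simp add: stationary_covariance_def)
qed

text \<open>Exchanging the stationary mean with the time integral that defines the potential shows that \<open>\<sigma>\<^sup>2\<close> is
  twice the integrated stationary covariance.\<close>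

lemma sigma_sq_eq: "sigma_sq P X \<pi> f = 2 * (\<integral>w. indicator {0..} w * stationary_covariance w \<partial>lborel)"
proof -
  interpret \<pi>: prob_space \<pi> by (rule \<pi>)
  interpret PS: pair_sigma_finite lborel \<pi> ..
  have "(\<integral>y. fc y * potential P X \<pi> f y \<partial>\<pi>) = (\<integral>y. (\<integral>w. indicator {0..} w * (fc y * semigroup w y) \<partial>lborel) \<partial>\<pi>)"
    by (intro Bochner_Integration.integral_cong refl)
       (simp add: potential_eq mult.left_commute flip: integral_mult_right_zero)
  also have "\<dots> = (\<integral>w. (\<integral>y. indicator {0..} w * (fc y * semigroup w y) \<partial>\<pi>) \<partial>lborel)"
    by (rule PS.Fubini_integral[OF integrable_covariance])
  finally show ?thesis by (simp add: sigma_sq_def stationary_covariance_def)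
qed

text \<open>At every time \<open>q > 0\<close> the process has been running for the time \<open>q / \<epsilon>\<close>, hence is close to
  stationary, and the delay \<open>\<epsilon> w\<close> vanishes: the double integral factorises in the limit.\<close>

lemma second_moment_limit:
  assumes k: "\<And>u. isCont k u" and k1: "\<And>u. \<bar>k u\<bar> \<le> 1" and t: "0 \<le> t"
  shows "((\<lambda>\<epsilon>. (\<integral>\<omega>. (fluctuation k \<epsilon> t \<omega>)\<^sup>2 \<partial>P x) / \<epsilon>) \<longlongrightarrow> sigma_sq P X \<pi> f * (LINT u:{0..t}|lborel. (k u)\<^sup>2)) (at_right 0)"
proof (rule tendsto_at_right_zeroI)
  fix E :: "nat \<Rightarrow> real" assume E: "\<And>i. 0 < E i" "E \<longlonglongrightarrow> 0"
  have km: "k \<in> borel_measurable borel"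
    by (intro borel_measurable_continuous_onI continuous_at_imp_continuous_on) (auto simp: k)
  note [measurable] = km
  have "(\<lambda>i. (\<integral>\<omega>. fluctuation k (E i) t \<omega> ^ (0 + 2) \<partial>P x) / E i) \<longlonglongrightarrow>
     real ((0 + 2) * (0 + 1)) * (\<integral>z. indicator ({0..t} \<times> {0..}) z * (k (fst z) * (k (fst z) * stationary_covariance (snd z))) \<partial>lborel)"
  proof (rule moment_limit[where L="\<lambda>q w. k q * stationary_covariance w" and j=0, OF km k1 t E])
    have "(\<lambda>z. k (fst z) * stationary_covariance (snd z)) \<in> borel_measurable (borel \<Otimes>\<^sub>M borel)" by measurable
    then show "(\<lambda>z. k (fst z) * stationary_covariance (snd z)) \<in> borel_measurable lborel"
      by (simp only: borel_prod measurable_lborel1 measurable_lborel2)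
    fix q w :: real assume q: "0 < q" "q < t" and w: "0 \<le> w"
    have "(\<lambda>i. cross_moment k x (E i) 0 q w) \<longlonglongrightarrow> stationary_covariance w"
    proof (rule LIM_zero_cancel, rule Lim_null_comparison)
      have "\<bar>cross_moment k x (E i) 0 q w - stationary_covariance w\<bar> \<le> C * C * d * v x * exp (- \<alpha> * (q / E i))" for i
      proof -
        have "\<bar>fc y * semigroup w y\<bar> \<le> C * C" for y
          unfolding abs_mult by (intro mult_mono fc_le semigroup_le_C) (use C_pos in auto)
        from convergence_bounded[where u="q / E i" and x=x and h="\<lambda>y. fc y * semigroup w y", OF _ _ this]
        show ?thesis using C_pos q E(1)[of i] by (simp add: cross_moment_def stationary_covariance_def)
      qed
      then show "\<forall>\<^sub>F i in sequentially. norm (cross_moment k x (E i) 0 q w - stationary_covariance w) \<le> C * C * d * v x * exp (- \<alpha> * (q / E i))"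
        by simp
      have "filterlim E (at_right 0) sequentially"
        using E less_imp_neq[OF E(1)] by (auto simp: filterlim_at)
      then have inv: "filterlim (\<lambda>i. inverse (E i)) at_top sequentially"
        by (rule filterlim_compose[OF filterlim_inverse_at_top_right])
      have "filterlim (\<lambda>i. (\<alpha> * q) * inverse (E i)) at_top sequentially"
        by (rule filterlim_tendsto_pos_mult_at_top[OF tendsto_const _ inv]) (use \<alpha>_pos q in simp)
      then have "filterlim (\<lambda>i. - ((\<alpha> * q) * inverse (E i))) at_bot sequentially"
        by (simp add: filterlim_uminus_at_top)
      then have "(\<lambda>i. exp (- ((\<alpha> * q) * inverse (E i)))) \<longlonglongrightarrow> 0"
        by (rule filterlim_compose[OF exp_at_bot])
      then have "(\<lambda>i. C * C * d * v x * exp (- ((\<alpha> * q) * inverse (E i)))) \<longlonglongrightarrow> C * C * d * v x * 0"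
        by (rule tendsto_mult_left)
      then show "(\<lambda>i. C * C * d * v x * exp (- \<alpha> * (q / E i))) \<longlonglongrightarrow> 0"
        by (simp add: divide_inverse mult.assoc)
    qed
    moreover have "(\<lambda>i. k (q + E i * w)) \<longlonglongrightarrow> k q"
    proof (rule isCont_tendsto_compose[OF k])
      have "(\<lambda>i. q + E i * w) \<longlonglongrightarrow> q + 0 * w" by (intro tendsto_intros E)
      then show "(\<lambda>i. q + E i * w) \<longlonglongrightarrow> q" by simp
    qed
    ultimately show "(\<lambda>i. k (q + E i * w) * cross_moment k x (E i) 0 q w) \<longlonglongrightarrow> k q * stationary_covariance w"
      by (intro tendsto_mult)
  qed
  moreover have "(\<integral>z. indicator ({0..t} \<times> {0..}) z * (k (fst z) * (k (fst z) * stationary_covariance (snd z))) \<partial>lborel)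
    = (\<integral>z. (indicator {0..t} (fst z) * (k (fst z))\<^sup>2) * (indicator {0..} (snd z) * stationary_covariance (snd z)) \<partial>lborel)"
    by (intro Bochner_Integration.integral_cong) (auto simp: indicator_def power2_eq_square mem_Times_iff)
  moreover have "\<dots> = (\<integral>u. indicator {0..t} u * (k u)\<^sup>2 \<partial>lborel) * (\<integral>w. indicator {0..} w * stationary_covariance w \<partial>lborel)"
  proof (rule integral_lborel_product[OF _ integrable_stationary_covariance])
    have "set_integrable lborel {0..t} (\<lambda>u. (k u)\<^sup>2)"
      by (rule set_integrable_bounded[where C=1]) (use k1 t in \<open>auto simp: abs_square_le_1\<close>)
    then show "integrable lborel (\<lambda>u. indicator {0..t} u * (k u)\<^sup>2)" by (simp add: set_integrable_def)
  qed
  ultimately show "(\<lambda>i. (\<integral>\<omega>. (fluctuation k (E i) t \<omega>)\<^sup>2 \<partial>P x) / E i) \<longlonglongrightarrow> sigma_sq P X \<pi> f * (LINT u:{0..t}|lborel. (k u)\<^sup>2)"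
    by (simp add: sigma_sq_eq set_lebesgue_integral_def mult_ac numeral_2_eq_2[symmetric])
qed

lemma first_moment:
  assumes k [measurable]: "k \<in> borel_measurable borel" and k1: "\<And>u. \<bar>k u\<bar> \<le> 1"
    and \<epsilon>: "0 < \<epsilon>" and t: "0 \<le> t"
  shows "(\<integral>\<omega>. fluctuation k \<epsilon> t \<omega> \<partial>P x) = \<epsilon> * (\<integral>w. indicator {0..t / \<epsilon>} w * (k (\<epsilon> * w) * semigroup w x) \<partial>lborel)"
proof -
  interpret Px: prob_space "P x" by (rule prob_space_P)
  interpret PS: pair_sigma_finite "lborel :: real measure" "P x" ..
  have int: "integrable (lborel \<Otimes>\<^sub>M P x) (\<lambda>(w, \<omega>). indicator {0..t / \<epsilon>} w * (k (\<epsilon> * w) * fc (Y w \<omega>)))"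
  proof (rule integrableI_bounded_set[where A="{0..t / \<epsilon>} \<times> space (P x)" and B=C])
    have "emeasure (lborel \<Otimes>\<^sub>M P x) ({0..t / \<epsilon>} \<times> space (P x)) = emeasure lborel {0..t / \<epsilon>} * emeasure (P x) (space (P x))"
      by (intro Px.emeasure_pair_measure_Times) auto
    then show "emeasure (lborel \<Otimes>\<^sub>M P x) ({0..t / \<epsilon>} \<times> space (P x)) < \<infinity>"
      using t \<epsilon> by (simp add: Px.emeasure_space_1)
    show "AE z\<in>{0..t / \<epsilon>} \<times> space (P x) in lborel \<Otimes>\<^sub>M P x. norm (case z of (w, \<omega>) \<Rightarrow> indicator {0..t / \<epsilon>} w * (k (\<epsilon> * w) * fc (Y w \<omega>))) \<le> C"
      using mult_mono[OF k1 fc_le] by (auto simp: abs_mult)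
  qed (auto simp: space_pair_measure indicator_def intro!: AE_I2 split: if_splits)
  have "(\<integral>\<omega>. fluctuation k \<epsilon> t \<omega> \<partial>P x) = (\<integral>\<omega>. \<epsilon> * (\<integral>w. indicator {0..t / \<epsilon>} w * (k (\<epsilon> * w) * fc (Y w \<omega>)) \<partial>lborel) \<partial>P x)"
  proof (intro Bochner_Integration.integral_cong refl)
    fix \<omega>
    have "{w. 0 \<le> w \<and> 0 + \<epsilon> * w \<le> t} = {0..t / \<epsilon>}" using \<epsilon> by (auto simp: field_simps)
    then show "fluctuation k \<epsilon> t \<omega> = \<epsilon> * (\<integral>w. indicator {0..t / \<epsilon>} w * (k (\<epsilon> * w) * fc (Y w \<omega>)) \<partial>lborel)"
      using fluctuation_tail[OF \<epsilon>, where k=k and \<omega>=\<omega> and q=0 and r=t] by (simp add: fluctuation_def)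
  qed
  also have "\<dots> = \<epsilon> * (\<integral>\<omega>. (\<integral>w. indicator {0..t / \<epsilon>} w * (k (\<epsilon> * w) * fc (Y w \<omega>)) \<partial>lborel) \<partial>P x)"
    by (rule integral_mult_right_zero)
  also have "(\<integral>\<omega>. (\<integral>w. indicator {0..t / \<epsilon>} w * (k (\<epsilon> * w) * fc (Y w \<omega>)) \<partial>lborel) \<partial>P x)
    = (\<integral>w. (\<integral>\<omega>. indicator {0..t / \<epsilon>} w * (k (\<epsilon> * w) * fc (Y w \<omega>)) \<partial>P x) \<partial>lborel)"
    by (rule PS.Fubini_integral[OF int])
  finally show ?thesis by (simp add: semigroup_def)
qed

text \<open>The starting point enters the limit through the potential; the weight is evaluated
  at arrival time \<open>0\<close> because the process relaxes within a time of order \<open>\<epsilon>\<close>.\<close>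

lemma first_moment_limit:
  assumes k: "\<And>u. isCont k u" and k1: "\<And>u. \<bar>k u\<bar> \<le> 1" and t: "0 < t"
  shows "((\<lambda>\<epsilon>. (\<integral>\<omega>. fluctuation k \<epsilon> t \<omega> \<partial>P x) / \<epsilon>) \<longlongrightarrow> potential P X \<pi> f x * k 0) (at_right 0)"
proof (rule tendsto_at_right_zeroI)
  fix E :: "nat \<Rightarrow> real" assume E: "\<And>i. 0 < E i" "E \<longlonglongrightarrow> 0"
  have km: "k \<in> borel_measurable borel"
    by (intro borel_measurable_continuous_onI continuous_at_imp_continuous_on) (auto simp: k)
  note [measurable] = km
  have [measurable]: "(\<lambda>w. semigroup w x) \<in> borel_measurable borel"
    using measurable_compose[OF measurable_Pair2'[of x borel borel] semigroup_meas] by simp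
  have "(\<lambda>i. \<integral>w. indicator {0..t / E i} w * (k (E i * w) * semigroup w x) \<partial>lborel) \<longlonglongrightarrow> (\<integral>w. indicator {0..} w * (k 0 * semigroup w x) \<partial>lborel)"
  proof (rule integral_dominated_convergence[where w="\<lambda>w. (C * d * v x) * (indicator {0..} w * exp (- \<alpha> * w))"])
    show "integrable lborel (\<lambda>w. (C * d * v x) * (indicator {0..} w * exp (- \<alpha> * w)))"
      by (intro integrable_mult_right integrable_exp_decay \<alpha>_pos)
    show "AE w in lborel. norm (indicator {0..t / E i} w * (k (E i * w) * semigroup w x)) \<le> (C * d * v x) * (indicator {0..} w * exp (- \<alpha> * w))" for i
    proof (rule AE_I2)
      fix w :: real
      show "norm (indicator {0..t / E i} w * (k (E i * w) * semigroup w x)) \<le> (C * d * v x) * (indicator {0..} w * exp (- \<alpha> * w))"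
      proof (cases "w \<in> {0..t / E i}")
        case True
        then have "\<bar>k (E i * w)\<bar> * \<bar>semigroup w x\<bar> \<le> 1 * (C * d * v x * exp (- \<alpha> * w))"
          by (intro mult_mono k1 semigroup_bound) auto
        then show ?thesis using True by (simp add: abs_mult)
      next
        case False
        then show ?thesis using C_pos d_nonneg v0[of x] by simp
      qed
    qed
    show "AE w in lborel. (\<lambda>i. indicator {0..t / E i} w * (k (E i * w) * semigroup w x)) \<longlonglongrightarrow> indicator {0..} w * (k 0 * semigroup w x)"
    proof (rule AE_I2)
      fix w :: real
      have Ew: "(\<lambda>i. E i * w) \<longlonglongrightarrow> 0" using tendsto_mult_right[OF E(2), of w] by simp
      have "(\<lambda>i. indicator {0..} w * (k (E i * w) * semigroup w x)) \<longlonglongrightarrow> indicator {0..} w * (k 0 * semigroup w x)"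
        by (intro tendsto_intros isCont_tendsto_compose[OF k Ew])
      moreover have "\<forall>\<^sub>F i in sequentially. E i * w < t"
        using Ew t by (intro order_tendstoD) auto
      then have "\<forall>\<^sub>F i in sequentially. indicator {0..} w * (k (E i * w) * semigroup w x) = indicator {0..t / E i} w * (k (E i * w) * semigroup w x)"
        by eventually_elim (use E(1) in \<open>auto simp: indicator_def field_simps\<close>)
      ultimately show "(\<lambda>i. indicator {0..t / E i} w * (k (E i * w) * semigroup w x)) \<longlonglongrightarrow> indicator {0..} w * (k 0 * semigroup w x)"
        by (rule Lim_transform_eventually)
    qed
  qed measurable
  moreover have "(\<integral>w. indicator {0..} w * (k 0 * semigroup w x) \<partial>lborel) = potential P X \<pi> f x * k 0"
    unfolding potential_eq by (simp add: mult_ac flip: integral_mult_right_zero)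
  moreover have "(\<integral>w. indicator {0..t / E i} w * (k (E i * w) * semigroup w x) \<partial>lborel) = (\<integral>\<omega>. fluctuation k (E i) t \<omega> \<partial>P x) / E i" for i
    unfolding first_moment[OF km k1 E(1) less_imp_le[OF t]] using E(1)[of i] by simp
  ultimately show "(\<lambda>i. (\<integral>\<omega>. fluctuation k (E i) t \<omega> \<partial>P x) / E i) \<longlonglongrightarrow> potential P X \<pi> f x * k 0" by simp
qed

end

section \<open>Poisson masses\<close>

lemma poisson_mass_nonneg: "0 \<le> r \<Longrightarrow> 0 \<le> poisson_mass r k"
  by (simp add: poisson_mass_def)

text \<open>The probability generating function of the Poisson law.\<close>

lemma poisson_mass_sums: "(\<lambda>k. poisson_mass r k * z ^ k) sums exp (- r * (1 - z))"
proof -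
  have "(\<lambda>k. exp (- r) * ((r * z) ^ k /\<^sub>R fact k)) sums (exp (- r) * exp (r * z))"
    by (intro sums_mult exp_converges)
  then show ?thesis
    by (simp add: poisson_mass_def power_mult_distrib field_simps scaleR_conv_of_real exp_add[symmetric])
qed

lemma poisson_mass_le_1:
  assumes r: "0 \<le> r"
  shows "poisson_mass r k \<le> 1"
proof -
  have s: "(\<lambda>k. poisson_mass r k) sums 1"
    using poisson_mass_sums[of r 1] by simp
  have "(\<Sum>k\<in>{k}. poisson_mass r k) \<le> (\<Sum>k. poisson_mass r k)"
    by (intro sum_le_suminf sums_summable[OF s]) (auto simp: poisson_mass_nonneg r)
  then show ?thesis using sums_unique[OF s] by simp
qed

text \<open>Uniqueness of probability generating functions.  The identity is only available for arguments in
  the open unit interval, so the coefficients are recovered one after the other as right-hand limits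
  at \<open>0\<close>.\<close>

lemma powser_unique:
  fixes c :: "nat \<Rightarrow> real"
  assumes bound: "\<And>n. \<bar>c n\<bar> \<le> B"
    and zero: "\<And>z. 0 < z \<Longrightarrow> z < 1 \<Longrightarrow> (\<lambda>n. c n * z ^ n) sums 0"
  shows "c n = 0"
proof (induction n rule: less_induct)
  case (less n)
  \<comment> \<open>The power series divided by \<open>z ^ n\<close>, all coefficients below \<open>n\<close> being zero.\<close>
  define h where "h z = (\<Sum>j. c (n + j) * z ^ j)" for z :: real
  have sm: "summable (\<lambda>j. c (n + j) * z ^ j)" if "norm z < 1" for z
  proof (rule summable_comparison_test')
    show "summable (\<lambda>j. B * norm z ^ j)" using that by (intro summable_mult summable_geometric) simp
    show "norm (c (n + j) * z ^ j) \<le> B * norm z ^ j" for j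
      unfolding real_norm_def abs_mult power_abs by (intro mult_right_mono bound) auto
  qed
  have "(h \<longlongrightarrow> c (n + 0)) (at 0)"
    by (rule powser_limit_0[where s=1]) (use summable_sums[OF sm] in \<open>auto simp: h_def\<close>)
  then have lim: "(h \<longlongrightarrow> c n) (at_right 0)" by (simp add: filterlim_at_split)
  have "h z = 0" if z: "0 < z" "z < 1" for z
  proof -
    have "(\<lambda>j. c (n + j) * z ^ (n + j)) sums (0 - (\<Sum>j<n. c j * z ^ j))"
      using sums_split_initial_segment[OF zero[OF z], of n] by (simp add: add.commute)
    moreover have "(\<Sum>j<n. c j * z ^ j) = 0" using less by simp
    ultimately have "(\<lambda>j. z ^ n * (c (n + j) * z ^ j)) sums (z ^ n * 0)" by (simp add: power_add mult_ac)
    then have "(\<lambda>j. c (n + j) * z ^ j) sums 0" using z by (subst (asm) sums_mult_iff) auto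
    then show ?thesis by (simp add: h_def sums_iff)
  qed
  then have "\<forall>\<^sub>F z in at_right 0. h z = 0"
    by (auto simp: eventually_at_right_field intro!: exI[of _ 1])
  then have "(h \<longlongrightarrow> 0) (at_right 0)" by (rule tendsto_eventually)
  then show ?case using tendsto_unique[OF _ lim] by simp
qed

lemma (in prob_space) expectation_powser:
  fixes g :: "nat \<Rightarrow> 'a \<Rightarrow> real"
  assumes [measurable]: "\<And>k. g k \<in> borel_measurable M" and g1: "\<And>k \<omega>. \<bar>g k \<omega>\<bar> \<le> 1" and z: "0 < z" "z < 1"
  shows "(\<lambda>k. (\<integral>\<omega>. g k \<omega> \<partial>M) * z ^ k) sums (\<integral>\<omega>. (\<Sum>k. g k \<omega> * z ^ k) \<partial>M)"
proof -
  have geo: "summable (\<lambda>k. z ^ k)" using z by (intro summable_geometric) simp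
  have b: "norm (g k \<omega> * z ^ k) \<le> z ^ k" for k \<omega>
    using mult_right_mono[OF g1[of k \<omega>], of "z ^ k"] z by (simp add: abs_mult)
  have i: "integrable M (\<lambda>\<omega>. g k \<omega> * z ^ k)" for k
    by (rule integrable_const_bound[where B="z ^ k"]) (use b in auto)
  have "(\<lambda>k. \<integral>\<omega>. g k \<omega> * z ^ k \<partial>M) sums (\<integral>\<omega>. (\<Sum>k. g k \<omega> * z ^ k) \<partial>M)"
  proof (rule sums_integral[OF i])
    show "AE \<omega> in M. summable (\<lambda>k. norm (g k \<omega> * z ^ k))"
      by (intro AE_I2 summable_comparison_test'[OF geo]) (use b in auto)
    show "summable (\<lambda>k. \<integral>\<omega>. norm (g k \<omega> * z ^ k) \<partial>M)"
    proof (rule summable_comparison_test'[OF geo])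
      fix k
      have "(\<integral>\<omega>. norm (g k \<omega> * z ^ k) \<partial>M) \<le> (\<integral>\<omega>. z ^ k \<partial>M)"
        by (intro integral_mono integrable_norm i) (use b in auto)
      then show "norm (\<integral>\<omega>. norm (g k \<omega> * z ^ k) \<partial>M) \<le> z ^ k" by (simp add: prob_space)
    qed
  qed
  then show ?thesis by simp
qed

lemma exp_neg_diff_le:
  fixes a b :: real
  assumes "0 \<le> a" "a \<le> b"
  shows "exp (- a) - exp (- b) \<le> b - a"
proof -
  have "exp (- a) - exp (- b) = exp (- a) * (1 - exp (- (b - a)))"
    by (simp add: right_diff_distrib exp_add[symmetric])
  also have "\<dots> \<le> 1 * (1 - exp (- (b - a)))"
    using assms by (intro mult_right_mono) auto
  also have "\<dots> \<le> b - a" unfolding mult_1 using exp_ge_add_one_self[of "- (b - a)"] by linarith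
  finally show ?thesis .
qed

text \<open>The \<open>n\<close>-th derivative of the Poisson mass in the mean.  Differentiation acts as a difference operator
  in \<open>k\<close>, so every derivative is bounded by a power of \<open>2\<close>.\<close>

fun poisson_mass_deriv :: "nat \<Rightarrow> nat \<Rightarrow> real \<Rightarrow> real" where
  "poisson_mass_deriv 0 k m = poisson_mass m k"
| "poisson_mass_deriv (Suc n) k m = (if k = 0 then 0 else poisson_mass_deriv n (k - 1) m) - poisson_mass_deriv n k m"

lemma DERIV_poisson_mass_deriv: "DERIV (poisson_mass_deriv n k) m :> poisson_mass_deriv (Suc n) k m"
proof (induction n arbitrary: k)
  case 0
  have "DERIV (\<lambda>m. m ^ k / fact k * exp (- m)) m :> (real k * m ^ (k - 1) / fact k) * exp (- m) - m ^ k / fact k * exp (- m)"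
    by (auto intro!: derivative_eq_intros simp: field_simps)
  moreover have "(real k * m ^ (k - 1) / fact k) * exp (- m) - m ^ k / fact k * exp (- m) = poisson_mass_deriv (Suc 0) k m"
    by (cases k) (simp_all add: poisson_mass_def del: of_nat_Suc)
  moreover have "(\<lambda>m. m ^ k / fact k * exp (- m)) = poisson_mass_deriv 0 k"
    by (auto simp: poisson_mass_def)
  ultimately show ?case by (simp only:)
next
  case (Suc n)
  have "DERIV (\<lambda>m. (if k = 0 then 0 else poisson_mass_deriv n (k - 1) m) - poisson_mass_deriv n k m) m
    :> (if k = 0 then 0 else poisson_mass_deriv (Suc n) (k - 1) m) - poisson_mass_deriv (Suc n) k m"
    using Suc.IH by (cases "k = 0") (auto intro!: DERIV_diff DERIV_minus simp del: poisson_mass_deriv.simps)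
  moreover have "poisson_mass_deriv (Suc n) k = (\<lambda>m. (if k = 0 then 0 else poisson_mass_deriv n (k - 1) m) - poisson_mass_deriv n k m)"
    by auto
  ultimately show ?case by (simp only: poisson_mass_deriv.simps(2)[of "Suc n"])
qed

lemma poisson_mass_deriv_bound: "0 \<le> m \<Longrightarrow> \<bar>poisson_mass_deriv n k m\<bar> \<le> 2 ^ n"
proof (induction n arbitrary: k)
  case 0
  then show ?case using poisson_mass_nonneg[of m k] poisson_mass_le_1[of m k] by simp
next
  case (Suc n)
  have "\<bar>poisson_mass_deriv n (k - 1) m\<bar> \<le> 2 ^ n" "\<bar>poisson_mass_deriv n k m\<bar> \<le> 2 ^ n"
    using Suc by blast+
  then have "\<bar>(if k = 0 then 0 else poisson_mass_deriv n (k - 1) m)\<bar> \<le> 2 ^ n" "\<bar>poisson_mass_deriv n k m\<bar> \<le> 2 ^ n"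
    by simp_all
  then have "\<bar>(if k = 0 then 0 else poisson_mass_deriv n (k - 1) m) - poisson_mass_deriv n k m\<bar> \<le> 2 ^ n + 2 ^ n"
    by (rule order_trans[OF abs_triangle_ineq4 add_mono])
  then show ?case by (simp only: poisson_mass_deriv.simps(2) power_Suc mult_2)
qed

lemma poisson_mass_Suc: "0 < m \<Longrightarrow> poisson_mass m k = poisson_mass m (Suc k) * (real (Suc k) / m)"
  by (simp add: poisson_mass_def)

lemma poisson_mass_first_deriv:
  assumes m: "0 < m"
  shows "poisson_mass_deriv 1 k m = poisson_mass m k * (real k / m - 1)"
proof (cases k)
  case (Suc j)
  then show ?thesis using poisson_mass_Suc[OF m, of j] by (simp add: right_diff_distrib del: of_nat_Suc)
qed simp

lemma poisson_mass_second_deriv: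
  assumes m: "0 < m"
  shows "poisson_mass_deriv 2 k m = poisson_mass m k * (1 - 2 * real k / m + real k * (real k - 1) / m\<^sup>2)"
proof -
  have "poisson_mass_deriv 2 k m = (if k = 0 then 0 else poisson_mass_deriv 1 (k - 1) m) - poisson_mass_deriv 1 k m"
    by (simp add: numeral_2_eq_2)
  also have "\<dots> = poisson_mass m k * (1 - 2 * real k / m + real k * (real k - 1) / m\<^sup>2)"
  proof (cases k)
    case (Suc j)
    have 1: "poisson_mass_deriv 1 j m = poisson_mass m (Suc j) * (real (Suc j) / m) * (real j / m - 1)"
      unfolding poisson_mass_first_deriv[OF m] poisson_mass_Suc[OF m, of j] ..
    have "(if k = 0 then 0 else poisson_mass_deriv 1 (k - 1) m) - poisson_mass_deriv 1 k m =
      poisson_mass m k * (real k / m) * ((real k - 1) / m - 1) - poisson_mass m k * (real k / m - 1)"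
      using 1 by (simp add: Suc poisson_mass_first_deriv[OF m] del: poisson_mass_deriv.simps One_nat_def)
    also have "\<dots> = poisson_mass m k * (1 - 2 * real k / m + real k * (real k - 1) / m\<^sup>2)"
      using m by (simp add: power2_eq_square field_simps)
    finally show ?thesis .
  qed (simp add: poisson_mass_first_deriv[OF m])
  finally show ?thesis .
qed

text \<open>The remainder constant comes from \<open>2 ^ 3 / fact 3 \<le> 2\<close>.\<close>

lemma poisson_mass_taylor:
  assumes m: "0 < m" and x: "0 \<le> m + \<Delta>"
  shows "\<bar>poisson_mass (m + \<Delta>) k - (poisson_mass m k + poisson_mass_deriv 1 k m * \<Delta> + poisson_mass_deriv 2 k m / 2 * \<Delta>\<^sup>2)\<bar>
    \<le> 2 * \<bar>\<Delta>\<bar> ^ 3"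
proof (cases "\<Delta> = 0")
  case False
  have "\<exists>u. (if m + \<Delta> < m then m + \<Delta> < u \<and> u < m else m < u \<and> u < m + \<Delta>) \<and>
    poisson_mass (m + \<Delta>) k = (\<Sum>i<3. poisson_mass_deriv i k m / fact i * (m + \<Delta> - m) ^ i)
      + poisson_mass_deriv 3 k u / fact 3 * (m + \<Delta> - m) ^ 3"
    by (rule Taylor[where f="\<lambda>m. poisson_mass m k" and diff="\<lambda>i. poisson_mass_deriv i k" and a="min m (m + \<Delta>)" and b="max m (m + \<Delta>)"])
       (use False DERIV_poisson_mass_deriv in \<open>auto simp: fun_eq_iff\<close>)
  then obtain u where u: "if m + \<Delta> < m then m + \<Delta> < u \<and> u < m else m < u \<and> u < m + \<Delta>"
    and eq: "poisson_mass (m + \<Delta>) k = (\<Sum>i<3. poisson_mass_deriv i k m / fact i * \<Delta> ^ i) + poisson_mass_deriv 3 k u / fact 3 * \<Delta> ^ 3"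
    by auto
  have "0 \<le> u" using u x m by (auto split: if_splits)
  have "(\<Sum>i<3. poisson_mass_deriv i k m / fact i * \<Delta> ^ i) = poisson_mass m k + poisson_mass_deriv 1 k m * \<Delta> + poisson_mass_deriv 2 k m / 2 * \<Delta>\<^sup>2"
    by (simp add: numeral_3_eq_3 numeral_2_eq_2)
  then have "poisson_mass (m + \<Delta>) k - (poisson_mass m k + poisson_mass_deriv 1 k m * \<Delta> + poisson_mass_deriv 2 k m / 2 * \<Delta>\<^sup>2)
     = poisson_mass_deriv 3 k u / fact 3 * \<Delta> ^ 3" using eq by linarith
  also have "\<bar>\<dots>\<bar> = \<bar>poisson_mass_deriv 3 k u\<bar> / 6 * \<bar>\<Delta>\<bar> ^ 3"
    by (simp add: abs_mult power_abs fact_numeral)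
  also have "\<dots> \<le> 2 * \<bar>\<Delta>\<bar> ^ 3"
    using poisson_mass_deriv_bound[OF \<open>0 \<le> u\<close>, of 3 k] by (intro mult_right_mono) auto
  finally show ?thesis .
qed simp

text \<open>Bounds the third absolute moment by the second and the fourth, which are the ones that are computed.\<close>

lemma abs_cube_le:
  fixes x \<delta> :: real
  assumes \<delta>: "0 < \<delta>"
  shows "\<bar>x\<bar> ^ 3 \<le> \<delta> * x\<^sup>2 + x ^ 4 / \<delta>"
proof -
  have e: "\<bar>x\<bar> ^ 3 = \<bar>x\<bar> * x\<^sup>2" "x ^ 4 = \<bar>x\<bar> * \<bar>x\<bar> * x\<^sup>2"
    by (simp_all add: power2_eq_square power3_eq_cube power4_eq_xxxx)
  show ?thesis
  proof (cases "\<bar>x\<bar> \<le> \<delta>")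
    case True
    then have "\<bar>x\<bar> * x\<^sup>2 \<le> \<delta> * x\<^sup>2" by (intro mult_right_mono) auto
    moreover have "0 \<le> x ^ 4 / \<delta>" using \<delta> by simp
    ultimately show ?thesis unfolding e(1) by linarith
  next
    case False
    then have "\<delta> * (\<bar>x\<bar> * x\<^sup>2) \<le> \<bar>x\<bar> * (\<bar>x\<bar> * x\<^sup>2)" by (intro mult_right_mono) auto
    then have "\<bar>x\<bar> * x\<^sup>2 \<le> x ^ 4 / \<delta>" using \<delta> unfolding e(2) by (simp add: field_simps)
    moreover have "0 \<le> \<delta> * x\<^sup>2" using \<delta> by simp
    ultimately show ?thesis unfolding e(1) by linarith
  qed
qed

lemma (in prob_space) expectation_poisson_mass_bound:
  assumes [measurable]: "\<Delta> \<in> borel_measurable M" and b: "\<And>\<omega>. \<bar>\<Delta> \<omega>\<bar> \<le> B" and m: "0 < m" and pos: "\<And>\<omega>. \<omega> \<in> space M \<Longrightarrow> 0 \<le> m + \<Delta> \<omega>" and \<delta>: "0 < \<delta>"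
  shows "\<bar>(\<integral>\<omega>. poisson_mass (m + \<Delta> \<omega>) k \<partial>M) - (poisson_mass m k + poisson_mass_deriv 1 k m * (\<integral>\<omega>. \<Delta> \<omega> \<partial>M)
      + poisson_mass_deriv 2 k m / 2 * (\<integral>\<omega>. (\<Delta> \<omega>)\<^sup>2 \<partial>M))\<bar>
    \<le> 2 * (\<delta> * (\<integral>\<omega>. (\<Delta> \<omega>)\<^sup>2 \<partial>M) + (\<integral>\<omega>. \<Delta> \<omega> ^ 4 \<partial>M) / \<delta>)"
proof -
  have B0: "0 \<le> B" by (rule order_trans[OF abs_ge_zero b])
  have i: "integrable M (\<lambda>\<omega>. \<Delta> \<omega> ^ n)" for n
    by (rule integrable_const_bound[where B="B ^ n"]) (auto simp: power_abs intro!: power_mono b)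
  have i1: "integrable M \<Delta>" using i[of 1] by simp
  have [measurable]: "(\<lambda>\<omega>. poisson_mass (m + \<Delta> \<omega>) k) \<in> borel_measurable M" unfolding poisson_mass_def by measurable
  have ip: "integrable M (\<lambda>\<omega>. poisson_mass (m + \<Delta> \<omega>) k)"
    by (rule integrable_const_bound[where B=1]) (use pos in \<open>auto simp: poisson_mass_nonneg poisson_mass_le_1\<close>)
  define c0 c1 c2 where "c0 = poisson_mass m k" and "c1 = poisson_mass_deriv 1 k m" and "c2 = poisson_mass_deriv 2 k m / 2"
  let ?R = "\<lambda>\<omega>. poisson_mass (m + \<Delta> \<omega>) k - (c0 + c1 * \<Delta> \<omega> + c2 * \<Delta> \<omega> ^ 2)"
  have iq: "integrable M (\<lambda>\<omega>. c0 + c1 * \<Delta> \<omega> + c2 * \<Delta> \<omega> ^ 2)"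
    by (intro Bochner_Integration.integrable_add integrable_mult_right i1 i) simp
  have "(\<integral>\<omega>. c0 + c1 * \<Delta> \<omega> + c2 * \<Delta> \<omega> ^ 2 \<partial>M) = c0 + c1 * (\<integral>\<omega>. \<Delta> \<omega> \<partial>M) + c2 * (\<integral>\<omega>. \<Delta> \<omega> ^ 2 \<partial>M)"
    using i1 i[of 2] by (simp add: prob_space)
  then have "(\<integral>\<omega>. poisson_mass (m + \<Delta> \<omega>) k \<partial>M) - (c0 + c1 * (\<integral>\<omega>. \<Delta> \<omega> \<partial>M) + c2 * (\<integral>\<omega>. \<Delta> \<omega> ^ 2 \<partial>M)) = (\<integral>\<omega>. ?R \<omega> \<partial>M)"
    by (simp only: Bochner_Integration.integral_diff[OF ip iq])
  also have "\<bar>\<dots>\<bar> \<le> (\<integral>\<omega>. \<bar>?R \<omega>\<bar> \<partial>M)" by (rule integral_abs_bound)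
  also have "\<dots> \<le> (\<integral>\<omega>. 2 * (\<delta> * \<Delta> \<omega> ^ 2 + \<Delta> \<omega> ^ 4 / \<delta>) \<partial>M)"
  proof (rule integral_mono)
    fix \<omega> assume w: "\<omega> \<in> space M"
    show "\<bar>?R \<omega>\<bar> \<le> 2 * (\<delta> * \<Delta> \<omega> ^ 2 + \<Delta> \<omega> ^ 4 / \<delta>)"
      unfolding c0_def c1_def c2_def
      by (rule order_trans[OF poisson_mass_taylor[OF m pos[OF w]] mult_left_mono[OF abs_cube_le[OF \<delta>]]]) simp
  next
    show "integrable M (\<lambda>\<omega>. \<bar>?R \<omega>\<bar>)" by (intro integrable_abs Bochner_Integration.integrable_diff ip iq)
    show "integrable M (\<lambda>\<omega>. 2 * (\<delta> * \<Delta> \<omega> ^ 2 + \<Delta> \<omega> ^ 4 / \<delta>))"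
      by (intro integrable_mult_right Bochner_Integration.integrable_add integrable_divide_zero i)
  qed
  also have "\<dots> = 2 * (\<delta> * (\<integral>\<omega>. \<Delta> \<omega> ^ 2 \<partial>M) + (\<integral>\<omega>. \<Delta> \<omega> ^ 4 \<partial>M) / \<delta>)"
    using i[of 2] i[of 4] by simp
  finally show ?thesis unfolding c0_def c1_def c2_def .
qed

section \<open>Arrival times and the number in system\<close>

text \<open>Right-continuity makes the infimum attained: a count below \<open>n\<close> at time \<open>s\<close> persists for a while.\<close>

lemma arrival_time_le_iff:
  assumes N: "counting_process M N" and w: "\<omega> \<in> space M" and n: "1 \<le> n" and s: "0 \<le> s"
  shows "arrival_time N n \<omega> \<le> ereal s \<longleftrightarrow> n \<le> N s \<omega>"
proof
  assume "n \<le> N s \<omega>"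
  then show "arrival_time N n \<omega> \<le> ereal s"
    unfolding arrival_time_def using s by (intro INF_lower) auto
next
  assume le: "arrival_time N n \<omega> \<le> ereal s"
  show "n \<le> N s \<omega>"
  proof (rule ccontr)
    assume not: "\<not> n \<le> N s \<omega>"
    have cont: "continuous (at_right s) (\<lambda>s. N s \<omega>)" and mono: "mono_on {0..} (\<lambda>t. N t \<omega>)"
      using N w s by (auto simp: counting_process_def)
    have "((\<lambda>u. N u \<omega>) \<longlongrightarrow> N s \<omega>) (at_right s)"
      using cont by (simp add: continuous_within)
    then have "\<forall>\<^sub>F u in at_right s. N u \<omega> = N s \<omega>"
      by (simp add: tendsto_discrete)
    then obtain b where b: "b > s" "\<And>u. s < u \<Longrightarrow> u < b \<Longrightarrow> N u \<omega> = N s \<omega>"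
      by (auto simp: eventually_at_right_field)
    have "ereal b \<le> arrival_time N n \<omega>"
      unfolding arrival_time_def
    proof (rule INF_greatest)
      fix u assume u: "u \<in> {t. 0 \<le> t \<and> n \<le> N t \<omega>}"
      show "ereal b \<le> ereal u"
      proof (rule ccontr)
        assume "\<not> ereal b \<le> ereal u"
        then have ub: "u < b" by simp
        define m where "m = max u ((s + b) / 2)"
        have "s < m" "m < b" using b(1) ub by (auto simp: m_def max_def)
        then have "N m \<omega> = N s \<omega>" by (rule b(2))
        moreover have "N u \<omega> \<le> N m \<omega>" using u s b(1) by (intro mono_onD[OF mono]) (auto simp: m_def)
        ultimately show False using u not by auto
      qed
    qed
    then have "ereal b \<le> ereal s" using le by (rule order_trans)
    then show False using b(1) by simp
  qed
qed

lemma arrival_time_measurable: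
  assumes N: "counting_process M N" and n: "1 \<le> n"
  shows "arrival_time N n \<in> borel_measurable M"
proof (subst borel_measurable_iff_Iic_ereal, intro allI)
  fix a
  have nn: "0 \<le> arrival_time N n \<omega>" for \<omega>
    unfolding arrival_time_def by (intro INF_greatest) auto
  show "arrival_time N n -` {..a} \<inter> space M \<in> sets M"
  proof (cases a)
    case (real s)
    show ?thesis
    proof (cases "0 \<le> s")
      case True
      have [measurable]: "N s \<in> M \<rightarrow>\<^sub>M count_space UNIV" using N True by (simp add: counting_process_def)
      have "arrival_time N n -` {..a} \<inter> space M = {\<omega> \<in> space M. n \<le> N s \<omega>}"
        using arrival_time_le_iff[OF N _ n True] by (auto simp: real)
      then show ?thesis by simp
    next
      case False
      then have "arrival_time N n -` {..a} \<inter> space M = {}"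
        using nn by (auto simp: real) (metis ereal_less_eq(5) order_trans)
      then show ?thesis by simp
    qed
  next
    case PInf
    then have "arrival_time N n -` {..a} \<inter> space M = space M" by auto
    then show ?thesis by simp
  next
    case MInf
    have "arrival_time N n \<omega> \<noteq> -\<infinity>" for \<omega> using nn[of \<omega>] by auto
    then have "arrival_time N n -` {..a} \<inter> space M = {}" using MInf by auto
    then show ?thesis by simp
  qed
qed

text \<open>The set counted by the number in system; working with the set allows splitting it by arrival cell.\<close>

definition in_system :: "(real \<Rightarrow> 'w \<Rightarrow> nat) \<Rightarrow> (nat \<Rightarrow> 'w \<Rightarrow> real) \<Rightarrow> real \<Rightarrow> 'w \<Rightarrow> nat set"
  where "in_system N V t \<omega> = {n. 1 \<le> n \<and> arrival_time N n \<omega> \<le> ereal t \<and>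
             ereal t < arrival_time N n \<omega> + ereal (V n \<omega>)}"

lemma number_in_system_eq: "number_in_system N V t \<omega> = card (in_system N V t \<omega>)"
  by (simp add: number_in_system_def in_system_def)

lemma in_system_subset:
  assumes "counting_process M N" "\<omega> \<in> space M" "0 \<le> t"
  shows "in_system N V t \<omega> \<subseteq> {1..N t \<omega>}"
  using arrival_time_le_iff[OF assms(1,2) _ assms(3)] by (auto simp: in_system_def)

lemma number_in_system_measurable:
  assumes N: "counting_process M N" and t: "0 \<le> t" and V: "\<And>n. 1 \<le> n \<Longrightarrow> V n \<in> borel_measurable M"
  shows "number_in_system N V t \<in> M \<rightarrow>\<^sub>M count_space UNIV"
proof -
  have [measurable]: "N t \<in> M \<rightarrow>\<^sub>M count_space UNIV" using N t by (simp add: counting_process_def)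
  define S where "S n \<omega> = (if n \<in> in_system N V t \<omega> then 1 else 0 :: nat)" for n \<omega>
  have [measurable]: "S n \<in> M \<rightarrow>\<^sub>M count_space UNIV" for n
  proof (cases "1 \<le> n")
    case True
    note [measurable] = arrival_time_measurable[OF N True] V[OF True]
    show ?thesis unfolding S_def in_system_def by measurable
  next
    case False
    then have "S n = (\<lambda>_. 0)" by (auto simp: S_def in_system_def)
    then show ?thesis by simp
  qed
  have "(\<lambda>\<omega>. (\<lambda>m \<omega>. \<Sum>n\<in>{1..m}. S n \<omega>) (N t \<omega>) \<omega>) \<in> M \<rightarrow>\<^sub>M count_space UNIV"
    by (rule measurable_compose_countable) measurable
  then show ?thesis
  proof (rule measurable_cong[THEN iffD1, rotated])
    fix \<omega> assume w: "\<omega> \<in> space M"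
    have "(\<Sum>n\<in>{1..N t \<omega>}. S n \<omega>) = card ({1..N t \<omega>} \<inter> in_system N V t \<omega>)"
      by (simp add: S_def sum.If_cases)
    also have "{1..N t \<omega>} \<inter> in_system N V t \<omega> = in_system N V t \<omega>"
      using in_system_subset[OF N w t] by blast
    finally show "(\<Sum>n\<in>{1..N t \<omega>}. S n \<omega>) = number_in_system N V t \<omega>"
      by (simp add: number_in_system_eq)
  qed
qed

text \<open>Customers are numbered in order of arrival, so the cell in which a customer arrives can be read off
  the cumulative counts \<open>a\<close> at the grid points.\<close>

lemma block_index:
  fixes a :: "nat \<Rightarrow> nat"
  assumes a: "mono a" and n: "n \<in> {a i<..a (Suc i)}"
  shows "(LEAST j. n \<le> a (Suc j)) = i"
proof (rule Least_equality)
  show "n \<le> a (Suc i)" using n by simp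
  fix j assume j: "n \<le> a (Suc j)"
  show "i \<le> j"
  proof (rule ccontr)
    assume "\<not> i \<le> j"
    then have "a (Suc j) \<le> a i" by (intro monoD[OF a]) simp
    then show False using j n by simp
  qed
qed

lemma blocks_disjoint:
  fixes a :: "nat \<Rightarrow> nat"
  assumes a: "mono a" and ij: "i \<noteq> j"
  shows "{a i<..a (Suc i)} \<inter> {a j<..a (Suc j)} = {}"
  using block_index[OF a, of _ i] block_index[OF a, of _ j] ij by blast

lemma blocks_Union:
  fixes a :: "nat \<Rightarrow> nat"
  assumes a: "mono a"
  shows "(\<Union>i<m. {a i<..a (Suc i)}) = {a 0<..a m}"
proof (induction m)
  case (Suc m)
  have "a 0 \<le> a m" "a m \<le> a (Suc m)" by (auto intro: monoD[OF a])
  then show ?case using Suc.IH by (auto simp: lessThan_Suc)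
qed auto

lemma prod_if_power:
  assumes "finite B"
  shows "(\<Prod>n\<in>B. if Q n then z else 1) = (z :: real) ^ card {n \<in> B. Q n}"
  using assms by (simp add: prod.If_cases Int_def)

section \<open>The infinite-server queue with doubly stochastic Poisson arrivals\<close>

text \<open>Only the mixed Poisson law of the increments enters, which covers ordinary Poisson processes (with a
  constant \<open>\<Lambda>\<close>) and doubly stochastic ones alike.  \<open>K\<close> is the tail of the service times.\<close>

locale cox_infinite_server = prob_space M for M :: "'w measure" +
  fixes N :: "real \<Rightarrow> 'w \<Rightarrow> nat" and V :: "nat \<Rightarrow> 'w \<Rightarrow> real"
    and \<Lambda> :: "real \<Rightarrow> 'w \<Rightarrow> real" and K :: "real \<Rightarrow> real" and C :: real
  assumes N: "counting_process M N"
    and V_indep: "indep_vars (\<lambda>_. borel) V {1..}"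
    and V_tail: "\<And>n u. 1 \<le> n \<Longrightarrow> prob {\<omega> \<in> space M. u < V n \<omega>} = K u"
    and N_V: "independent_of_arrivals M N V"
    and \<Lambda>_meas [measurable]: "(\<lambda>(s, \<omega>). \<Lambda> s \<omega>) \<in> borel_measurable (borel \<Otimes>\<^sub>M M)"
    and \<Lambda>_nonneg: "\<And>s \<omega>. 0 \<le> \<Lambda> s \<omega>" and \<Lambda>_le: "\<And>s \<omega>. \<Lambda> s \<omega> \<le> C"
    and increments: "\<And>\<tau> n k. 0 \<le> \<tau> 0 \<Longrightarrow> mono \<tau> \<Longrightarrow>
      prob {\<omega> \<in> space M. \<forall>i<n. N (\<tau> (Suc i)) \<omega> - N (\<tau> i) \<omega> = k i} =
      (\<integral>\<omega>. (\<Prod>i<n. poisson_mass (LINT s:{\<tau> i..\<tau> (Suc i)}|lborel. \<Lambda> s \<omega>) (k i)) \<partial>M)"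
begin

lemma V_measurable: "1 \<le> n \<Longrightarrow> V n \<in> borel_measurable M"
  using V_indep by (auto simp: indep_vars_def2)

lemma N_measurable: "0 \<le> s \<Longrightarrow> N s \<in> M \<rightarrow>\<^sub>M count_space UNIV"
  using N by (simp add: counting_process_def)

definition intensity_mass :: "real \<Rightarrow> real \<Rightarrow> 'w \<Rightarrow> real"
  where "intensity_mass a b \<omega> = (LINT s:{a..b}|lborel. \<Lambda> s \<omega>)"

lemma intensity_mass_measurable [measurable]: "intensity_mass a b \<in> borel_measurable M"
  unfolding intensity_mass_def set_lebesgue_integral_def by measurable

lemma intensity_mass_nonneg: "0 \<le> intensity_mass a b \<omega>"
  unfolding intensity_mass_def set_lebesgue_integral_def
  by (intro Bochner_Integration.integral_nonneg) (auto simp: \<Lambda>_nonneg)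

lemma K_eq: "K u = prob {\<omega> \<in> space M. u < V 1 \<omega>}"
  using V_tail[of 1 u] by simp

lemma K_nonneg: "0 \<le> K u" and K_le_1: "K u \<le> 1"
  unfolding K_eq by auto

lemma expectation_thinning_weight:
  assumes J: "finite J" "J \<subseteq> {1..}" and z: "0 \<le> z" "z \<le> 1"
  shows "(\<integral>\<omega>. (\<Prod>n\<in>J. if c n < V n \<omega> then z else 1) \<partial>M) = (\<Prod>n\<in>J. 1 - (1 - z) * K (c n))"
proof -
  have m: "(\<lambda>\<omega>. if c n < V n \<omega> then z else 1) \<in> borel_measurable M" if "n \<in> J" for n
  proof -
    have n1: "1 \<le> n" using that J by auto
    note [measurable] = V_measurable[OF n1]
    show ?thesis by measurable
  qed
  have "(\<integral>\<omega>. (\<Prod>n\<in>J. if c n < V n \<omega> then z else 1) \<partial>M) = (\<Prod>n\<in>J. \<integral>\<omega>. (if c n < V n \<omega> then z else 1) \<partial>M)"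
  proof (rule indep_vars_lebesgue_integral[OF J(1)])
    have "indep_vars (\<lambda>_. borel) V J" by (rule indep_vars_subset[OF V_indep J(2)])
    then show "indep_vars (\<lambda>_. borel) (\<lambda>n \<omega>. if c n < V n \<omega> then z else 1) J"
      by (rule indep_vars_compose2[where Y="\<lambda>n v. if c n < v then z else 1"]) measurable
    show "integrable M (\<lambda>\<omega>. if c n < V n \<omega> then z else 1)" if "n \<in> J" for n
      using m[OF that] z by (intro integrable_const_bound[where B=1]) auto
  qed
  also have "\<dots> = (\<Prod>n\<in>J. 1 - (1 - z) * K (c n))"
  proof (rule prod.cong[OF refl])
    fix n assume n: "n \<in> J"
    then have n1: "1 \<le> n" using J by auto
    note [measurable] = V_measurable[OF n1]
    have "(\<integral>\<omega>. (if c n < V n \<omega> then z else 1) \<partial>M) = (\<integral>\<omega>. 1 - (1 - z) * indicator {\<omega> \<in> space M. c n < V n \<omega>} \<omega> \<partial>M)"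
      by (intro Bochner_Integration.integral_cong) (auto simp: indicator_def)
    also have "\<dots> = 1 - (1 - z) * prob {\<omega> \<in> space M. c n < V n \<omega>}"
    proof -
      have "integrable M (indicator {\<omega> \<in> space M. c n < V n \<omega>} :: 'w \<Rightarrow> real)"
        by (intro integrable_real_indicator) (auto simp: less_top[symmetric])
      then show ?thesis by (simp add: prob_space)
    qed
    finally show "(\<integral>\<omega>. (if c n < V n \<omega> then z else 1) \<partial>M) = 1 - (1 - z) * K (c n)"
      by (simp add: V_tail[OF n1])
  qed
  finally show ?thesis .
qed

lemma expectation_arrivals_services:
  assumes A: "A \<in> sets (generated M (count_space UNIV) N {0..})"
    and W: "W \<in> borel_measurable (generated M borel V {1..})" and WB: "\<And>\<omega>. \<bar>W \<omega>\<bar> \<le> B"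
  shows "(\<integral>\<omega>. indicator A \<omega> * W \<omega> \<partial>M) = prob A * (\<integral>\<omega>. W \<omega> \<partial>M)"
proof -
  let ?GN = "generated M (count_space UNIV) N {0..}" and ?GV = "generated M borel V {1..}"
  have subN: "subalgebra M ?GN" by (rule subalgebra_generated) (use N_measurable in auto)
  have subV: "subalgebra M ?GV" by (rule subalgebra_generated) (use V_measurable in auto)
  have spN: "space ?GN = space M" and spV: "space ?GV = space M" using subN subV by (auto simp: subalgebra_def)
  have AM [measurable]: "A \<in> sets M" using A subN by (auto simp: subalgebra_def)
  have WM [measurable]: "W \<in> borel_measurable M" by (rule measurable_from_subalg[OF subV W])
  have IA: "indicator A \<in> borel_measurable ?GN" using A by simp
  have gen: "sigma_sets (space M) {Z -` S \<inter> space M |S. S \<in> sets borel} \<subseteq> sets G"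
    if "Z \<in> borel_measurable G" "space G = space M" for G and Z :: "'w \<Rightarrow> real"
    using that by (intro sets.sigma_sets_subset[of _ G, unfolded that(2)]) (auto dest: measurable_sets)
  have "indep_set (sets ?GN) (sets ?GV)" using N_V by (simp add: independent_of_arrivals_def)
  then have "indep_set (sigma_sets (space M) {indicator A -` S \<inter> space M |S. S \<in> sets (borel :: real measure)})
     (sigma_sets (space M) {W -` S \<inter> space M |S. S \<in> sets borel})"
    unfolding indep_set_def
    by (rule indep_sets_mono_sets) (use gen[OF IA spN] gen[OF W spV] in \<open>auto split: bool.split\<close>)
  then have iv: "indep_var borel (indicator A :: 'w \<Rightarrow> real) borel W"
    unfolding indep_var_eq by simp
  have "(\<integral>\<omega>. indicator A \<omega> * W \<omega> \<partial>M) = (\<integral>\<omega>. indicator A \<omega> \<partial>M) * (\<integral>\<omega>. W \<omega> \<partial>M)"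
  proof (rule indep_var_lebesgue_integral[OF iv])
    show "integrable M (indicator A :: 'w \<Rightarrow> real)"
      by (intro integrable_real_indicator) (auto simp: less_top[symmetric])
    show "integrable M W" by (rule integrable_const_bound[where B=B]) (auto simp: WB)
  qed
  then show ?thesis by simp
qed

lemma block_count_measurable:
  assumes "0 \<le> a" "0 \<le> b"
  shows "(\<lambda>\<omega>. card {n \<in> {N a \<omega><..N b \<omega>}. c < V n \<omega>}) \<in> M \<rightarrow>\<^sub>M count_space UNIV"
proof -
  note [measurable] = N_measurable[OF assms(1)] N_measurable[OF assms(2)]
  define S where "S n \<omega> = (if 1 \<le> n \<and> c < V n \<omega> then 1 else 0 :: nat)" for n \<omega>
  have [measurable]: "S n \<in> M \<rightarrow>\<^sub>M count_space UNIV" for n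
  proof (cases "1 \<le> n")
    case True
    note [measurable] = V_measurable[OF True]
    show ?thesis unfolding S_def by measurable
  next
    case False
    then have "S n = (\<lambda>_. 0)" by (auto simp: S_def)
    then show ?thesis by simp
  qed
  have "(\<lambda>\<omega>. \<Sum>n\<in>{N a \<omega><..N b \<omega>}. S n \<omega>) \<in> M \<rightarrow>\<^sub>M count_space UNIV"
  proof (rule measurable_compose_countable[where f="\<lambda>p \<omega>. \<Sum>n\<in>{p<..N b \<omega>}. S n \<omega>" and g="N a"])
    show "(\<lambda>\<omega>. \<Sum>n\<in>{p<..N b \<omega>}. S n \<omega>) \<in> M \<rightarrow>\<^sub>M count_space UNIV" for p
    proof (rule measurable_compose_countable[where f="\<lambda>q \<omega>. \<Sum>n\<in>{p<..q}. S n \<omega>" and g="N b"])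
      show "(\<lambda>\<omega>. \<Sum>n\<in>{p<..q}. S n \<omega>) \<in> M \<rightarrow>\<^sub>M count_space UNIV" for q by measurable
    qed measurable
  qed measurable
  moreover have "(\<Sum>n\<in>{p<..q}. S n \<omega>) = card {n \<in> {p<..q}. c < V n \<omega>}" for p q \<omega>
  proof -
    have "(\<Sum>n\<in>{p<..q}. S n \<omega>) = (\<Sum>n\<in>{p<..q}. if c < V n \<omega> then 1 else 0)"
      by (intro sum.cong) (auto simp: S_def)
    also have "\<dots> = card {n \<in> {p<..q}. c < V n \<omega>}"
      by (subst card_eq_sum, subst sum.inter_filter) auto
    finally show ?thesis .
  qed
  ultimately show ?thesis by (simp only:)
qed

lemma thinned_count_power_measurable:
  assumes "\<And>i. 0 \<le> \<tau> i"
  shows "(\<lambda>\<omega>. (z :: real) ^ (\<Sum>i<m. card {n \<in> {N (\<tau> i) \<omega><..N (\<tau> (Suc i)) \<omega>}. c i < V n \<omega>})) \<in> borel_measurable M"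
proof -
  define D where "D i \<omega> = card {n \<in> {N (\<tau> i) \<omega><..N (\<tau> (Suc i)) \<omega>}. c i < V n \<omega>}" for i \<omega>
  have [measurable]: "D i \<in> M \<rightarrow>\<^sub>M count_space UNIV" for i
    unfolding D_def by (rule block_count_measurable) (use assms in auto)
  have sum_meas: "(\<lambda>\<omega>. \<Sum>i<m. D i \<omega>) \<in> M \<rightarrow>\<^sub>M count_space UNIV" by measurable
  have "(\<lambda>\<omega>. z ^ (\<Sum>i<m. D i \<omega>)) \<in> borel_measurable M"
    by (rule measurable_compose[OF sum_meas]) simp
  then show ?thesis unfolding D_def .
qed

text \<open>Keep a customer of cell \<open>i\<close> when the service time exceeds the threshold \<open>c i\<close>.  Given the counts in the
  cells, the kept customers are independent, so the generating function is a sum over all vectors of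
  counts; it factorises over the cells into Poisson generating functions.\<close>

lemma thinned_count_pgf:
  assumes \<tau>: "\<tau> 0 = 0" "mono \<tau>" and z: "0 \<le> z" "z \<le> 1"
  shows "(\<integral>\<omega>. z ^ (\<Sum>i<m. card {n \<in> {N (\<tau> i) \<omega><..N (\<tau> (Suc i)) \<omega>}. c i < V n \<omega>}) \<partial>M) =
    (\<integral>\<omega>. exp (- ((1 - z) * (\<Sum>i<m. intensity_mass (\<tau> i) (\<tau> (Suc i)) \<omega> * K (c i)))) \<partial>M)"
proof -
  have \<tau>0: "0 \<le> \<tau> i" for i using monoD[OF \<tau>(2), of 0 i] \<tau>(1) by simp
  have [measurable]: "N (\<tau> i) \<in> M \<rightarrow>\<^sub>M count_space UNIV" for i by (rule N_measurable[OF \<tau>0])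
  define I where "I = (PiE {..<m} (\<lambda>_. UNIV) :: (nat \<Rightarrow> nat) set)"
  have I: "countable I" unfolding I_def by (intro countable_PiE) auto
  define L where "L \<omega> = (\<Sum>i<m. card {n \<in> {N (\<tau> i) \<omega><..N (\<tau> (Suc i)) \<omega>}. c i < V n \<omega>})" for \<omega>
  define ev where "ev k = {\<omega> \<in> space M. \<forall>i<m. N (\<tau> (Suc i)) \<omega> - N (\<tau> i) \<omega> = k i}" for k
  define S where "S k i = (\<Sum>j<i. k j)" for k :: "nat \<Rightarrow> nat" and i
  have S_mono: "mono (S k)" for k unfolding S_def by (intro monoI sum_mono2) auto
  \<comment> \<open>On the event that the increments are \<open>k\<close>, this is \<open>z\<close> to the number of kept customers, but
    it depends on the service times alone.\<close>
  define W where "W k \<omega> = (\<Prod>n\<in>{0<..S k m}. if c (LEAST j. n \<le> S k (Suc j)) < V n \<omega> then z else 1)" for k \<omega>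
  define q where "q i = 1 - (1 - z) * K (c i)" for i
  have q0: "0 \<le> q i" for i
    using mult_mono[of "1 - z" 1 "K (c i)" 1] z K_nonneg[of "c i"] K_le_1[of "c i"] by (simp add: q_def)
  have ev_meas [measurable]: "ev k \<in> sets M" for k unfolding ev_def by measurable
  have W01: "0 \<le> W k \<omega>" "W k \<omega> \<le> 1" for k \<omega>
    unfolding W_def using z by (auto intro!: prod_nonneg prod_le_1)
  have prod_blocks: "(\<Prod>n\<in>{0<..S k m}. h n) = (\<Prod>i<m. \<Prod>n\<in>{S k i<..S k (Suc i)}. h n)" for k and h :: "nat \<Rightarrow> real"
  proof -
    have "{0<..S k m} = (\<Union>i<m. {S k i<..S k (Suc i)})"
      using blocks_Union[OF S_mono, of k m] by (simp add: S_def)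
    then show ?thesis
      using blocks_disjoint[OF S_mono] by (simp add: prod.UNION_disjoint)
  qed
  have W_meas: "W k \<in> borel_measurable (generated M borel V {1..})" for k
  proof -
    have "V n \<in> borel_measurable (generated M borel V {1..})" if "n \<in> {0<..S k m}" for n
      using that by (intro measurable_generated) auto
    then show ?thesis unfolding W_def by measurable
  qed
  have W_measM [measurable]: "W k \<in> borel_measurable M" for k
    by (rule measurable_from_subalg[OF subalgebra_generated W_meas]) (use V_measurable in auto)
  have on_ev: "z ^ L \<omega> = W k \<omega>" if w: "\<omega> \<in> ev k" for k \<omega>
  proof -
    have NS: "i \<le> m \<Longrightarrow> N (\<tau> i) \<omega> = S k i" for i
    proof (induction i)
      case 0
      then show ?case using N w \<tau>(1) by (simp add: S_def ev_def counting_process_def)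
    next
      case (Suc i)
      have "N (\<tau> i) \<omega> \<le> N (\<tau> (Suc i)) \<omega>"
      proof (rule mono_onD[of "{0..}" "\<lambda>t. N t \<omega>"])
        show "mono_on {0..} (\<lambda>t. N t \<omega>)" using N w by (simp add: counting_process_def ev_def)
        show "\<tau> i \<le> \<tau> (Suc i)" by (rule monoD[OF \<tau>(2)]) simp
      qed (use \<tau>0 in auto)
      moreover have "N (\<tau> (Suc i)) \<omega> - N (\<tau> i) \<omega> = k i" using w Suc.prems by (simp add: ev_def)
      ultimately show ?case using Suc.IH Suc.prems by (simp add: S_def)
    qed
    have "W k \<omega> = (\<Prod>i<m. \<Prod>n\<in>{S k i<..S k (Suc i)}. if c (LEAST j. n \<le> S k (Suc j)) < V n \<omega> then z else 1)"
      unfolding W_def prod_blocks ..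
    also have "\<dots> = (\<Prod>i<m. \<Prod>n\<in>{S k i<..S k (Suc i)}. if c i < V n \<omega> then z else 1)"
      by (intro prod.cong refl) (simp add: block_index[OF S_mono])
    also have "\<dots> = (\<Prod>i<m. z ^ card {n \<in> {S k i<..S k (Suc i)}. c i < V n \<omega>})"
      by (intro prod.cong refl prod_if_power) simp
    also have "\<dots> = z ^ L \<omega>"
      by (simp add: L_def NS power_sum)
    finally show ?thesis by simp
  qed
  have EW: "(\<integral>\<omega>. W k \<omega> \<partial>M) = (\<Prod>i<m. q i ^ k i)" for k
  proof -
    have "(\<integral>\<omega>. W k \<omega> \<partial>M) = (\<Prod>n\<in>{0<..S k m}. q (LEAST j. n \<le> S k (Suc j)))"
      unfolding W_def q_def by (rule expectation_thinning_weight) (use z in auto)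
    also have "\<dots> = (\<Prod>i<m. \<Prod>n\<in>{S k i<..S k (Suc i)}. q i)"
      unfolding prod_blocks by (intro prod.cong refl) (simp add: block_index[OF S_mono])
    also have "\<dots> = (\<Prod>i<m. q i ^ k i)" by (simp add: S_def)
    finally show ?thesis .
  qed
  define \<mu> where "\<mu> i = intensity_mass (\<tau> i) (\<tau> (Suc i))" for i
  have \<mu>0: "0 \<le> \<mu> i \<omega>" for i \<omega> unfolding \<mu>_def by (rule intensity_mass_nonneg)
  have [measurable]: "\<mu> i \<in> borel_measurable M" for i unfolding \<mu>_def by measurable
  have [measurable]: "(\<lambda>\<omega>. poisson_mass (\<mu> i \<omega>) n) \<in> borel_measurable M" for i n
    unfolding poisson_mass_def by measurable
  have Evk: "(\<integral>\<^sup>+\<omega>. indicator (ev k) \<omega> * ennreal (W k \<omega>) \<partial>M) =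
    (\<integral>\<^sup>+\<omega>. (\<Prod>i<m. ennreal (poisson_mass (\<mu> i \<omega>) (k i) * q i ^ k i)) \<partial>M)" for k
  proof -
    have evG: "ev k \<in> sets (generated M (count_space UNIV) N {0..})"
    proof -
      let ?G = "generated M (count_space UNIV) N {0..}"
      have [measurable]: "N (\<tau> i) \<in> ?G \<rightarrow>\<^sub>M count_space UNIV" for i
        by (rule measurable_generated) (use \<tau>0 in auto)
      have "ev k = {\<omega> \<in> space ?G. \<forall>i<m. N (\<tau> (Suc i)) \<omega> - N (\<tau> i) \<omega> = k i}"
        by (simp add: ev_def generated_def space_measure_of_conv)
      also have "\<dots> \<in> sets ?G" by measurable
      finally show ?thesis .
    qed
    have iw: "integrable M (\<lambda>\<omega>. indicator (ev k) \<omega> * W k \<omega>)"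
      by (rule integrable_const_bound[where B=1]) (use W01 in \<open>auto simp: indicator_def\<close>)
    have ip: "integrable M (\<lambda>\<omega>. \<Prod>i<m. poisson_mass (\<mu> i \<omega>) (k i))"
    proof (rule integrable_const_bound[where B=1])
      show "AE \<omega> in M. norm (\<Prod>i<m. poisson_mass (\<mu> i \<omega>) (k i)) \<le> 1"
        by (auto intro!: AE_I2 prod_le_1 simp: abs_prod poisson_mass_nonneg poisson_mass_le_1 \<mu>0)
    qed measurable
    have "(\<integral>\<^sup>+\<omega>. indicator (ev k) \<omega> * ennreal (W k \<omega>) \<partial>M) = (\<integral>\<^sup>+\<omega>. ennreal (indicator (ev k) \<omega> * W k \<omega>) \<partial>M)"
      by (intro nn_integral_cong) (auto simp: indicator_def)
    also have "\<dots> = ennreal (\<integral>\<omega>. indicator (ev k) \<omega> * W k \<omega> \<partial>M)"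
      by (rule nn_integral_eq_integral[OF iw]) (use W01 in auto)
    also have "(\<integral>\<omega>. indicator (ev k) \<omega> * W k \<omega> \<partial>M) = prob (ev k) * (\<Prod>i<m. q i ^ k i)"
      unfolding EW[symmetric] by (rule expectation_arrivals_services[OF evG W_meas, where B=1]) (use W01 in auto)
    also have "prob (ev k) = (\<integral>\<omega>. (\<Prod>i<m. poisson_mass (\<mu> i \<omega>) (k i)) \<partial>M)"
      unfolding ev_def \<mu>_def intensity_mass_def using \<tau> by (intro increments) auto
    also have "\<dots> * (\<Prod>i<m. q i ^ k i) = (\<integral>\<omega>. (\<Prod>i<m. poisson_mass (\<mu> i \<omega>) (k i)) * (\<Prod>i<m. q i ^ k i) \<partial>M)"
      by (rule integral_mult_left_zero[symmetric])
    also have "ennreal \<dots> = (\<integral>\<^sup>+\<omega>. ennreal ((\<Prod>i<m. poisson_mass (\<mu> i \<omega>) (k i)) * (\<Prod>i<m. q i ^ k i)) \<partial>M)"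
      by (rule nn_integral_eq_integral[symmetric])
         (auto intro!: integrable_mult_left ip AE_I2 mult_nonneg_nonneg prod_nonneg zero_le_power simp: poisson_mass_nonneg \<mu>0 q0)
    also have "\<dots> = (\<integral>\<^sup>+\<omega>. (\<Prod>i<m. ennreal (poisson_mass (\<mu> i \<omega>) (k i) * q i ^ k i)) \<partial>M)"
      by (intro nn_integral_cong) (simp add: prod.distrib[symmetric] prod_ennreal poisson_mass_nonneg \<mu>0 q0)
    finally show ?thesis .
  qed
  have split: "ennreal (z ^ L \<omega>) = (\<integral>\<^sup>+k. indicator (ev k) \<omega> * ennreal (W k \<omega>) \<partial>count_space I)" if w: "\<omega> \<in> space M" for \<omega>
  proof -
    define k where "k = restrict (\<lambda>i. N (\<tau> (Suc i)) \<omega> - N (\<tau> i) \<omega>) {..<m}"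
    have kI: "k \<in> I" by (simp add: k_def I_def)
    have kev: "\<omega> \<in> ev k" using w by (simp add: ev_def k_def)
    have "k' = k" if "k' \<in> I" "\<omega> \<in> ev k'" for k'
      using that by (intro PiE_ext[of k' "{..<m}" "\<lambda>_. UNIV" k]) (auto simp: I_def ev_def k_def)
    then have "(\<omega> \<in> ev k') = (k' = k)" if "k' \<in> I" for k' using kev that by blast
    then have "(\<integral>\<^sup>+k'. indicator (ev k') \<omega> * ennreal (W k' \<omega>) \<partial>count_space I) = (\<integral>\<^sup>+k'. ennreal (W k \<omega>) * indicator {k} k' \<partial>count_space I)"
      by (intro nn_integral_cong) (simp add: indicator_def)
    also have "\<dots> = ennreal (W k \<omega>)" using kI by (simp add: nn_integral_cmult_indicator)
    finally show ?thesis using on_ev[OF kev] by simp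
  qed
  have "(\<integral>\<^sup>+\<omega>. ennreal (z ^ L \<omega>) \<partial>M) = (\<integral>\<^sup>+\<omega>. \<integral>\<^sup>+k. indicator (ev k) \<omega> * ennreal (W k \<omega>) \<partial>count_space I \<partial>M)"
    by (intro nn_integral_cong split)
  also have "\<dots> = (\<integral>\<^sup>+k. \<integral>\<^sup>+\<omega>. indicator (ev k) \<omega> * ennreal (W k \<omega>) \<partial>M \<partial>count_space I)"
    by (rule nn_integral_count_space_nn_integral[OF I]) measurable
  also have "\<dots> = (\<integral>\<^sup>+k. \<integral>\<^sup>+\<omega>. (\<Prod>i<m. ennreal (poisson_mass (\<mu> i \<omega>) (k i) * q i ^ k i)) \<partial>M \<partial>count_space I)"
    unfolding Evk ..
  also have "\<dots> = (\<integral>\<^sup>+\<omega>. \<integral>\<^sup>+k. (\<Prod>i<m. ennreal (poisson_mass (\<mu> i \<omega>) (k i) * q i ^ k i)) \<partial>count_space I \<partial>M)"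
    by (rule nn_integral_count_space_nn_integral[OF I, symmetric]) measurable
  also have "\<dots> = (\<integral>\<^sup>+\<omega>. ennreal (exp (- ((1 - z) * (\<Sum>i<m. \<mu> i \<omega> * K (c i))))) \<partial>M)"
  proof (rule nn_integral_cong)
    fix \<omega>
    interpret PF: product_sigma_finite "\<lambda>_::nat. count_space (UNIV :: nat set)"
      by (simp add: product_sigma_finite_def sigma_finite_measure_count_space)
    have "(\<integral>\<^sup>+k. (\<Prod>i<m. ennreal (poisson_mass (\<mu> i \<omega>) (k i) * q i ^ k i)) \<partial>count_space I)
      = (\<Prod>i<m. \<integral>\<^sup>+n. ennreal (poisson_mass (\<mu> i \<omega>) n * q i ^ n) \<partial>count_space UNIV)"
    proof -
      have "count_space I = Pi\<^sub>M {..<m} (\<lambda>_. count_space UNIV)"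
        unfolding I_def by (rule count_space_PiM_finite[symmetric]) auto
      then have "(\<integral>\<^sup>+k. (\<Prod>i<m. ennreal (poisson_mass (\<mu> i \<omega>) (k i) * q i ^ k i)) \<partial>count_space I)
        = (\<integral>\<^sup>+k. (\<Prod>i<m. ennreal (poisson_mass (\<mu> i \<omega>) (k i) * q i ^ k i)) \<partial>Pi\<^sub>M {..<m} (\<lambda>_. count_space UNIV))"
        by (simp only:)
      also have "\<dots> = (\<Prod>i<m. \<integral>\<^sup>+n. ennreal (poisson_mass (\<mu> i \<omega>) n * q i ^ n) \<partial>count_space UNIV)"
        by (rule PF.product_nn_integral_prod[where f="\<lambda>i n. ennreal (poisson_mass (\<mu> i \<omega>) n * q i ^ n)"]) auto
      finally show ?thesis .
    qed
    also have "\<dots> = (\<Prod>i<m. ennreal (exp (- \<mu> i \<omega> * (1 - q i))))"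
    proof (rule prod.cong[OF refl])
      fix i
      have s: "(\<lambda>n. poisson_mass (\<mu> i \<omega>) n * q i ^ n) sums exp (- \<mu> i \<omega> * (1 - q i))"
        by (rule poisson_mass_sums)
      have "(\<integral>\<^sup>+n. ennreal (poisson_mass (\<mu> i \<omega>) n * q i ^ n) \<partial>count_space UNIV) = (\<Sum>n. ennreal (poisson_mass (\<mu> i \<omega>) n * q i ^ n))"
        by (rule nn_integral_count_space_nat)
      also have "\<dots> = ennreal (exp (- \<mu> i \<omega> * (1 - q i)))"
        by (rule suminf_ennreal_eq[OF _ s]) (simp add: poisson_mass_nonneg \<mu>0 q0)
      finally show "(\<integral>\<^sup>+n. ennreal (poisson_mass (\<mu> i \<omega>) n * q i ^ n) \<partial>count_space UNIV) = ennreal (exp (- \<mu> i \<omega> * (1 - q i)))" .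
    qed
    also have "\<dots> = ennreal (exp (\<Sum>i<m. - \<mu> i \<omega> * (1 - q i)))"
      by (simp add: prod_ennreal exp_sum)
    also have "(\<Sum>i<m. - \<mu> i \<omega> * (1 - q i)) = - ((1 - z) * (\<Sum>i<m. \<mu> i \<omega> * K (c i)))"
      by (simp add: q_def sum_distrib_left sum_negf mult_ac)
    finally show "(\<integral>\<^sup>+k. (\<Prod>i<m. ennreal (poisson_mass (\<mu> i \<omega>) (k i) * q i ^ k i)) \<partial>count_space I) =
      ennreal (exp (- ((1 - z) * (\<Sum>i<m. \<mu> i \<omega> * K (c i)))))" .
  qed
  finally have eq: "(\<integral>\<^sup>+\<omega>. ennreal (z ^ L \<omega>) \<partial>M) = (\<integral>\<^sup>+\<omega>. ennreal (exp (- ((1 - z) * (\<Sum>i<m. \<mu> i \<omega> * K (c i))))) \<partial>M)" .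
  have "(\<integral>\<omega>. z ^ L \<omega> \<partial>M) = enn2real (\<integral>\<^sup>+\<omega>. ennreal (z ^ L \<omega>) \<partial>M)"
  proof (rule integral_eq_nn_integral)
    show "(\<lambda>\<omega>. z ^ L \<omega>) \<in> borel_measurable M"
      unfolding L_def by (rule thinned_count_power_measurable[OF \<tau>0])
  qed (use z in auto)
  also have "\<dots> = (\<integral>\<omega>. exp (- ((1 - z) * (\<Sum>i<m. \<mu> i \<omega> * K (c i)))) \<partial>M)"
    unfolding eq by (rule integral_eq_nn_integral[symmetric]) auto
  finally show ?thesis by (simp add: L_def \<mu>_def)
qed

lemma K_antimono: "a \<le> b \<Longrightarrow> K b \<le> K a"
proof -
  assume ab: "a \<le> b"
  note [measurable] = V_measurable[of 1, simplified]
  show "K b \<le> K a" unfolding K_eq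
    by (rule finite_measure_mono) (use ab in auto)
qed

lemma K_measurable [measurable]: "K \<in> borel_measurable borel"
proof -
  have "mono (\<lambda>u. - K u)" by (intro monoI) (simp add: K_antimono)
  then have "(\<lambda>u. - (- K u)) \<in> borel_measurable borel"
    by (intro borel_measurable_uminus borel_measurable_mono)
  then show ?thesis by simp
qed

text \<open>The offered load: the mean number in system at time \<open>t\<close>, given the intensity.\<close>

definition load :: "real \<Rightarrow> 'w \<Rightarrow> real"
  where "load t \<omega> = (LINT s:{0..t}|lborel. \<Lambda> s \<omega> * K (t - s))"

lemma load_measurable [measurable]: "load t \<in> borel_measurable M"
  unfolding load_def set_lebesgue_integral_def by measurable

lemma load_nonneg: "0 \<le> load t \<omega>"
  unfolding load_def set_lebesgue_integral_def
  by (intro Bochner_Integration.integral_nonneg) (auto simp: \<Lambda>_nonneg K_nonneg)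

lemma C_nonneg: "0 \<le> C"
  using order_trans[OF \<Lambda>_nonneg \<Lambda>_le] .

text \<open>The Riemann type sums at the two ends of each cell enclose the load because \<open>K\<close> decreases.  The mass
  of a cell is at most \<open>C t / m\<close>, and the differences of \<open>K\<close> telescope to at most \<open>1\<close>.\<close>

lemma load_sandwich:
  assumes t: "0 \<le> t" and m: "0 < m" and w: "\<omega> \<in> space M"
  defines "\<tau> \<equiv> \<lambda>i::nat. real i * (t / real m)"
  defines "lower \<equiv> \<Sum>i<m. intensity_mass (\<tau> i) (\<tau> (Suc i)) \<omega> * K (t - \<tau> i)"
  defines "upper \<equiv> \<Sum>i<m. intensity_mass (\<tau> i) (\<tau> (Suc i)) \<omega> * K (t - \<tau> (Suc i))"
  shows "lower \<le> load t \<omega>" "load t \<omega> \<le> upper" "upper - lower \<le> C * t / real m" "0 \<le> lower"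
proof -
  have [measurable]: "(\<lambda>s. \<Lambda> s \<omega>) \<in> borel_measurable borel"
    using measurable_compose[OF measurable_Pair2'[OF w] \<Lambda>_meas] by simp
  have \<tau>S: "\<tau> i \<le> \<tau> (Suc i)" and \<tau>0: "0 \<le> \<tau> i" for i
    using t m by (auto simp: \<tau>_def intro!: mult_right_mono divide_right_mono)
  have \<tau>m: "\<tau> m = t" using m by (simp add: \<tau>_def)
  have \<tau>d: "\<tau> (Suc i) - \<tau> i = t / real m" for i by (simp add: \<tau>_def algebra_simps add_divide_distrib)
  define \<mu> where "\<mu> i = intensity_mass (\<tau> i) (\<tau> (Suc i)) \<omega>" for i
  define J where "J i = (LINT s:{\<tau> i..\<tau> (Suc i)}|lborel. \<Lambda> s \<omega> * K (t - s))" for i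
  have i1: "set_integrable lborel {a..b} (\<lambda>s. \<Lambda> s \<omega>)" for a b
    by (rule set_integrable_bounded[where C=C]) (auto simp: \<Lambda>_nonneg \<Lambda>_le emeasure_lborel_Icc_eq)
  have i2: "set_integrable lborel A (\<lambda>s. \<Lambda> s \<omega> * K (t - s))" if "A \<in> sets borel" "A \<subseteq> {a..b}" for a b A
  proof (rule set_integrable_bounded[where C="C * 1"])
    show "\<bar>\<Lambda> s \<omega> * K (t - s)\<bar> \<le> C * 1" for s
      unfolding abs_mult by (intro mult_mono) (auto simp: \<Lambda>_nonneg \<Lambda>_le K_nonneg K_le_1 C_nonneg)
    have "emeasure lborel A \<le> emeasure lborel {a..b}" using that by (intro emeasure_mono) auto
    also have "\<dots> < \<infinity>" by (auto simp: emeasure_lborel_Icc_eq)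
    finally show "emeasure lborel A < \<infinity>" .
  qed (use that in auto)
  have \<mu>0: "0 \<le> \<mu> i" for i unfolding \<mu>_def by (rule intensity_mass_nonneg)
  have \<mu>C: "\<mu> i \<le> C * (t / real m)" for i
  proof -
    have "\<mu> i \<le> (LINT s:{\<tau> i..\<tau> (Suc i)}|lborel. C)"
      unfolding \<mu>_def intensity_mass_def
      by (intro set_integral_mono i1) (auto simp: set_integrable_def \<Lambda>_le emeasure_lborel_Icc_eq)
    also have "\<dots> = C * (t / real m)"
      using \<tau>S[of i] by (simp add: set_lebesgue_integral_def \<tau>d mult.commute)
    finally show ?thesis .
  qed
  have lo: "\<mu> i * K (t - \<tau> i) \<le> J i" for i
  proof -
    have "\<mu> i * K (t - \<tau> i) = (LINT s:{\<tau> i..\<tau> (Suc i)}|lborel. \<Lambda> s \<omega> * K (t - \<tau> i))"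
      by (simp add: \<mu>_def intensity_mass_def)
    also have "\<dots> \<le> J i" unfolding J_def
      by (intro set_integral_mono i2[OF _ order_refl]) (auto intro!: mult_left_mono K_antimono \<Lambda>_nonneg i1)
    finally show ?thesis .
  qed
  have hi: "J i \<le> \<mu> i * K (t - \<tau> (Suc i))" for i
  proof -
    have "J i \<le> (LINT s:{\<tau> i..\<tau> (Suc i)}|lborel. \<Lambda> s \<omega> * K (t - \<tau> (Suc i)))" unfolding J_def
      by (intro set_integral_mono i2[OF _ order_refl]) (auto intro!: mult_left_mono K_antimono \<Lambda>_nonneg i1)
    also have "\<dots> = \<mu> i * K (t - \<tau> (Suc i))"
      by (simp add: \<mu>_def intensity_mass_def)
    finally show ?thesis .
  qed
  have "(LINT s:{0..\<tau> j}|lborel. \<Lambda> s \<omega> * K (t - s)) = (\<Sum>i<j. J i)" for j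
  proof (induction j)
    case 0
    have "AE s in lborel. indicator {0..\<tau> 0} s *\<^sub>R (\<Lambda> s \<omega> * K (t - s)) = 0"
      using AE_lborel_singleton[of 0] by eventually_elim (auto simp: \<tau>_def indicator_def)
    then show ?case by (simp add: set_lebesgue_integral_def integral_eq_zero_AE)
  next
    case (Suc j)
    have "(LINT s:{0..\<tau> (Suc j)}|lborel. \<Lambda> s \<omega> * K (t - s)) = (LINT s:{0..<\<tau> j} \<union> {\<tau> j..\<tau> (Suc j)}|lborel. \<Lambda> s \<omega> * K (t - s))"
      using \<tau>S[of j] \<tau>0[of j] by (intro arg_cong2[where f="\<lambda>S. set_lebesgue_integral lborel S"]) auto
    also have "\<dots> = (LINT s:{0..<\<tau> j}|lborel. \<Lambda> s \<omega> * K (t - s)) + J j"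
      unfolding J_def by (intro set_integral_Un i2[of "{0..<\<tau> j}" 0 "\<tau> j"] i2[OF _ order_refl]) auto
    also have "(LINT s:{0..<\<tau> j}|lborel. \<Lambda> s \<omega> * K (t - s)) = (LINT s:{0..\<tau> j}|lborel. \<Lambda> s \<omega> * K (t - s))"
      unfolding set_lebesgue_integral_def
      by (intro integral_cong_AE; (measurable; fail)?)
         (use AE_lborel_singleton[of "\<tau> j"] in \<open>eventually_elim, auto simp: indicator_def\<close>)
    finally show ?case by (simp add: Suc.IH)
  qed
  from this[of m] have sum: "load t \<omega> = (\<Sum>i<m. J i)" by (simp add: load_def \<tau>m)
  show "lower \<le> load t \<omega>" unfolding lower_def sum \<mu>_def[symmetric] by (intro sum_mono lo)
  show "load t \<omega> \<le> upper" unfolding upper_def sum \<mu>_def[symmetric] by (intro sum_mono hi)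
  show "0 \<le> lower" unfolding lower_def \<mu>_def[symmetric] by (intro sum_nonneg mult_nonneg_nonneg \<mu>0 K_nonneg)
  have "upper - lower = (\<Sum>i<m. \<mu> i * (K (t - \<tau> (Suc i)) - K (t - \<tau> i)))"
    by (simp add: upper_def lower_def \<mu>_def sum_subtractf right_diff_distrib)
  also have "\<dots> \<le> (\<Sum>i<m. (C * (t / real m)) * (K (t - \<tau> (Suc i)) - K (t - \<tau> i)))"
    by (intro sum_mono mult_right_mono \<mu>C) (use \<tau>S in \<open>auto intro!: K_antimono\<close>)
  also have "\<dots> = (C * (t / real m)) * (K (t - \<tau> m) - K (t - \<tau> 0))"
    unfolding sum_distrib_left[symmetric] by (subst sum_lessThan_telescope) (rule refl)
  also have "\<dots> \<le> (C * (t / real m)) * 1"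
    using K_le_1[of "t - \<tau> m"] K_nonneg[of "t - \<tau> 0"] t C_nonneg by (intro mult_left_mono) auto
  finally show "upper - lower \<le> C * t / real m" by simp
qed

text \<open>A customer of cell \<open>i\<close> arrives after \<open>\<tau> i\<close> and no later than \<open>\<tau> (Suc i)\<close>.  Service longer than
  \<open>t - \<tau> i\<close> is therefore sufficient for being present at time \<open>t\<close>, and service longer than
  \<open>t - \<tau> (Suc i)\<close> is necessary.\<close>

lemma number_in_system_sandwich:
  assumes t: "0 \<le> t" and m: "0 < m" and w: "\<omega> \<in> space M"
  defines "\<tau> \<equiv> \<lambda>i::nat. real i * (t / real m)"
  shows "(\<Sum>i<m. card {n \<in> {N (\<tau> i) \<omega><..N (\<tau> (Suc i)) \<omega>}. t - \<tau> i < V n \<omega>}) \<le> number_in_system N V t \<omega>"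
    "number_in_system N V t \<omega> \<le> (\<Sum>i<m. card {n \<in> {N (\<tau> i) \<omega><..N (\<tau> (Suc i)) \<omega>}. t - \<tau> (Suc i) < V n \<omega>})"
proof -
  define a where "a i = N (\<tau> i) \<omega>" for i
  define B where "B i = {a i<..a (Suc i)}" for i
  have \<tau>_mono: "i \<le> j \<Longrightarrow> \<tau> i \<le> \<tau> j" for i j
    using t by (auto simp: \<tau>_def intro!: mult_right_mono divide_right_mono)
  have \<tau>0: "0 \<le> \<tau> i" for i using t by (simp add: \<tau>_def)
  have \<tau>m: "\<tau> m = t" using m by (simp add: \<tau>_def)
  have a_mono: "mono a"
  proof (rule monoI)
    fix i j :: nat assume "i \<le> j"
    have "mono_on {0..} (\<lambda>t. N t \<omega>)" using N w by (simp add: counting_process_def)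
    from mono_onD[OF this _ _ \<tau>_mono[OF \<open>i \<le> j\<close>]] show "a i \<le> a j" using \<tau>0 by (simp add: a_def)
  qed
  have a0: "a 0 = 0" using N w by (simp add: a_def \<tau>_def counting_process_def)
  let ?I = "in_system N V t \<omega>"
  have U: "?I = (\<Union>i<m. ?I \<inter> B i)"
  proof -
    have "?I \<subseteq> {1..N t \<omega>}" by (rule in_system_subset[OF N w t])
    also have "\<dots> = {0<..a m}" by (auto simp: a_def \<tau>m)
    also have "\<dots> = (\<Union>i<m. B i)" unfolding B_def using blocks_Union[OF a_mono, of m] by (simp add: a0)
    finally show ?thesis by blast
  qed
  have dis: "(?I \<inter> B i) \<inter> (?I \<inter> B j) = {}" if "i \<noteq> j" for i j
    using blocks_disjoint[OF a_mono that] unfolding B_def by blast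
  have "card ?I = card (\<Union>i<m. ?I \<inter> B i)" using U by simp
  also have "\<dots> = (\<Sum>i<m. card (?I \<inter> B i))"
    using dis by (intro card_UN_disjoint) (auto simp: B_def)
  finally have card: "number_in_system N V t \<omega> = (\<Sum>i<m. card (?I \<inter> B i))"
    by (simp add: number_in_system_eq)
  have T: "\<exists>T. arrival_time N n \<omega> = ereal T \<and> \<tau> i < T \<and> T \<le> \<tau> (Suc i)" if n: "n \<in> B i" for n i
  proof -
    have n1: "1 \<le> n" using n by (auto simp: B_def)
    have "\<not> arrival_time N n \<omega> \<le> ereal (\<tau> i)" "arrival_time N n \<omega> \<le> ereal (\<tau> (Suc i))"
      using n arrival_time_le_iff[OF N w n1 \<tau>0] by (auto simp: B_def a_def)
    then show ?thesis by (cases "arrival_time N n \<omega>") auto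
  qed
  show "(\<Sum>i<m. card {n \<in> {N (\<tau> i) \<omega><..N (\<tau> (Suc i)) \<omega>}. t - \<tau> i < V n \<omega>}) \<le> number_in_system N V t \<omega>"
    unfolding card
  proof (rule sum_mono, rule card_mono)
    fix i assume "i \<in> {..<m}"
    then have le: "\<tau> (Suc i) \<le> t" using \<tau>_mono[of "Suc i" m] \<tau>m by simp
    show "{n \<in> {N (\<tau> i) \<omega><..N (\<tau> (Suc i)) \<omega>}. t - \<tau> i < V n \<omega>} \<subseteq> ?I \<inter> B i"
    proof clarify
      fix n assume n: "n \<in> {N (\<tau> i) \<omega><..N (\<tau> (Suc i)) \<omega>}" and V: "t - \<tau> i < V n \<omega>"
      then have nB: "n \<in> B i" by (simp add: B_def a_def)
      from T[OF this] obtain T where "arrival_time N n \<omega> = ereal T" "\<tau> i < T" "T \<le> \<tau> (Suc i)" by blast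
      then show "n \<in> ?I \<inter> B i" using nB V le by (auto simp: in_system_def B_def)
    qed
  qed (simp add: B_def)
  show "number_in_system N V t \<omega> \<le> (\<Sum>i<m. card {n \<in> {N (\<tau> i) \<omega><..N (\<tau> (Suc i)) \<omega>}. t - \<tau> (Suc i) < V n \<omega>})"
    unfolding card
  proof (rule sum_mono, rule card_mono)
    fix i
    show "?I \<inter> B i \<subseteq> {n \<in> {N (\<tau> i) \<omega><..N (\<tau> (Suc i)) \<omega>}. t - \<tau> (Suc i) < V n \<omega>}"
    proof
      fix n assume n: "n \<in> ?I \<inter> B i"
      then obtain T where "arrival_time N n \<omega> = ereal T" "\<tau> i < T" "T \<le> \<tau> (Suc i)" using T by blast
      then show "n \<in> {n \<in> {N (\<tau> i) \<omega><..N (\<tau> (Suc i)) \<omega>}. t - \<tau> (Suc i) < V n \<omega>}"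
        using n by (auto simp: in_system_def B_def a_def)
    qed
  qed simp
qed

lemma number_in_system_random_variable: "0 \<le> t \<Longrightarrow> number_in_system N V t \<in> M \<rightarrow>\<^sub>M count_space UNIV"
  by (rule number_in_system_measurable[OF N _ V_measurable])

text \<open>For \<open>z\<close> in the unit interval, \<open>z\<close> to the number in system lies between the corresponding powers for
  the two thinned counts, whose means differ by at most \<open>C t / m\<close>.\<close>

lemma number_in_system_pgf:
  assumes t: "0 \<le> t" and z: "0 \<le> z" "z \<le> 1"
  shows "(\<integral>\<omega>. z ^ number_in_system N V t \<omega> \<partial>M) = (\<integral>\<omega>. exp (- ((1 - z) * load t \<omega>)) \<partial>M)"
proof -
  let ?Q = "number_in_system N V t"
  have [measurable]: "?Q \<in> M \<rightarrow>\<^sub>M count_space UNIV" by (rule number_in_system_random_variable[OF t])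
  have iQ: "integrable M (\<lambda>\<omega>. z ^ ?Q \<omega>)"
    by (rule integrable_const_bound[where B=1]) (use z in \<open>auto simp: power_le_one\<close>)
  have ie: "integrable M (\<lambda>\<omega>. exp (- ((1 - z) * g \<omega>)))"
    if [measurable]: "g \<in> borel_measurable M" and "\<And>\<omega>. \<omega> \<in> space M \<Longrightarrow> 0 \<le> g \<omega>" for g
    by (rule integrable_const_bound[where B=1]) (use z that(2) in auto)
  have bound: "\<bar>(\<integral>\<omega>. z ^ ?Q \<omega> \<partial>M) - (\<integral>\<omega>. exp (- ((1 - z) * load t \<omega>)) \<partial>M)\<bar> \<le> C * t / real m" if m: "0 < m" for m
  proof -
    define \<tau> where "\<tau> i = real i * (t / real m)" for i :: nat
    have \<tau>: "\<tau> 0 = 0" "mono \<tau>" using t by (auto simp: \<tau>_def intro!: monoI mult_right_mono divide_right_mono)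
    have \<tau>0: "0 \<le> \<tau> i" for i using t by (simp add: \<tau>_def)
    have \<tau>m: "i < m \<Longrightarrow> \<tau> (Suc i) \<le> t" for i using monoD[OF \<tau>(2), of "Suc i" m] m by (simp add: \<tau>_def)
    define lower where "lower \<omega> = (\<Sum>i<m. intensity_mass (\<tau> i) (\<tau> (Suc i)) \<omega> * K (t - \<tau> i))" for \<omega>
    define upper where "upper \<omega> = (\<Sum>i<m. intensity_mass (\<tau> i) (\<tau> (Suc i)) \<omega> * K (t - \<tau> (Suc i)))" for \<omega>
    have [measurable]: "lower \<in> borel_measurable M" "upper \<in> borel_measurable M"
      unfolding lower_def upper_def by measurable
    define L where "L \<omega> = (\<Sum>i<m. card {n \<in> {N (\<tau> i) \<omega><..N (\<tau> (Suc i)) \<omega>}. t - \<tau> i < V n \<omega>})" for \<omega>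
    define U where "U \<omega> = (\<Sum>i<m. card {n \<in> {N (\<tau> i) \<omega><..N (\<tau> (Suc i)) \<omega>}. t - \<tau> (Suc i) < V n \<omega>})" for \<omega>
    have ls: "lower \<omega> \<le> load t \<omega>" "load t \<omega> \<le> upper \<omega>" "upper \<omega> - lower \<omega> \<le> C * t / real m" "0 \<le> lower \<omega>"
      if "\<omega> \<in> space M" for \<omega>
      using load_sandwich[OF t m that] unfolding lower_def upper_def \<tau>_def by auto
    have EL: "(\<integral>\<omega>. z ^ L \<omega> \<partial>M) = (\<integral>\<omega>. exp (- ((1 - z) * lower \<omega>)) \<partial>M)"
      unfolding L_def lower_def by (rule thinned_count_pgf[OF \<tau> z])
    have EU: "(\<integral>\<omega>. z ^ U \<omega> \<partial>M) = (\<integral>\<omega>. exp (- ((1 - z) * upper \<omega>)) \<partial>M)"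
      unfolding U_def upper_def by (rule thinned_count_pgf[OF \<tau> z])
    have zp: "(\<lambda>\<omega>. z ^ (\<Sum>i<m. card {n \<in> {N (\<tau> i) \<omega><..N (\<tau> (Suc i)) \<omega>}. c i < V n \<omega>})) \<in> borel_measurable M" for c
      by (rule thinned_count_power_measurable[OF \<tau>0])
    have iL: "integrable M (\<lambda>\<omega>. z ^ L \<omega>)" and iU: "integrable M (\<lambda>\<omega>. z ^ U \<omega>)"
      unfolding L_def U_def by (rule integrable_const_bound[where B=1], use z in \<open>simp add: power_le_one\<close>, rule zp)+
    have QL: "(\<integral>\<omega>. z ^ ?Q \<omega> \<partial>M) \<le> (\<integral>\<omega>. exp (- ((1 - z) * lower \<omega>)) \<partial>M)"
      unfolding EL[symmetric]
      by (rule integral_mono[OF iQ iL])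
         (use z number_in_system_sandwich(1)[OF t m] in \<open>auto simp: L_def \<tau>_def intro!: power_decreasing\<close>)
    have QU: "(\<integral>\<omega>. exp (- ((1 - z) * upper \<omega>)) \<partial>M) \<le> (\<integral>\<omega>. z ^ ?Q \<omega> \<partial>M)"
      unfolding EU[symmetric]
      by (rule integral_mono[OF iU iQ])
         (use z number_in_system_sandwich(2)[OF t m] in \<open>auto simp: U_def \<tau>_def intro!: power_decreasing\<close>)
    have il: "integrable M (\<lambda>\<omega>. exp (- ((1 - z) * lower \<omega>)))"
      by (rule ie) (use ls in auto)
    have iu: "integrable M (\<lambda>\<omega>. exp (- ((1 - z) * upper \<omega>)))"
    proof (rule ie)
      show "0 \<le> upper \<omega>" if "\<omega> \<in> space M" for \<omega> using ls[OF that] by linarith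
    qed measurable
    have i0: "integrable M (\<lambda>\<omega>. exp (- ((1 - z) * load t \<omega>)))"
      by (rule ie) (use load_nonneg in auto)
    have 1: "(\<integral>\<omega>. exp (- ((1 - z) * load t \<omega>)) \<partial>M) \<le> (\<integral>\<omega>. exp (- ((1 - z) * lower \<omega>)) \<partial>M)"
      by (rule integral_mono[OF i0 il]) (use ls z in \<open>auto intro!: mult_left_mono\<close>)
    have 2: "(\<integral>\<omega>. exp (- ((1 - z) * upper \<omega>)) \<partial>M) \<le> (\<integral>\<omega>. exp (- ((1 - z) * load t \<omega>)) \<partial>M)"
      by (rule integral_mono[OF iu i0]) (use ls z in \<open>auto intro!: mult_left_mono\<close>)
    have "(\<integral>\<omega>. exp (- ((1 - z) * lower \<omega>)) \<partial>M) - (\<integral>\<omega>. exp (- ((1 - z) * upper \<omega>)) \<partial>M)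
      = (\<integral>\<omega>. exp (- ((1 - z) * lower \<omega>)) - exp (- ((1 - z) * upper \<omega>)) \<partial>M)"
      by (rule Bochner_Integration.integral_diff[OF il iu, symmetric])
    also have "\<dots> \<le> (\<integral>\<omega>. C * t / real m \<partial>M)"
    proof (rule integral_mono)
      fix \<omega> assume w: "\<omega> \<in> space M"
      have "exp (- ((1 - z) * lower \<omega>)) - exp (- ((1 - z) * upper \<omega>)) \<le> (1 - z) * upper \<omega> - (1 - z) * lower \<omega>"
        using ls[OF w] z by (intro exp_neg_diff_le mult_left_mono mult_nonneg_nonneg) auto
      also have "\<dots> = (1 - z) * (upper \<omega> - lower \<omega>)" by (simp add: right_diff_distrib)
      also have "\<dots> \<le> 1 * (C * t / real m)"
        using ls[OF w] z by (intro mult_mono) auto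
      finally show "exp (- ((1 - z) * lower \<omega>)) - exp (- ((1 - z) * upper \<omega>)) \<le> C * t / real m" by simp
    qed (use il iu in auto)
    also have "\<dots> = C * t / real m" by (simp add: prob_space)
    finally show ?thesis using QL QU 1 2 by linarith
  qed
  have "(\<lambda>m. C * t / real m) \<longlonglongrightarrow> 0" by (rule lim_const_over_n)
  then have "\<bar>(\<integral>\<omega>. z ^ ?Q \<omega> \<partial>M) - (\<integral>\<omega>. exp (- ((1 - z) * load t \<omega>)) \<partial>M)\<bar> \<le> 0"
    by (rule LIMSEQ_le_const) (use bound in \<open>auto intro!: exI[of _ 1]\<close>)
  then show ?thesis by simp
qed

text \<open>The mixed Poisson law has the generating function just computed, and generating functions determine
  the law.\<close>

theorem number_in_system_mass:
  assumes t: "0 \<le> t"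
  shows "prob {\<omega> \<in> space M. number_in_system N V t \<omega> = k} = (\<integral>\<omega>. poisson_mass (load t \<omega>) k \<partial>M)"
proof -
  let ?Q = "number_in_system N V t"
  have [measurable]: "?Q \<in> M \<rightarrow>\<^sub>M count_space UNIV" by (rule number_in_system_random_variable[OF t])
  have [measurable]: "(\<lambda>\<omega>. poisson_mass (load t \<omega>) k) \<in> borel_measurable M" for k
    unfolding poisson_mass_def by measurable
  define c where "c k = prob {\<omega> \<in> space M. ?Q \<omega> = k} - (\<integral>\<omega>. poisson_mass (load t \<omega>) k \<partial>M)" for k
  have p1: "\<bar>poisson_mass (load t \<omega>) k\<bar> \<le> 1" for \<omega> k
    using poisson_mass_nonneg[OF load_nonneg] poisson_mass_le_1[OF load_nonneg] by simp
  have "c k = 0"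
  proof (rule powser_unique[where B=2])
    fix k
    have "\<bar>\<integral>\<omega>. poisson_mass (load t \<omega>) k \<partial>M\<bar> \<le> (\<integral>\<omega>. \<bar>poisson_mass (load t \<omega>) k\<bar> \<partial>M)"
      by (rule integral_abs_bound)
    also have "\<dots> \<le> (\<integral>\<omega>. 1 \<partial>M)" by (rule integral_mono') (use p1 in auto)
    finally have "\<bar>\<integral>\<omega>. poisson_mass (load t \<omega>) k \<partial>M\<bar> \<le> 1" by (simp add: prob_space)
    moreover have "\<bar>prob {\<omega> \<in> space M. ?Q \<omega> = k}\<bar> \<le> 1" by simp
    ultimately show "\<bar>c k\<bar> \<le> 2" unfolding c_def by linarith
  next
    fix z :: real assume z: "0 < z" "z < 1"
    have "(\<lambda>k. (\<integral>\<omega>. indicator {k} (?Q \<omega>) \<partial>M) * z ^ k) sums (\<integral>\<omega>. (\<Sum>k. indicator {k} (?Q \<omega>) * z ^ k) \<partial>M)"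
    proof (rule expectation_powser[OF _ _ z])
      show "(\<lambda>\<omega>. indicator {k} (?Q \<omega>) :: real) \<in> borel_measurable M" for k
        by (rule measurable_compose[where g="indicator {k}" and f="?Q" and N="count_space UNIV"]) auto
    qed (auto simp: indicator_def)
    moreover have "(\<integral>\<omega>. indicator {k} (?Q \<omega>) \<partial>M) = prob {\<omega> \<in> space M. ?Q \<omega> = k}" for k
    proof -
      have "(\<integral>\<omega>. indicator {k} (?Q \<omega>) \<partial>M) = (\<integral>\<omega>. indicator {\<omega> \<in> space M. ?Q \<omega> = k} \<omega> \<partial>M :: real)"
        by (intro Bochner_Integration.integral_cong) (auto simp: indicator_def)
      then show ?thesis by simp
    qed
    moreover have "(\<Sum>k. indicator {k} (?Q \<omega>) * z ^ k) = z ^ ?Q \<omega>" for \<omega>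
    proof -
      have "(\<Sum>k. indicator {k} (?Q \<omega>) * z ^ k) = (\<Sum>k\<in>{?Q \<omega>}. indicator {k} (?Q \<omega>) * z ^ k)"
        by (rule suminf_finite) auto
      then show ?thesis by simp
    qed
    ultimately have 1: "(\<lambda>k. prob {\<omega> \<in> space M. ?Q \<omega> = k} * z ^ k) sums (\<integral>\<omega>. z ^ ?Q \<omega> \<partial>M)"
      by simp
    have "(\<lambda>k. (\<integral>\<omega>. poisson_mass (load t \<omega>) k \<partial>M) * z ^ k) sums (\<integral>\<omega>. (\<Sum>k. poisson_mass (load t \<omega>) k * z ^ k) \<partial>M)"
      by (rule expectation_powser[OF _ p1 z]) measurable
    also have "(\<lambda>\<omega>. \<Sum>k. poisson_mass (load t \<omega>) k * z ^ k) = (\<lambda>\<omega>. exp (- ((1 - z) * load t \<omega>)))"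
    proof
      fix \<omega>
      show "(\<Sum>k. poisson_mass (load t \<omega>) k * z ^ k) = exp (- ((1 - z) * load t \<omega>))"
        unfolding sums_unique[OF poisson_mass_sums, symmetric] by (simp add: mult.commute)
    qed
    finally have 2: "(\<lambda>k. (\<integral>\<omega>. poisson_mass (load t \<omega>) k \<partial>M) * z ^ k) sums (\<integral>\<omega>. z ^ ?Q \<omega> \<partial>M)"
      using number_in_system_pgf[OF t, of z] z by simp
    show "(\<lambda>k. c k * z ^ k) sums 0"
      using sums_diff[OF 1 2] by (simp add: c_def left_diff_distrib)
  qed
  then show ?thesis by (simp add: c_def)
qed

end

section \<open>Expansion of the mean Poisson mass\<close>

context ergodic_modulation begin

text \<open>Taylor expansion of the Poisson mass around the averaged load.  Divided by \<open>\<epsilon>\<close>, the remainder is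
  at most \<open>2 (\<delta> e\<^sub>2 + e\<^sub>4 / \<delta>)\<close> for every \<open>\<delta> > 0\<close>, where \<open>e\<^sub>2\<close> and \<open>e\<^sub>4\<close> are the moments divided by \<open>\<epsilon>\<close>.\<close>

theorem expectation_poisson_mass_expansion:
  assumes k: "\<And>u. isCont k u" and k1: "\<And>u. \<bar>k u\<bar> \<le> 1" and t: "0 < t" and m: "0 < m"
    and pos: "\<And>\<epsilon> \<omega>. 0 < \<epsilon> \<Longrightarrow> \<omega> \<in> space M \<Longrightarrow> 0 \<le> m + fluctuation k \<epsilon> t \<omega>"
  shows "((\<lambda>\<epsilon>. ((\<integral>\<omega>. poisson_mass (m + fluctuation k \<epsilon> t \<omega>) j \<partial>P x) - poisson_mass m j) / \<epsilon>) \<longlongrightarrow>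
     poisson_mass m j * ((real j / m - 1) * (potential P X \<pi> f x * k 0)
       + 1 / 2 * (1 - 2 * real j / m + real j * (real j - 1) / m\<^sup>2) * (sigma_sq P X \<pi> f * (LINT u:{0..t}|lborel. (k u)\<^sup>2)))) (at_right 0)"
proof -
  interpret Px: prob_space "P x" by (rule prob_space_P)
  have km [measurable]: "k \<in> borel_measurable borel"
    by (intro borel_measurable_continuous_onI continuous_at_imp_continuous_on) (auto simp: k)
  define e1 where "e1 \<epsilon> = (\<integral>\<omega>. fluctuation k \<epsilon> t \<omega> \<partial>P x) / \<epsilon>" for \<epsilon>
  define e2 where "e2 \<epsilon> = (\<integral>\<omega>. (fluctuation k \<epsilon> t \<omega>)\<^sup>2 \<partial>P x) / \<epsilon>" for \<epsilon>
  define e4 where "e4 \<epsilon> = (\<integral>\<omega>. fluctuation k \<epsilon> t \<omega> ^ 4 \<partial>P x) / \<epsilon>" for \<epsilon>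
  define L2 where "L2 = sigma_sq P X \<pi> f * (LINT u:{0..t}|lborel. (k u)\<^sup>2)"
  have t0: "0 \<le> t" by (rule less_imp_le[OF t])
  have l1: "(e1 \<longlongrightarrow> potential P X \<pi> f x * k 0) (at_right 0)"
    unfolding e1_def by (rule first_moment_limit[OF k k1 t])
  have l2: "(e2 \<longlongrightarrow> L2) (at_right 0)"
    unfolding e2_def L2_def by (rule second_moment_limit[OF k k1 t0])
  have l4: "(e4 \<longlongrightarrow> 0) (at_right 0)"
    unfolding e4_def by (rule fourth_moment_limit[OF km k1 t0])
  define G where "G \<epsilon> = ((\<integral>\<omega>. poisson_mass (m + fluctuation k \<epsilon> t \<omega>) j \<partial>P x) - poisson_mass m j) / \<epsilon>" for \<epsilon>
  define H where "H \<epsilon> = poisson_mass_deriv 1 j m * e1 \<epsilon> + poisson_mass_deriv 2 j m / 2 * e2 \<epsilon>" for \<epsilon>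
  \<comment> \<open>Tends to \<open>0\<close>, but slowly enough for \<open>e4 / \<delta> \<le> \<delta>\<close>; the summand \<open>\<epsilon>\<close> keeps it positive.\<close>
  define \<delta> where "\<delta> \<epsilon> = sqrt (e4 \<epsilon> + \<epsilon>)" for \<epsilon>
  have bound: "norm (G \<epsilon> - H \<epsilon>) \<le> 2 * (\<delta> \<epsilon> * (e2 \<epsilon> + 1))" if \<epsilon>: "0 < \<epsilon>" for \<epsilon>
  proof -
    have e40: "0 \<le> e4 \<epsilon>" using \<epsilon> by (simp add: e4_def)
    have \<delta>0: "0 < \<delta> \<epsilon>" using e40 \<epsilon> by (simp add: \<delta>_def)
    have eqs: "(\<integral>\<omega>. poisson_mass (m + fluctuation k \<epsilon> t \<omega>) j \<partial>P x) = poisson_mass m j + \<epsilon> * G \<epsilon>"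
      "(\<integral>\<omega>. fluctuation k \<epsilon> t \<omega> \<partial>P x) = \<epsilon> * e1 \<epsilon>" "(\<integral>\<omega>. (fluctuation k \<epsilon> t \<omega>)\<^sup>2 \<partial>P x) = \<epsilon> * e2 \<epsilon>"
      "(\<integral>\<omega>. fluctuation k \<epsilon> t \<omega> ^ 4 \<partial>P x) = \<epsilon> * e4 \<epsilon>"
      using \<epsilon> by (simp_all add: G_def e1_def e2_def e4_def)
    have "\<bar>(\<integral>\<omega>. poisson_mass (m + fluctuation k \<epsilon> t \<omega>) j \<partial>P x) - (poisson_mass m j + poisson_mass_deriv 1 j m * (\<integral>\<omega>. fluctuation k \<epsilon> t \<omega> \<partial>P x)
      + poisson_mass_deriv 2 j m / 2 * (\<integral>\<omega>. (fluctuation k \<epsilon> t \<omega>)\<^sup>2 \<partial>P x))\<bar>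
      \<le> 2 * (\<delta> \<epsilon> * (\<integral>\<omega>. (fluctuation k \<epsilon> t \<omega>)\<^sup>2 \<partial>P x) + (\<integral>\<omega>. fluctuation k \<epsilon> t \<omega> ^ 4 \<partial>P x) / \<delta> \<epsilon>)"
      by (rule Px.expectation_poisson_mass_bound[where B="C * t"])
         (use fluctuation_bound[OF k1 t0] m pos[OF \<epsilon>] \<delta>0 in \<open>auto simp: space_P\<close>)
    then have "\<bar>poisson_mass m j + \<epsilon> * G \<epsilon> - (poisson_mass m j + poisson_mass_deriv 1 j m * (\<epsilon> * e1 \<epsilon>) + poisson_mass_deriv 2 j m / 2 * (\<epsilon> * e2 \<epsilon>))\<bar>
      \<le> 2 * (\<delta> \<epsilon> * (\<epsilon> * e2 \<epsilon>) + \<epsilon> * e4 \<epsilon> / \<delta> \<epsilon>)"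
      unfolding eqs .
    moreover have "poisson_mass m j + \<epsilon> * G \<epsilon> - (poisson_mass m j + poisson_mass_deriv 1 j m * (\<epsilon> * e1 \<epsilon>) + poisson_mass_deriv 2 j m / 2 * (\<epsilon> * e2 \<epsilon>))
      = \<epsilon> * (G \<epsilon> - H \<epsilon>)"
      unfolding H_def by (simp add: algebra_simps del: poisson_mass_deriv.simps One_nat_def)
    ultimately have "\<bar>\<epsilon> * (G \<epsilon> - H \<epsilon>)\<bar> \<le> 2 * (\<delta> \<epsilon> * (\<epsilon> * e2 \<epsilon>) + \<epsilon> * e4 \<epsilon> / \<delta> \<epsilon>)"
      by (simp only:)
    then have "\<bar>\<epsilon> * (G \<epsilon> - H \<epsilon>)\<bar> \<le> \<epsilon> * (2 * (\<delta> \<epsilon> * e2 \<epsilon> + e4 \<epsilon> / \<delta> \<epsilon>))"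
      by (simp add: algebra_simps)
    then have "\<bar>G \<epsilon> - H \<epsilon>\<bar> \<le> 2 * (\<delta> \<epsilon> * e2 \<epsilon> + e4 \<epsilon> / \<delta> \<epsilon>)"
      using \<epsilon> by (simp add: abs_mult)
    also have "e4 \<epsilon> / \<delta> \<epsilon> \<le> \<delta> \<epsilon>"
    proof -
      have "e4 \<epsilon> \<le> \<delta> \<epsilon> * \<delta> \<epsilon>" using e40 \<epsilon> by (simp add: \<delta>_def)
      then show ?thesis using \<delta>0 by (simp add: divide_le_eq)
    qed
    finally show ?thesis by (simp add: algebra_simps)
  qed
  have "(\<delta> \<longlongrightarrow> sqrt (0 + 0)) (at_right 0)"
    unfolding \<delta>_def by (intro tendsto_intros l4)
  then have "((\<lambda>\<epsilon>. 2 * (\<delta> \<epsilon> * (e2 \<epsilon> + 1))) \<longlongrightarrow> 2 * (sqrt (0 + 0) * (L2 + 1))) (at_right 0)"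
    by (intro tendsto_intros l2)
  then have "((\<lambda>\<epsilon>. 2 * (\<delta> \<epsilon> * (e2 \<epsilon> + 1))) \<longlongrightarrow> 0) (at_right 0)" by simp
  then have "((\<lambda>\<epsilon>. G \<epsilon> - H \<epsilon>) \<longlongrightarrow> 0) (at_right 0)"
    by (rule Lim_null_comparison[rotated]) (use bound in \<open>auto simp: eventually_at_right_field intro!: exI[of _ 1]\<close>)
  moreover have "(H \<longlongrightarrow> poisson_mass_deriv 1 j m * (potential P X \<pi> f x * k 0) + poisson_mass_deriv 2 j m / 2 * L2) (at_right 0)"
    unfolding H_def by (intro tendsto_intros l1 l2) auto
  ultimately have "((\<lambda>\<epsilon>. (G \<epsilon> - H \<epsilon>) + H \<epsilon>) \<longlongrightarrow> 0 + (poisson_mass_deriv 1 j m * (potential P X \<pi> f x * k 0) + poisson_mass_deriv 2 j m / 2 * L2)) (at_right 0)"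
    by (rule tendsto_add)
  then have "(G \<longlongrightarrow> 0 + (poisson_mass_deriv 1 j m * (potential P X \<pi> f x * k 0) + poisson_mass_deriv 2 j m / 2 * L2)) (at_right 0)"
    by (simp only: diff_add_cancel)
  moreover have "0 + (poisson_mass_deriv 1 j m * (potential P X \<pi> f x * k 0) + poisson_mass_deriv 2 j m / 2 * L2) =
     poisson_mass m j * ((real j / m - 1) * (potential P X \<pi> f x * k 0)
       + 1 / 2 * (1 - 2 * real j / m + real j * (real j - 1) / m\<^sup>2) * L2)"
  proof -
    have "0 + (p * a * b + p * c / 2 * l) = p * (a * b + 1 / 2 * c * l)" for p a b c l :: real
      by (simp add: algebra_simps)
    then show ?thesis unfolding poisson_mass_first_deriv[OF m] poisson_mass_second_deriv[OF m] .
  qed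
  ultimately show ?thesis unfolding G_def L2_def by (simp only:)
qed

end

section \<open>Service times with a density\<close>

text \<open>The tail depends on the density only, so it is the same under \<open>M\<close> and under all \<open>P x\<close>.\<close>

lemma service_tail_density:
  assumes prob: "prob_space M" and S: "service_times M V \<kappa>" and n: "1 \<le> n"
  shows "measure M {\<omega> \<in> space M. u < V n \<omega>} = measure (density lborel (\<lambda>u. ennreal (\<kappa> u) * indicator {0..} u)) {u<..}"
proof -
  interpret prob_space M by (rule prob)
  have D: "distributed M lborel (V n) (\<lambda>u. ennreal (\<kappa> u) * indicator {0..} u)"
    using S n by (simp add: service_times_def)
  then have [measurable]: "V n \<in> M \<rightarrow>\<^sub>M lborel" by (rule distributed_measurable)
  have "measure (density lborel (\<lambda>u. ennreal (\<kappa> u) * indicator {0..} u)) {u<..} = measure (distr M lborel (V n)) {u<..}"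
    by (simp only: distributed_distr_eq_density[OF D])
  also have "\<dots> = measure M (V n -` {u<..} \<inter> space M)"
    by (rule measure_distr) measurable
  also have "V n -` {u<..} \<inter> space M = {\<omega> \<in> space M. u < V n \<omega>}" by auto
  finally show ?thesis by simp
qed

context
  fixes M :: "'w measure" and V :: "nat \<Rightarrow> 'w \<Rightarrow> real" and \<kappa> :: "real \<Rightarrow> real"
  assumes prob: "prob_space M" and S: "service_times M V \<kappa>"
    and \<kappa>: "\<And>u. 0 \<le> u \<Longrightarrow> 0 \<le> \<kappa> u"
begin

text \<open>A law with a density has no atoms; hence the tail is continuous everywhere and equals \<open>1\<close> at \<open>0\<close>.\<close>

lemma service_density_integrable: "integrable lborel (\<lambda>u. indicator {0..} u * \<kappa> u)"
  and service_tail_eq: "0 \<le> u \<Longrightarrow> service_tail M V u = 1 - (LINT r:{0..u}|lborel. indicator {0..} r * \<kappa> r)"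
  and isCont_service_tail: "isCont (service_tail M V) s"
  and service_tail_0: "service_tail M V 0 = 1"
proof -
  interpret prob_space M by (rule prob)
  define D where "D = density lborel (\<lambda>u. ennreal (\<kappa> u) * indicator {0..} u)"
  define p where "p = (\<lambda>u. indicator {0..} u * \<kappa> u)"
  have D: "distributed M lborel (V 1) (\<lambda>u. ennreal (\<kappa> u) * indicator {0..} u)"
    using S by (simp add: service_times_def)
  have V1: "V 1 \<in> M \<rightarrow>\<^sub>M lborel" by (rule distributed_measurable[OF D])
  have pD: "prob_space D" unfolding D_def distributed_distr_eq_density[OF D, symmetric]
    by (rule prob_space_distr[OF V1])
  interpret D: prob_space D by (rule pD)
  have p0: "0 \<le> p u" for u using \<kappa> by (simp add: p_def indicator_def)
  have pe: "(\<lambda>u. ennreal (\<kappa> u) * indicator {0..} u) = (\<lambda>u. ennreal (p u))"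
    by (auto simp: p_def indicator_def)
  have [measurable]: "(\<lambda>u. ennreal (p u)) \<in> borel_measurable borel"
    using distributed_borel_measurable[OF D] unfolding pe by simp
  have "(\<lambda>u. enn2real (ennreal (p u))) \<in> borel_measurable borel" by measurable
  then have [measurable]: "p \<in> borel_measurable borel" using p0 by simp
  have "(\<integral>\<^sup>+u. ennreal (p u) \<partial>lborel) = 1"
    using D.emeasure_space_1 by (simp add: D_def pe emeasure_density)
  then have p: "integrable lborel p" by (intro integrableI_nonneg) (auto simp: p0)
  then show "integrable lborel (\<lambda>u. indicator {0..} u * \<kappa> u)" unfolding p_def .
  interpret DR: real_distribution D
    by (intro real_distribution.intro pD real_distribution_axioms.intro) (simp_all add: D_def)
  have tail: "service_tail M V = (\<lambda>u. 1 - cdf D u)"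
  proof
    fix u
    have "service_tail M V u = D.prob {u<..}"
      unfolding service_tail_def service_tail_density[OF prob S order_refl] D_def ..
    also have "{u<..} = space D - {..u}" by (auto simp: D_def)
    also have "D.prob \<dots> = 1 - D.prob {..u}"
      by (intro D.prob_compl) (simp add: D_def)
    finally show "service_tail M V u = 1 - cdf D u" by (simp add: cdf_def)
  qed
  have mD: "D.prob A = (\<integral>u. indicator A u * p u \<partial>lborel)" if [measurable]: "A \<in> sets borel" for A
  proof -
    have i: "integrable lborel (\<lambda>u. indicator A u * p u)"
      using integrable_mult_indicator[OF _ p, of A] by simp
    have "emeasure D A = (\<integral>\<^sup>+u. ennreal (indicator A u * p u) \<partial>lborel)"
      unfolding D_def pe by (subst emeasure_density) (auto intro!: nn_integral_cong simp: indicator_def)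
    also have "\<dots> = ennreal (\<integral>u. indicator A u * p u \<partial>lborel)"
      by (rule nn_integral_eq_integral[OF i]) (simp add: p0)
    finally show ?thesis by (simp add: measure_def p0 integral_nonneg_AE)
  qed
  have atom: "D.prob {s} = 0" for s
  proof -
    have "(\<integral>u. indicator {s} u * p u \<partial>lborel) = 0"
      by (rule integral_eq_zero_AE) (use AE_lborel_singleton[of s] in \<open>eventually_elim, auto\<close>)
    then show ?thesis by (simp add: mD)
  qed
  show "isCont (service_tail M V) s"
    unfolding tail using DR.isCont_cdf[of s] atom[of s] by (intro continuous_intros) simp
  have cdf: "cdf D u = (LINT r:{0..u}|lborel. indicator {0..} r * \<kappa> r)" for u
    unfolding cdf_def mD[of "{..u}", simplified] set_lebesgue_integral_def
    by (intro Bochner_Integration.integral_cong) (auto simp: p_def indicator_def)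
  then show "service_tail M V u = 1 - (LINT r:{0..u}|lborel. indicator {0..} r * \<kappa> r)"
    by (simp add: tail)
  have "cdf D 0 = 0"
  proof -
    have "(\<integral>u. indicator {..0} u * p u \<partial>lborel) = 0"
      by (rule integral_eq_zero_AE) (use AE_lborel_singleton[of 0] in \<open>eventually_elim, auto simp: p_def indicator_def\<close>)
    then show ?thesis by (simp add: cdf_def mD)
  qed
  then show "service_tail M V 0 = 1" by (simp add: tail)
qed

lemma eta_sq_eq:
  assumes t: "0 \<le> t"
  shows "eta_sq \<sigma>2 (service_tail M V) \<kappa> t = \<sigma>2 * (LINT u:{0..t}|lborel. (service_tail M V (t - u))\<^sup>2)"
proof -
  let ?K = "service_tail M V"
  have "(LINT u:{0..t}|lborel. (?K (t - u))\<^sup>2) = (LINT u:{0..t}|lborel. (?K u)\<^sup>2)"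
  proof -
    have "(LINT u:{0..t}|lborel. (?K u)\<^sup>2) = \<bar>- 1\<bar> *\<^sub>R (\<integral>u. indicator {0..t} (t + - 1 * u) *\<^sub>R (?K (t + - 1 * u))\<^sup>2 \<partial>lborel)"
      unfolding set_lebesgue_integral_def by (rule lborel_integral_real_affine) simp
    also have "\<dots> = (LINT u:{0..t}|lborel. (?K (t - u))\<^sup>2)"
      unfolding set_lebesgue_integral_def by (auto intro!: Bochner_Integration.integral_cong simp: indicator_def)
    finally show ?thesis by simp
  qed
  also have "\<dots> = 2 * (LINT s:{0..t}|lborel. ?K s * (indicator {0..} s * \<kappa> s) * s) + t * (?K t)\<^sup>2"
    by (rule integral_square_tail[OF service_density_integrable t]) (simp add: service_tail_eq)
  also have "(LINT s:{0..t}|lborel. ?K s * (indicator {0..} s * \<kappa> s) * s) = (LINT s:{0..t}|lborel. ?K s * \<kappa> s * s)"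
    by (intro set_lebesgue_integral_cong) auto
  finally show ?thesis by (simp add: eta_sq_def algebra_simps)
qed

text \<open>The tail starts at \<open>1\<close> and is continuous, so it exceeds \<open>1 / 2\<close> near \<open>0\<close>.\<close>

lemma integral_service_tail_pos:
  assumes t: "0 < t"
  shows "0 < (LINT s:{0..t}|lborel. service_tail M V (t - s))"
proof -
  let ?K = "service_tail M V"
  have K01: "0 \<le> ?K u" "?K u \<le> 1" for u
    using prob_space.prob_le_1[OF prob] by (simp_all add: service_tail_def)
  have Km [measurable]: "?K \<in> borel_measurable borel"
    by (intro borel_measurable_continuous_onI continuous_at_imp_continuous_on) (auto simp: isCont_service_tail)
  have "(?K \<longlongrightarrow> 1) (at 0)" using isCont_service_tail[of 0] by (simp add: isCont_def service_tail_0)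
  then have "\<forall>\<^sub>F u in at 0. 1 / 2 < ?K u" by (rule order_tendstoD) simp
  then obtain \<delta> where \<delta>: "0 < \<delta>" "\<And>u. u \<noteq> 0 \<Longrightarrow> \<bar>u\<bar> < \<delta> \<Longrightarrow> 1 / 2 < ?K u"
    by (auto simp: eventually_at dist_real_def)
  define a where "a = min (\<delta> / 2) t"
  have a: "0 < a" "a \<le> t" "a < \<delta>" using \<delta>(1) t by (auto simp: a_def min_def)
  have "0 < a * (1 / 2)" using a by simp
  also have "\<dots> = (\<integral>s. indicator {t - a..t} s * (1 / 2) \<partial>lborel)" using a by simp
  also have "\<dots> \<le> (\<integral>s. indicator {0..t} s * ?K (t - s) \<partial>lborel)"
  proof (rule integral_mono')
    have "set_integrable lborel {0..t} (\<lambda>s. ?K (t - s))"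
      by (rule set_integrable_bounded[where C=1]) (auto simp: K01 emeasure_lborel_Icc_eq)
    then show "integrable lborel (\<lambda>s. indicator {0..t} s * ?K (t - s))" by (simp add: set_integrable_def)
    fix s
    show "indicator {t - a..t} s * (1 / 2) \<le> indicator {0..t} s * ?K (t - s)"
    proof (cases "s \<in> {t - a..t}")
      case True
      then have "s \<in> {0..t}" using a by auto
      moreover have "1 / 2 \<le> ?K (t - s)"
        using \<delta>(2)[of "t - s"] True a service_tail_0 by (cases "s = t") auto
      ultimately show ?thesis using True by simp
    qed (simp add: K01)
    show "0 \<le> indicator {0..t} s * ?K (t - s)" by (simp add: K01)
  qed
  finally show ?thesis by (simp add: set_lebesgue_integral_def)
qed

end

section \<open>Laws of the arrival processes\<close>

lemma poisson_process_increments: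
  assumes prob: "prob_space M" and N: "poisson_process M r N" and \<tau>: "0 \<le> \<tau> 0" "mono \<tau>"
  shows "measure M {\<omega> \<in> space M. \<forall>i<n. N (\<tau> (Suc i)) \<omega> - N (\<tau> i) \<omega> = k i} =
    (\<integral>\<omega>. (\<Prod>i<n. poisson_mass (LINT s:{\<tau> i..\<tau> (Suc i)}|lborel. r) (k i)) \<partial>M)"
proof -
  interpret prob_space M by (rule prob)
  have \<tau>0: "0 \<le> \<tau> i" and \<tau>S: "\<tau> i \<le> \<tau> (Suc i)" for i
    using \<tau>(1) monoD[OF \<tau>(2), of 0 i] monoD[OF \<tau>(2), of i "Suc i"] by auto
  have law: "prob {\<omega> \<in> space M. N (\<tau> (Suc i)) \<omega> - N (\<tau> i) \<omega> = k i} = poisson_mass (LINT s:{\<tau> i..\<tau> (Suc i)}|lborel. r) (k i)" for i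
  proof -
    have "(LINT s:{\<tau> i..\<tau> (Suc i)}|lborel. r) = r * (\<tau> (Suc i) - \<tau> i)"
      using \<tau>S[of i] by (simp add: set_lebesgue_integral_def mult.commute)
    then show ?thesis using N \<tau>0[of i] \<tau>S[of i] by (simp add: poisson_process_def)
  qed
  show ?thesis
  proof (cases "n = 0")
    case True
    then show ?thesis by (simp add: prob_space)
  next
    case False
    have "indep_vars (\<lambda>_. count_space UNIV) (\<lambda>i \<omega>. N (\<tau> (Suc i)) \<omega> - N (\<tau> i) \<omega>) {..<n}"
      using N \<tau> unfolding poisson_process_def by blast
    then have "prob (\<Inter>i\<in>{..<n}. (\<lambda>\<omega>. N (\<tau> (Suc i)) \<omega> - N (\<tau> i) \<omega>) -` {k i} \<inter> space M)
      = (\<Prod>i\<in>{..<n}. prob ((\<lambda>\<omega>. N (\<tau> (Suc i)) \<omega> - N (\<tau> i) \<omega>) -` {k i} \<inter> space M))"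
      by (rule indep_varsD) (use False in auto)
    moreover have "(\<Inter>i\<in>{..<n}. (\<lambda>\<omega>. N (\<tau> (Suc i)) \<omega> - N (\<tau> i) \<omega>) -` {k i} \<inter> space M)
      = {\<omega> \<in> space M. \<forall>i<n. N (\<tau> (Suc i)) \<omega> - N (\<tau> i) \<omega> = k i}"
      using False by auto
    moreover have "(\<lambda>\<omega>. N (\<tau> (Suc i)) \<omega> - N (\<tau> i) \<omega>) -` {k i} \<inter> space M = {\<omega> \<in> space M. N (\<tau> (Suc i)) \<omega> - N (\<tau> i) \<omega> = k i}" for i
      by auto
    ultimately have "prob {\<omega> \<in> space M. \<forall>i<n. N (\<tau> (Suc i)) \<omega> - N (\<tau> i) \<omega> = k i} =
      (\<Prod>i<n. poisson_mass (LINT s:{\<tau> i..\<tau> (Suc i)}|lborel. r) (k i))"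
      by (simp only: law)
    then show ?thesis by (simp add: prob_space)
  qed
qed

text \<open>Taking means removes the conditioning and leaves the mixed law of the increments.\<close>

lemma doubly_stochastic_poisson_increments:
  assumes prob: "prob_space M" and G: "subalgebra M G" and N: "doubly_stochastic_poisson M G \<Lambda> N"
    and \<Lambda>: "(\<lambda>(s, \<omega>). \<Lambda>' s \<omega>) \<in> borel_measurable (borel \<Otimes>\<^sub>M M)" "\<And>s \<omega>. 0 \<le> s \<Longrightarrow> \<Lambda> s \<omega> = \<Lambda>' s \<omega>"
    and \<tau>: "0 \<le> \<tau> 0" "mono \<tau>"
  shows "measure M {\<omega> \<in> space M. \<forall>i<n. N (\<tau> (Suc i)) \<omega> - N (\<tau> i) \<omega> = k i} =
    (\<integral>\<omega>. (\<Prod>i<n. poisson_mass (LINT s:{\<tau> i..\<tau> (Suc i)}|lborel. \<Lambda>' s \<omega>) (k i)) \<partial>M)"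
proof -
  interpret prob_space M by (rule prob)
  interpret sub: finite_measure_subalgebra M G by unfold_locales (rule G)
  note [measurable] = \<Lambda>(1)
  have \<tau>0: "0 \<le> \<tau> i" for i
    using \<tau>(1) monoD[OF \<tau>(2), of 0 i] by auto
  have [measurable]: "N (\<tau> i) \<in> M \<rightarrow>\<^sub>M count_space UNIV" for i
    using N \<tau>0 by (simp add: doubly_stochastic_poisson_def counting_process_def)
  let ?E = "{\<omega> \<in> space M. \<forall>i<n. N (\<tau> (Suc i)) \<omega> - N (\<tau> i) \<omega> = k i}"
  have E [measurable]: "?E \<in> sets M" by measurable
  have same: "(LINT s:{\<tau> i..\<tau> (Suc i)}|lborel. \<Lambda> s \<omega>) = (LINT s:{\<tau> i..\<tau> (Suc i)}|lborel. \<Lambda>' s \<omega>)" for i \<omega>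
    by (intro set_lebesgue_integral_cong) (use \<tau>0[of i] \<Lambda>(2) in auto)
  have "AE \<omega> in M. real_cond_exp M G (indicator {\<omega> \<in> space M. \<forall>i<n. N (\<tau>' (Suc i)) \<omega> - N (\<tau>' i) \<omega> = k' i}) \<omega> =
      (\<Prod>i<n. poisson_mass (LINT s:{\<tau>' i..\<tau>' (Suc i)}|lborel. \<Lambda> s \<omega>) (k' i))"
    if "0 \<le> \<tau>' 0 \<and> mono \<tau>'" for \<tau>' :: "nat \<Rightarrow> real" and n and k' :: "nat \<Rightarrow> nat"
    using N that unfolding doubly_stochastic_poisson_def by blast
  from this[of \<tau> n k] \<tau>
  have ae: "AE \<omega> in M. real_cond_exp M G (indicator ?E) \<omega> = (\<Prod>i<n. poisson_mass (LINT s:{\<tau> i..\<tau> (Suc i)}|lborel. \<Lambda>' s \<omega>) (k i))"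
    unfolding same by blast
  have iE: "integrable M (indicator ?E :: 'a \<Rightarrow> real)"
    by (intro integrable_real_indicator) (auto simp: less_top[symmetric])
  have "prob ?E = (\<integral>\<omega>. indicator ?E \<omega> \<partial>M)" by simp
  also have "\<dots> = (\<integral>\<omega>. real_cond_exp M G (indicator ?E) \<omega> \<partial>M)"
    by (rule sub.real_cond_exp_int(2)[OF iE, symmetric])
  also have "\<dots> = (\<integral>\<omega>. (\<Prod>i<n. poisson_mass (LINT s:{\<tau> i..\<tau> (Suc i)}|lborel. \<Lambda>' s \<omega>) (k i)) \<partial>M)"
  proof (rule integral_cong_AE)
    show "(\<lambda>\<omega>. \<Prod>i<n. poisson_mass (LINT s:{\<tau> i..\<tau> (Suc i)}|lborel. \<Lambda>' s \<omega>) (k i)) \<in> borel_measurable M"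
      unfolding poisson_mass_def set_lebesgue_integral_def by measurable
  qed (use ae in auto)
  finally show ?thesis .
qed

lemma (in prob_space) expectation_poisson_mass:
  assumes Q [measurable]: "Q \<in> M \<rightarrow>\<^sub>M count_space UNIV" and m: "0 \<le> m"
    and law: "\<And>k. prob {\<omega> \<in> space M. Q \<omega> = k} = poisson_mass m k"
  shows "(\<integral>\<omega>. real (Q \<omega>) \<partial>M) = m"
proof -
  have s: "(\<lambda>j. real j * poisson_mass m j) sums m"
  proof -
    have "(\<lambda>j. m * (poisson_mass m j * 1 ^ j)) sums (m * exp (- m * (1 - 1)))"
      by (intro sums_mult poisson_mass_sums)
    moreover have "real (Suc j) * poisson_mass m (Suc j) = m * (poisson_mass m j * 1 ^ j)" for j
      by (simp add: poisson_mass_def field_simps del: of_nat_Suc)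
    ultimately have "(\<lambda>j. real (Suc j) * poisson_mass m (Suc j)) sums m" by simp
    then show ?thesis by (subst (asm) sums_Suc_iff) simp
  qed
  have "(\<integral>\<^sup>+\<omega>. ennreal (real (Q \<omega>)) \<partial>M) = (\<integral>\<^sup>+\<omega>. (\<Sum>j. ennreal (real j) * indicator {\<omega> \<in> space M. Q \<omega> = j} \<omega>) \<partial>M)"
  proof (rule nn_integral_cong)
    fix \<omega> assume w: "\<omega> \<in> space M"
    have "(\<Sum>j. ennreal (real j) * indicator {\<omega> \<in> space M. Q \<omega> = j} \<omega>) = (\<Sum>j\<in>{Q \<omega>}. ennreal (real j) * indicator {\<omega> \<in> space M. Q \<omega> = j} \<omega>)"
      by (rule suminf_finite) auto
    then show "ennreal (real (Q \<omega>)) = (\<Sum>j. ennreal (real j) * indicator {\<omega> \<in> space M. Q \<omega> = j} \<omega>)"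
      using w by simp
  qed
  also have "\<dots> = (\<Sum>j. \<integral>\<^sup>+\<omega>. ennreal (real j) * indicator {\<omega> \<in> space M. Q \<omega> = j} \<omega> \<partial>M)"
    by (rule nn_integral_suminf) measurable
  also have "\<dots> = (\<Sum>j. ennreal (real j * poisson_mass m j))"
    by (intro suminf_cong) (simp add: nn_integral_cmult emeasure_eq_measure law ennreal_mult' )
  also have "\<dots> = ennreal m"
    by (rule suminf_ennreal_eq[OF _ s]) (simp add: poisson_mass_nonneg m)
  finally have "(\<integral>\<^sup>+\<omega>. ennreal (real (Q \<omega>)) \<partial>M) = ennreal m" .
  then show ?thesis using m by (subst integral_eq_nn_integral) auto
qed

section \<open>The expansion of the queue length distribution\<close>

theorem theorem4:
  fixes M :: "'w measure"
    and P :: "'s::polish_space \<Rightarrow> 'w measure"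
    and X :: "real \<Rightarrow> 'w \<Rightarrow> 's"
    and v f :: "'s \<Rightarrow> real"
    and \<pi> :: "'s measure"
    and N :: "real \<Rightarrow> real \<Rightarrow> 'w \<Rightarrow> nat"
    and V :: "nat \<Rightarrow> 'w \<Rightarrow> real"
    and \<kappa> :: "real \<Rightarrow> real"
    and Q :: "real \<Rightarrow> real \<Rightarrow> 'w \<Rightarrow> nat"
    and Kbar g :: "_ \<Rightarrow> real"
    and lambda_star \<sigma>2 \<eta>2 EQ0 t :: real
    and x :: 's
    and k :: nat
  assumes markov: "markov_process M P X"
    and ergodic: "geometrically_ergodic P X v \<pi>"
    and f_cont: "continuous_on UNIV f"
    and f_bounded: "bounded (range f)"
    and f_nonneg: "\<And>y. 0 \<le> f y"
  defines "lambda_star \<equiv> \<integral>y. f y \<partial>\<pi>"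
  assumes lambda_pos: "0 < lambda_star"
    and arrivals: "\<And>\<epsilon> y. 0 < \<epsilon> \<Longrightarrow>
      doubly_stochastic_poisson (P y) (generated (P y) borel X {0..})
        (\<lambda>s \<omega>. f (X (s / \<epsilon>) \<omega>)) (N \<epsilon>)"
    and arrivals0: "poisson_process M lambda_star (N 0)"
    and density_nonneg: "\<And>u. 0 \<le> u \<Longrightarrow> 0 \<le> \<kappa> u"
    and services: "\<And>y. service_times (P y) V \<kappa>"
    and services0: "service_times M V \<kappa>"
    and indep: "\<And>\<epsilon> y. 0 < \<epsilon> \<Longrightarrow> independent_of_arrivals (P y) (N \<epsilon>) V"
    and indep0: "independent_of_arrivals M (N 0) V"
    and t_pos: "0 < t"
  defines "Q \<equiv> \<lambda>\<epsilon>. number_in_system (N \<epsilon>) V"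
    and "EQ0 \<equiv> \<integral>\<omega>. real (Q 0 t \<omega>) \<partial>M"
    and "Kbar \<equiv> service_tail M V"
    and "g \<equiv> potential P X \<pi> f"
    and "\<sigma>2 \<equiv> sigma_sq P X \<pi> f"
    and "\<eta>2 \<equiv> eta_sq \<sigma>2 Kbar \<kappa> t"
  shows "\<exists>r :: real \<Rightarrow> real.
    ((\<lambda>\<epsilon>. r \<epsilon> / \<epsilon>) \<longlongrightarrow> 0) (at_right 0) \<and>
    (\<forall>\<epsilon>>0.
      measure (P x) {\<omega> \<in> space M. Q \<epsilon> t \<omega> = k} =
      measure M {\<omega> \<in> space M. Q 0 t \<omega> = k} *
        (1 + \<epsilon> * ((real k / EQ0 - 1) * g x * Kbar t
                 + 1 / 2 * (1 - 2 * real k / EQ0 + real k * (real k - 1) / EQ0\<^sup>2) * \<eta>2)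
           + r \<epsilon>))"
proof -
  have probM: "prob_space M" using markov by (simp add: markov_process_def)
  interpret M: prob_space M by (rule probM)
  have f_meas [measurable]: "f \<in> borel_measurable borel"
    by (rule borel_measurable_continuous_onI[OF f_cont])
  obtain B where B: "\<And>y. \<bar>f y\<bar> \<le> B" using f_bounded by (auto simp: bounded_iff)
  define C where "C = B + \<bar>\<integral>z. f z \<partial>\<pi>\<bar> + 1"
  have B0: "0 \<le> B" by (rule order_trans[OF abs_ge_zero B])
  obtain d \<alpha> where d\<alpha>: "0 \<le> d" "0 < \<alpha>"
    "\<And>u x h. \<lbrakk>0 \<le> u; h \<in> borel_measurable borel; \<And>y. \<bar>h y\<bar> \<le> v y\<rbrakk> \<Longrightarrow>
       \<bar>(\<integral>\<omega>. h (X u \<omega>) \<partial>P x) - (\<integral>y. h y \<partial>\<pi>)\<bar> \<le> d * v x * exp (- \<alpha> * u)"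
    by (rule ergodicity_constants[OF ergodic]) blast
  interpret E: ergodic_modulation M P X v f \<pi> d \<alpha> C
  proof (rule ergodic_modulation.intro)
    show "\<bar>centred \<pi> f y\<bar> \<le> C" for y
      using B[of y] unfolding centred_def C_def by linarith
    show "markov_process M P X" by (rule markov)
    show "v \<in> borel_measurable borel" "prob_space \<pi>" "sets \<pi> = sets borel" "\<And>y. 1 \<le> v y"
      using ergodic unfolding geometrically_ergodic_def by blast+
    show "0 \<le> d" "0 < \<alpha>" by (rule d\<alpha>)+
    show "0 < C" using B0 unfolding C_def by linarith
    show "\<bar>(\<integral>\<omega>. h (X u \<omega>) \<partial>P x) - (\<integral>y. h y \<partial>\<pi>)\<bar> \<le> d * v x * exp (- \<alpha> * u)"
      if "0 \<le> u" "h \<in> borel_measurable borel" "\<And>y. \<bar>h y\<bar> \<le> v y" for u x h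
      by (rule d\<alpha>(3)[OF that])
  qed (rule f_meas)
  interpret Px: prob_space "P x" by (rule E.prob_space_P)
  have K_cont: "isCont Kbar s" for s
    unfolding Kbar_def by (rule isCont_service_tail[OF probM services0 density_nonneg])
  have K_meas [measurable]: "Kbar \<in> borel_measurable borel"
    by (intro borel_measurable_continuous_onI continuous_at_imp_continuous_on) (auto simp: K_cont)
  have K01: "0 \<le> Kbar u" "Kbar u \<le> 1" for u by (simp_all add: Kbar_def service_tail_def)
  have tailM: "measure M {\<omega> \<in> space M. u < V n \<omega>} = Kbar u" if "1 \<le> n" for n u
    unfolding Kbar_def service_tail_def service_tail_density[OF probM services0 that]
      service_tail_density[OF probM services0 order_refl] ..
  have tailP: "measure (P x) {\<omega> \<in> space (P x). u < V n \<omega>} = Kbar u" if "1 \<le> n" for n u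
    unfolding service_tail_density[OF E.prob_space_P services that] 
      service_tail_density[OF probM services0 order_refl, symmetric] Kbar_def service_tail_def ..
  \<comment> \<open>The probability that a customer arriving at time \<open>u\<close> is present at time \<open>t\<close>.\<close>
  define kern where "kern u = Kbar (t - u)" for u
  have kern_cont: "isCont kern u" for u
    unfolding kern_def by (rule isCont_o2[where g=Kbar]) (auto intro!: continuous_intros K_cont)
  have kern1: "\<bar>kern u\<bar> \<le> 1" for u using K01 by (simp add: kern_def)
  define m where "m = (LINT s:{0..t}|lborel. lambda_star * Kbar (t - s))"
  have m_pos: "0 < m"
    using integral_service_tail_pos[OF probM services0 density_nonneg t_pos] lambda_pos
    by (simp add: m_def Kbar_def)

  interpret Q0: cox_infinite_server M "N 0" V "\<lambda>_ _. lambda_star" Kbar lambda_star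
  proof
    show "counting_process M (N 0)" using arrivals0 by (simp add: poisson_process_def)
    show "M.indep_vars (\<lambda>_. borel) V {1..}" using services0 by (simp add: service_times_def)
    show "M.prob {\<omega> \<in> space M. \<forall>i<n. N 0 (\<tau> (Suc i)) \<omega> - N 0 (\<tau> i) \<omega> = k i} =
      (\<integral>\<omega>. (\<Prod>i<n. poisson_mass (LINT s:{\<tau> i..\<tau> (Suc i)}|lborel. lambda_star) (k i)) \<partial>M)"
      if "0 \<le> \<tau> 0" "mono \<tau>" for \<tau> n k
      by (rule poisson_process_increments[OF probM arrivals0 that])
  qed (use tailM indep0 lambda_pos in auto)
  have load0: "Q0.load t \<omega> = m" for \<omega> by (simp add: Q0.load_def m_def)
  have law0: "M.prob {\<omega> \<in> space M. Q 0 t \<omega> = j} = poisson_mass m j" for j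
    using Q0.number_in_system_mass[of t j] t_pos by (simp add: Q_def load0 M.prob_space)
  have EQ0: "EQ0 = m"
    unfolding EQ0_def
  proof (rule M.expectation_poisson_mass[OF _ _ law0])
    show "Q 0 t \<in> M \<rightarrow>\<^sub>M count_space UNIV"
      unfolding Q_def using t_pos by (intro Q0.number_in_system_random_variable) simp
  qed (use m_pos in simp)

  have load: "measure (P x) {\<omega> \<in> space M. Q \<epsilon> t \<omega> = k} = (\<integral>\<omega>. poisson_mass (m + E.fluctuation kern \<epsilon> t \<omega>) k \<partial>P x)"
    and pos: "\<And>\<omega>. \<omega> \<in> space M \<Longrightarrow> 0 \<le> m + E.fluctuation kern \<epsilon> t \<omega>"
    if \<epsilon>: "0 < \<epsilon>" for \<epsilon>
  proof -
    have fY [measurable]: "(\<lambda>(s, \<omega>). f (E.Y (s / \<epsilon>) \<omega>)) \<in> borel_measurable (borel \<Otimes>\<^sub>M M)" by measurable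
    have fYP: "(\<lambda>(s, \<omega>). f (E.Y (s / \<epsilon>) \<omega>)) \<in> borel_measurable (borel \<Otimes>\<^sub>M P x)" by measurable
    have sub: "subalgebra (P x) (generated (P x) borel X {0..})"
      by (intro subalgebra_generated) (use E.X_measurable in auto)
    interpret Q\<epsilon>: cox_infinite_server "P x" "N \<epsilon>" V "\<lambda>s \<omega>. f (E.Y (s / \<epsilon>) \<omega>)" Kbar B
    proof
      show "counting_process (P x) (N \<epsilon>)" using arrivals[OF \<epsilon>] by (simp add: doubly_stochastic_poisson_def)
      show "Px.indep_vars (\<lambda>_. borel) V {1..}" using services by (simp add: service_times_def)
      show "independent_of_arrivals (P x) (N \<epsilon>) V" by (rule indep[OF \<epsilon>])
      show "(\<lambda>(s, \<omega>). f (E.Y (s / \<epsilon>) \<omega>)) \<in> borel_measurable (borel \<Otimes>\<^sub>M P x)" by (rule fYP)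
      show "Px.prob {\<omega> \<in> space (P x). \<forall>i<n. N \<epsilon> (\<tau> (Suc i)) \<omega> - N \<epsilon> (\<tau> i) \<omega> = k i} =
        (\<integral>\<omega>. (\<Prod>i<n. poisson_mass (LINT s:{\<tau> i..\<tau> (Suc i)}|lborel. f (E.Y (s / \<epsilon>) \<omega>)) (k i)) \<partial>P x)"
        if "0 \<le> \<tau> 0" "mono \<tau>" for \<tau> n k
        by (rule doubly_stochastic_poisson_increments[OF E.prob_space_P sub arrivals[OF \<epsilon>] fYP _ that])
           (use \<epsilon> in \<open>auto simp: E.Y_def\<close>)
      show "f (E.Y (s / \<epsilon>) \<omega>) \<le> B" for s \<omega> using B[of "E.Y (s / \<epsilon>) \<omega>"] by simp
    qed (use tailP f_nonneg in auto)
    have ld: "Q\<epsilon>.load t \<omega> = m + E.fluctuation kern \<epsilon> t \<omega>" if w: "\<omega> \<in> space M" for \<omega>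
    proof -
      have [measurable]: "(\<lambda>s. f (E.Y (s / \<epsilon>) \<omega>)) \<in> borel_measurable borel"
        using measurable_compose[OF measurable_Pair2'[OF w] fY] by simp
      have i1: "set_integrable lborel {0..t} (\<lambda>s. f (E.Y (s / \<epsilon>) \<omega>) * Kbar (t - s))"
      proof (rule set_integrable_bounded[where C="B * 1"])
        show "\<bar>f (E.Y (s / \<epsilon>) \<omega>) * Kbar (t - s)\<bar> \<le> B * 1" for s
          unfolding abs_mult by (intro mult_mono B) (auto simp: K01 B0)
      qed (auto simp: emeasure_lborel_Icc_eq)
      have i2: "set_integrable lborel {0..t} (\<lambda>s. lambda_star * Kbar (t - s))"
      proof (rule set_integrable_bounded[where C="lambda_star * 1"])
        show "\<bar>lambda_star * Kbar (t - s)\<bar> \<le> lambda_star * 1" for s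
          unfolding abs_mult using lambda_pos by (intro mult_mono) (auto simp: K01)
      qed (auto simp: emeasure_lborel_Icc_eq)
      have "E.fluctuation kern \<epsilon> t \<omega> = (LINT s:{0..t}|lborel. f (E.Y (s / \<epsilon>) \<omega>) * Kbar (t - s) - lambda_star * Kbar (t - s))"
        unfolding E.fluctuation_def kern_def centred_def lambda_star_def
        by (intro set_lebesgue_integral_cong) (auto simp: algebra_simps)
      also have "\<dots> = Q\<epsilon>.load t \<omega> - m"
        unfolding Q\<epsilon>.load_def m_def by (rule set_integral_diff(2)[OF i1 i2])
      finally show ?thesis by simp
    qed
    show "0 \<le> m + E.fluctuation kern \<epsilon> t \<omega>" if "\<omega> \<in> space M" for \<omega>
      using Q\<epsilon>.load_nonneg[of t \<omega>] ld[OF that] by simp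
    have "measure (P x) {\<omega> \<in> space M. Q \<epsilon> t \<omega> = k} = (\<integral>\<omega>. poisson_mass (Q\<epsilon>.load t \<omega>) k \<partial>P x)"
      using Q\<epsilon>.number_in_system_mass[of t k] t_pos by (simp add: Q_def E.space_P)
    also have "\<dots> = (\<integral>\<omega>. poisson_mass (m + E.fluctuation kern \<epsilon> t \<omega>) k \<partial>P x)"
      by (intro Bochner_Integration.integral_cong refl) (simp add: ld E.space_P)
    finally show "measure (P x) {\<omega> \<in> space M. Q \<epsilon> t \<omega> = k} = (\<integral>\<omega>. poisson_mass (m + E.fluctuation kern \<epsilon> t \<omega>) k \<partial>P x)" .
  qed

  define b where "b = (real k / EQ0 - 1) * g x * Kbar t
                 + 1 / 2 * (1 - 2 * real k / EQ0 + real k * (real k - 1) / EQ0\<^sup>2) * \<eta>2"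
  define p0 where "p0 = poisson_mass m k"
  have p0: "0 < p0" using m_pos by (simp add: p0_def poisson_mass_def)
  define p where "p \<epsilon> = measure (P x) {\<omega> \<in> space M. Q \<epsilon> t \<omega> = k}" for \<epsilon>
  have eta: "\<eta>2 = sigma_sq P X \<pi> f * (LINT u:{0..t}|lborel. (kern u)\<^sup>2)"
    unfolding \<eta>2_def Kbar_def kern_def \<sigma>2_def
    using t_pos by (intro eta_sq_eq[OF probM services0 density_nonneg]) auto
  have "((\<lambda>\<epsilon>. ((\<integral>\<omega>. poisson_mass (m + E.fluctuation kern \<epsilon> t \<omega>) k \<partial>P x) - poisson_mass m k) / \<epsilon>) \<longlongrightarrow> p0 * b) (at_right 0)"
    using E.expectation_poisson_mass_expansion[OF kern_cont kern1 t_pos m_pos pos, where j=k and x=x]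
    by (simp add: b_def p0_def EQ0 eta g_def kern_def mult.assoc)
  then have lim: "((\<lambda>\<epsilon>. (p \<epsilon> - p0) / \<epsilon>) \<longlongrightarrow> p0 * b) (at_right 0)"
    by (rule Lim_transform_eventually)
       (auto simp: eventually_at_right_field p_def p0_def load intro!: exI[of _ 1])
  define r where "r \<epsilon> = p \<epsilon> / p0 - 1 - \<epsilon> * b" for \<epsilon>
  have "((\<lambda>\<epsilon>. (p \<epsilon> - p0) / \<epsilon> / p0 - b) \<longlongrightarrow> p0 * b / p0 - b) (at_right 0)"
    using p0 by (intro tendsto_intros lim) auto
  then have "((\<lambda>\<epsilon>. (p \<epsilon> - p0) / \<epsilon> / p0 - b) \<longlongrightarrow> 0) (at_right 0)" using p0 by simp
  then have "((\<lambda>\<epsilon>. r \<epsilon> / \<epsilon>) \<longlongrightarrow> 0) (at_right 0)"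
  proof (rule Lim_transform_eventually)
    have "(p \<epsilon> - p0) / \<epsilon> / p0 - b = r \<epsilon> / \<epsilon>" if "0 < \<epsilon>" for \<epsilon>
      using that p0 by (simp add: r_def field_simps)
    then show "\<forall>\<^sub>F \<epsilon> in at_right 0. (p \<epsilon> - p0) / \<epsilon> / p0 - b = r \<epsilon> / \<epsilon>"
      by (auto simp: eventually_at_right_field intro!: exI[of _ 1])
  qed
  moreover have "p \<epsilon> = p0 * (1 + \<epsilon> * b + r \<epsilon>)" for \<epsilon> using p0 by (simp add: r_def field_simps)
  ultimately show ?thesis
    unfolding law0 p_def b_def p0_def by (intro exI[of _ r]) auto
qed

end
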